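(* There is a zero-error quantum algorithm for ordered search on lists of length $n$ whose expected quantum query complexity is $$\frac{\ln n}{\pi}+o(\ln n)\qquad(n\to\infty).$$
   Context: Ordered search: for $n\ge1$ the possible inputs are the strings $x=0^j1^{n-j}\in\{0,1\}^n$ with $j\in\{0,\ldots,n-1\}$ unknown, so $x_i=\mathbf 1[i\ge j]$ for $i\in\{0,\dots,n-1\}$; the goal is to output $j$. Quantum query access to $x$ is provided by the phase oracle $O_x|i\rangle=(-1)^{x_i}|i\rangle$. A query algorithm interleaves input-independent unitaries (on a Hilbert space that may include workspace, possibly infinite-dimensional such as $L^2(\mathbb R)$) and measurements with applications of $O_x$; each application of $O_x$ costs one query. A classical comparison query (learning a bit $x_i$) also counts as a query. An algorithm is zero-error if it never outputs an incorrect value but may use a random number of queries; its expected query complexity is the expected number of queries (maximized over inputs $x$). *)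

theory Defs
  imports "HOL-Probability.Probability" "HOL-Library.Landau_Symbols"
begin

text \<open>
  The state space of a query algorithm is the tensor product of the query register, with basis
  labels \<open>i < n\<close>, and a workspace. Every separable complex Hilbert space is unitarily equivalent
  to \<open>\<ell>\<^sup>2(W)\<close> for some \<open>W \<subseteq> \<nat>\<close> (for \<open>L\<^sup>2(\<real>)\<close> take \<open>W = UNIV\<close>), so the state space is
  \<open>\<ell>\<^sup>2({0,\<dots>,n-1} \<times> W)\<close>; a state maps the basis label \<open>(i, w)\<close> to its amplitude.
\<close>

type_synonym state = "nat \<times> nat \<Rightarrow> complex"

definition hilbert_space :: "nat \<Rightarrow> nat set \<Rightarrow> state set" where
  "hilbert_space n W =
     {\<psi>. (\<forall>p. p \<notin> {..<n} \<times> W \<longrightarrow> \<psi> p = 0) \<and> (\<lambda>p. (cmod (\<psi> p))\<^sup>2) summable_on UNIV}"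

definition state_inner :: "state \<Rightarrow> state \<Rightarrow> complex" where
  "state_inner \<phi> \<psi> = (\<Sum>\<^sub>\<infinity>p. cnj (\<phi> p) * \<psi> p)"

definition state_norm :: "state \<Rightarrow> real" where
  "state_norm \<psi> = sqrt (\<Sum>\<^sub>\<infinity>p. (cmod (\<psi> p))\<^sup>2)"

definition normalized :: "state \<Rightarrow> state" where
  "normalized \<psi> = (\<lambda>p. \<psi> p / complex_of_real (state_norm \<psi>))"

text \<open>Operators are only constrained on the Hilbert space \<open>H\<close>; their values elsewhere are irrelevant.\<close>

definition linear_operator :: "state set \<Rightarrow> (state \<Rightarrow> state) \<Rightarrow> bool" where
  "linear_operator H T \<longleftrightarrow>
     (\<forall>\<psi>\<in>H. T \<psi> \<in> H) \<and>
     (\<forall>\<phi>\<in>H. \<forall>\<psi>\<in>H. T (\<lambda>p. \<phi> p + \<psi> p) = (\<lambda>p. T \<phi> p + T \<psi> p)) \<and>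
     (\<forall>c. \<forall>\<psi>\<in>H. T (\<lambda>p. c * \<psi> p) = (\<lambda>p. c * T \<psi> p))"

definition unitary_operator :: "state set \<Rightarrow> (state \<Rightarrow> state) \<Rightarrow> bool" where
  "unitary_operator H U \<longleftrightarrow>
     linear_operator H U \<and> U ` H = H \<and>
     (\<forall>\<phi>\<in>H. \<forall>\<psi>\<in>H. state_inner (U \<phi>) (U \<psi>) = state_inner \<phi> \<psi>)"

definition orthogonal_projection :: "state set \<Rightarrow> (state \<Rightarrow> state) \<Rightarrow> bool" where
  "orthogonal_projection H P \<longleftrightarrow>
     linear_operator H P \<and> (\<forall>\<psi>\<in>H. P (P \<psi>) = P \<psi>) \<and>
     (\<forall>\<phi>\<in>H. \<forall>\<psi>\<in>H. state_inner (P \<phi>) \<psi> = state_inner \<phi> (P \<psi>))"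

text \<open>
  Outcomes are natural numbers; a measurement with finitely many outcomes has \<open>P k = 0\<close> for the
  unused \<open>k\<close>. The last conjunct is the completeness relation \<open>\<Sum>\<^sub>k P\<^sub>k = I\<close> in the strong topology.
\<close>

definition projective_measurement :: "state set \<Rightarrow> (nat \<Rightarrow> state \<Rightarrow> state) \<Rightarrow> bool" where
  "projective_measurement H P \<longleftrightarrow>
     (\<forall>k. orthogonal_projection H (P k)) \<and>
     (\<forall>k l. k \<noteq> l \<longrightarrow> (\<forall>\<psi>\<in>H. P k (P l \<psi>) = (\<lambda>p. 0))) \<and>
     (\<forall>\<psi>\<in>H. (\<lambda>N. state_norm (\<lambda>p. \<psi> p - (\<Sum>k<N. P k \<psi> p))) \<longlonglongrightarrow> 0)"

definition phase_oracle :: "(nat \<Rightarrow> bool) \<Rightarrow> state \<Rightarrow> state" where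
  "phase_oracle x \<psi> = (\<lambda>(i, w). (- 1) ^ of_bool (x i) * \<psi> (i, w))"

text \<open>
  Adaptive query programs. Being a codatatype, a program may be an infinite tree, so the number of
  steps need not be bounded. Continuations depend on measurement outcomes and on classically
  queried bits, but never on the input itself.
\<close>

codatatype program =
    Output nat
  | Unitary "state \<Rightarrow> state" program
  | Measure "nat \<Rightarrow> state \<Rightarrow> state" "nat \<Rightarrow> program"
  | Quantum_Query program
  | Classical_Query nat "bool \<Rightarrow> program"

coinductive valid_program :: "nat \<Rightarrow> state set \<Rightarrow> program \<Rightarrow> bool" for n H where
  "valid_program n H (Output k)"
| "unitary_operator H U \<Longrightarrow> valid_program n H A \<Longrightarrow> valid_program n H (Unitary U A)"
| "projective_measurement H P \<Longrightarrow> (\<And>k. valid_program n H (F k)) \<Longrightarrow>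
     valid_program n H (Measure P F)"
| "valid_program n H A \<Longrightarrow> valid_program n H (Quantum_Query A)"
| "i < n \<Longrightarrow> (\<And>b. valid_program n H (F b)) \<Longrightarrow> valid_program n H (Classical_Query i F)"

text \<open>
  \<open>run x A \<psi>\<close> is the joint distribution of the output and the number of queries made when \<open>A\<close> is
  executed on input \<open>x\<close> from the unit vector \<open>\<psi>\<close>. Missing probability mass is the probability of
  not halting. In the measurement clause, the Born weights sum to 1 for a unit vector and a
  complete measurement, as required by \<open>embed_pmf\<close>.
\<close>

partial_function (spmf) run :: "(nat \<Rightarrow> bool) \<Rightarrow> program \<Rightarrow> state \<Rightarrow> (nat \<times> nat) spmf" where
  "run x A \<psi> = (case A of
       Output k \<Rightarrow> return_spmf (k, 0)
     | Unitary U B \<Rightarrow> run x B (U \<psi>)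
     | Measure P F \<Rightarrow>
         bind_spmf (spmf_of_pmf (embed_pmf (\<lambda>k. (state_norm (P k \<psi>))\<^sup>2)))
           (\<lambda>k. run x (F k) (normalized (P k \<psi>)))
     | Quantum_Query B \<Rightarrow> map_spmf (map_prod id Suc) (run x B (phase_oracle x \<psi>))
     | Classical_Query i F \<Rightarrow> map_spmf (map_prod id Suc) (run x (F (x i)) \<psi>))"

record query_algorithm =
  workspace :: "nat set"
  initial :: state
  prog :: program

definition valid_algorithm :: "nat \<Rightarrow> query_algorithm \<Rightarrow> bool" where
  "valid_algorithm n A \<longleftrightarrow>
     initial A \<in> hilbert_space n (workspace A) \<and> state_norm (initial A) = 1 \<and>
     valid_program n (hilbert_space n (workspace A)) (prog A)"

definition execute :: "(nat \<Rightarrow> bool) \<Rightarrow> query_algorithm \<Rightarrow> (nat \<times> nat) spmf" where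
  "execute x A = run x (prog A) (initial A)"

text \<open>The string \<open>0\<^sup>j1\<^sup>n\<^sup>-\<^sup>j\<close>; only the positions \<open>i < n\<close> are ever accessed.\<close>

definition ordered_input :: "nat \<Rightarrow> nat \<Rightarrow> bool" where
  "ordered_input j i \<longleftrightarrow> j \<le> i"

text \<open>The algorithm halts almost surely, and any output that occurs is correct.\<close>

definition zero_error_ordered_search :: "nat \<Rightarrow> query_algorithm \<Rightarrow> bool" where
  "zero_error_ordered_search n A \<longleftrightarrow> valid_algorithm n A \<and>
     (\<forall>j<n. lossless_spmf (execute (ordered_input j) A) \<and>
            (\<forall>(k, q) \<in> set_spmf (execute (ordered_input j) A). k = j))"

definition expected_queries :: "(nat \<Rightarrow> bool) \<Rightarrow> query_algorithm \<Rightarrow> ennreal" where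
  "expected_queries x A = (\<integral>\<^sup>+ (k, q). ennreal (real q) \<partial>measure_spmf (execute x A))"

definition expected_query_complexity :: "nat \<Rightarrow> query_algorithm \<Rightarrow> ennreal" where
  "expected_query_complexity n A = (SUP j\<in>{..<n}. expected_queries (ordered_input j) A)"

end

theory Submission
  imports Defs "HOL-Real_Asymp.Real_Asymp"
begin

text \<open>
  Place the answer at the origin of a one-dimensional lattice. The oracle is then the sign function of
  the position, and its partner is the discrete Hilbert transform, a translation-invariant (hence
  input-independent) orthogonal operator that plays the role of the sign of the momentum. On even wave
  packets \<open>|y|\<^sup>-\<^sup>1\<^sup>/\<^sup>2 g (ln |y|)\<close> with slowly varying \<open>g\<close>, the product of the two acts, up to
  second-order errors, as the translation \<open>g (u) \<mapsto> g (u + pi)\<close>: on the Mellin side it is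
  multiplication by a unimodular function whose group delay at frequency 0 is \<open>pi\<close>. So every query
  shrinks the length scale by the factor \<open>exp pi\<close>. A packet that is spread out at scales
  much larger than \<open>n\<close> is nearly independent of the answer; after \<open>ln n / pi + o (ln n)\<close> queries it
  sits within \<open>exp (o (ln n))\<close> of the answer, and a measurement of the position followed by a verified
  classical binary search in a small window finishes the job. If the verification fails, which has
  probability \<open>o (1)\<close>, a full binary search keeps the error zero.

  The packets are \<open>g (u) = sech (\<sigma> (u - c))\<close>, for which the second-order Taylor remainder is
  bounded by \<open>\<sigma>\<^sup>2 g (u)\<close> up to exponential factors; with \<open>L = ln n + 3\<close>, the width \<open>1 / \<sigma>\<close> is of order
  \<open>L powr (3 / 4)\<close>, so that the accumulated error of order \<open>L \<sigma>\<^sup>2\<close> vanishes, and the distance kept from the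
  lattice scale is \<open>b = L powr (7 / 8)\<close>.
\<close>

section \<open>Riemann sums of antitone functions\<close>

text \<open>In the continuum one query multiplies |y|^(s - 1/2) by tan (pi/4 + pi s/2), which is
  unimodular for imaginary s, equals 1 at s = 0 and has derivative pi there. Only this value and
  this derivative are used; they enter as the moments - pi and - pi^2 of the kernel 2 sqrt r / (1 -
  r^2) against 1 and ln r.

  The obstacle is that the kernel has a non-integrable pole at r = 1, while the operator has to be
  exactly orthogonal on a lattice. The convolution kernel 1 / (pi (m + 1/2)) settles both: its rows
  are exactly orthonormal, and its outputs lie midway between its input sites, so the pole is always
  straddled symmetrically and its contribution cancels exactly. What is left are Riemann sums of
  antitone functions. The price is a displacement by half a site per query, a small relative change
  away from the answer.

  Close to the answer the asymptotics fail altogether. There the errors are merely bounded by the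
  packet itself, and the packet is kept away from that region: with center c its mass there is of
  order exp (- 2 \<sigma> c).\<close>

text \<open>Antitonicity compares each cell of width \<open>h\<close> with an increment of the
  antiderivative, so an integrable singularity at 0 costs only the first cell and the integral over
  (0, h/2); the bound by \<open>r powr (- 3 / 4)\<close> makes both O(h^(1/4)). Truncating the
  improper integral at 1/X and X suits the reflection of r to 1/r that evaluates the integrals
  later.\<close>

lemma riemann_sum_antitone:
  fixes \<Phi> F :: "real \<Rightarrow> real"
  assumes anti: "\<And>r s. 0 < r \<Longrightarrow> r \<le> s \<Longrightarrow> \<Phi> s \<le> \<Phi> r"
    and nonneg: "\<And>r. 0 < r \<Longrightarrow> 0 \<le> \<Phi> r"
    and deriv: "\<And>r. 0 < r \<Longrightarrow> (F has_real_derivative \<Phi> r) (at r)"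
    and bound: "\<And>r. 0 < r \<Longrightarrow> \<Phi> r \<le> B * r powr (- 3 / 4)"
    and lim: "((\<lambda>X. F X - F (1 / X)) \<longlongrightarrow> I) at_top"
    and h: "0 < h"
  shows "summable (\<lambda>k. \<Phi> ((real k + 1 / 2) * h))"
    and "\<bar>h * (\<Sum>k. \<Phi> ((real k + 1 / 2) * h)) - I\<bar> \<le> 4 * B * h powr (1 / 4)"
proof -
  define r where "r = (\<lambda>k. (real k + 1 / 2) * h)"
  have r_pos: "0 < r k" for k using h by (simp add: r_def)
  have r_Suc: "r (Suc k) = r k + h" for k by (simp add: r_def algebra_simps)
  have B: "0 \<le> B" using bound[of 1] nonneg[of 1] by simp
  have cell: "(b - a) * \<Phi> b \<le> F b - F a \<and> F b - F a \<le> (b - a) * \<Phi> a"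
    if "0 < a" "a \<le> b" for a b
  proof (cases "a = b")
    case False
    then have "a < b" using that by simp
    moreover have "(F has_real_derivative \<Phi> x) (at x)" if "a \<le> x" for x
      using deriv that \<open>0 < a\<close> by simp
    ultimately obtain z where z: "a < z" "z < b" "F b - F a = (b - a) * \<Phi> z"
      using MVT2[of a b F \<Phi>] by blast
    show ?thesis using z anti[of a z] anti[of z b] that by (auto intro!: mult_left_mono)
  qed simp
  have mono: "F a \<le> F b" if "0 < a" "a \<le> b" for a b
    using cell[OF that] nonneg[of b] that by (smt (verit) mult_nonneg_nonneg)
  \<comment> \<open>The right side is the integral of the bound \<open>B * r powr (- 3 / 4)\<close>
    over (0, b).\<close>
  have small: "F b - F a \<le> 4 * B * b powr (1 / 4)" if "0 < a" "a \<le> b" for a b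
  proof -
    have "4 * B * a powr (1 / 4) - F a \<le> 4 * B * b powr (1 / 4) - F b"
    proof (rule DERIV_nonneg_imp_nondecreasing[OF that(2)])
      fix x assume "a \<le> x" "x \<le> b"
      then have x: "0 < x" using that by simp
      have "((\<lambda>x. 4 * B * x powr (1 / 4) - F x) has_real_derivative
          4 * B * (1 / 4 * x powr (1 / 4 - 1)) - \<Phi> x) (at x)"
        by (rule DERIV_diff[OF DERIV_cmult[OF has_real_derivative_powr[OF x]] deriv[OF x]])
      moreover have "4 * B * (1 / 4 * x powr (1 / 4 - 1)) = B * x powr (- 3 / 4)" by simp
      ultimately have "((\<lambda>x. 4 * B * x powr (1 / 4) - F x) has_real_derivative
          B * x powr (- 3 / 4) - \<Phi> x) (at x)" by (simp only:)
      then show "\<exists>y. ((\<lambda>x. 4 * B * x powr (1 / 4) - F x) has_real_derivative y) (at x) \<and> 0 \<le> y"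
        using bound[OF x] by (intro exI conjI) auto
    qed
    moreover have "0 \<le> 4 * B * a powr (1 / 4)" using B by simp
    ultimately show ?thesis by linarith
  qed
  have le_I: "F b - F a \<le> I" if "0 < a" "a \<le> b" for a b
  proof (rule tendsto_lowerbound[OF lim])
    show "\<forall>\<^sub>F X in at_top. F b - F a \<le> F X - F (1 / X)"
      using eventually_ge_at_top[of "max b (1 / a)"]
    proof eventually_elim
      case (elim X)
      then have "0 < X" "1 / X \<le> a" using that by (auto simp: field_simps)
      then show ?case using mono[of b X] mono[of "1 / X" a] elim that by simp
    qed
  qed simp
  have sum_bounds: "F (r K) - F (r 0) \<le> (\<Sum>k<K. h * \<Phi> (r k)) \<and>
      (\<Sum>k<K. h * \<Phi> (r (Suc k))) \<le> F (r K) - F (r 0)" for K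
  proof (induction K)
    case (Suc K)
    have "h * \<Phi> (r (Suc K)) \<le> F (r (Suc K)) - F (r K) \<and> F (r (Suc K)) - F (r K) \<le> h * \<Phi> (r K)"
      using cell[of "r K" "r (Suc K)"] r_pos h by (simp add: r_Suc)
    then show ?case using Suc by simp
  qed simp
  have r0: "r 0 = h / 2" by (simp add: r_def)
  have first: "h * \<Phi> (r 0) \<le> 4 * B * h powr (1 / 4)"
  proof -
    have "h * \<Phi> (r 0) \<le> h * (B * (h / 2) powr (- 3 / 4))"
      using bound[OF r_pos[of 0]] h by (simp add: r0)
    also have "\<dots> = B * (h powr 1 * h powr (- 3 / 4)) * 2 powr (3 / 4)"
      using h by (simp add: powr_divide powr_minus field_simps)
    also have "h powr 1 * h powr (- 3 / 4) = h powr (1 / 4)"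
      unfolding powr_add[symmetric] by simp
    also have "B * h powr (1 / 4) * 2 powr (3 / 4) \<le> B * h powr (1 / 4) * 4"
    proof (rule mult_left_mono)
      have "(2::real) powr (3 / 4) \<le> 2 powr 2" by (rule powr_mono) auto
      then show "(2::real) powr (3 / 4) \<le> 4" by simp
    qed (use B in simp)
    finally show ?thesis by (simp add: mult_ac)
  qed
  have partial_le: "(\<Sum>k<K. h * \<Phi> (r k)) \<le> h * \<Phi> (r 0) + I" for K
  proof -
    have "(\<Sum>k<K. h * \<Phi> (r k)) \<le> (\<Sum>k<Suc K. h * \<Phi> (r k))"
      using h nonneg[OF r_pos] by simp
    also have "\<dots> = h * \<Phi> (r 0) + (\<Sum>k<K. h * \<Phi> (r (Suc k)))"
      by (rule sum.lessThan_Suc_shift)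
    also have "\<dots> \<le> h * \<Phi> (r 0) + (F (r K) - F (r 0))" using sum_bounds by simp
    also have "\<dots> \<le> h * \<Phi> (r 0) + I"
      using le_I[of "r 0" "r K"] r_pos h by (simp add: r_def)
    finally show ?thesis .
  qed
  have summ: "summable (\<lambda>k. h * \<Phi> (r k))"
    by (rule summableI_nonneg_bounded[OF _ partial_le])
      (use nonneg[OF r_pos] h in auto)
  then have summ': "summable (\<lambda>k. \<Phi> (r k))" using h by (simp add: summable_cmult_iff)
  then show "summable (\<lambda>k. \<Phi> ((real k + 1 / 2) * h))" by (simp add: r_def)
  have eq: "(\<Sum>k. h * \<Phi> (r k)) = h * (\<Sum>k. \<Phi> (r k))" using summ' by (rule suminf_mult)
  have upper: "h * (\<Sum>k. \<Phi> (r k)) \<le> h * \<Phi> (r 0) + I"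
    unfolding eq[symmetric] by (rule suminf_le_const[OF summ partial_le])
  \<comment> \<open>The sample points start at h/2, so a partial sum misses at most the integral
    over (0, h/2) and the part beyond its last point, which disappears in the limit.\<close>
  have lower: "I - 4 * B * (h / 2) powr (1 / 4) \<le> h * (\<Sum>k. \<Phi> (r k))"
  proof (rule tendsto_le)
    have r_top: "filterlim r at_top sequentially"
      unfolding r_def using h
      by (intro filterlim_at_top_mult_tendsto_pos[OF tendsto_const])
        (auto intro!: filterlim_tendsto_add_at_top tendsto_const filterlim_real_sequentially
          simp: add.commute[of _ "1/2"])
    show "(\<lambda>K. \<Sum>k<K. h * \<Phi> (r k)) \<longlonglongrightarrow> h * (\<Sum>k. \<Phi> (r k))"
      using summable_LIMSEQ[OF summ] eq by simp
    show "(\<lambda>K. (F (r K) - F (1 / r K)) - 4 * B * (h / 2) powr (1 / 4))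
        \<longlonglongrightarrow> I - 4 * B * (h / 2) powr (1 / 4)"
      by (intro tendsto_intros filterlim_compose[OF lim r_top])
    show "\<forall>\<^sub>F K in sequentially. F (r K) - F (1 / r K) - 4 * B * (h / 2) powr (1 / 4)
        \<le> (\<Sum>k<K. h * \<Phi> (r k))"
      using filterlim_at_top_dense[THEN iffD1, OF r_top, rule_format, of "1 / r 0"]
    proof eventually_elim
      case (elim K)
      then have "1 / r K \<le> r 0" using r_pos[of K] r_pos[of 0] by (simp add: field_simps)
      from small[OF _ this] r_pos[of K] sum_bounds[of K] show ?case by (simp add: r0)
    qed
  qed simp
  have "(h / 2) powr (1 / 4) \<le> h powr (1 / 4)" using h by (intro powr_mono2) auto
  then have "4 * B * (h / 2) powr (1 / 4) \<le> 4 * B * h powr (1 / 4)"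
    using B by (intro mult_left_mono) auto
  with upper lower first
  show "\<bar>h * (\<Sum>k. \<Phi> ((real k + 1 / 2) * h)) - I\<bar> \<le> 4 * B * h powr (1 / 4)"
    unfolding r_def by (simp add: abs_le_iff)
qed

section \<open>The function ln r / (r - 1) and the origin of the constant pi^2\<close>

text \<open>The zero of ln at 1 removes the pole of the query kernel, so the first logarithmic
  moment is an ordinary integral of this function; concavity of ln makes it antitone, as the Riemann
  sums require. The value at 1 is the continuous extension.\<close>

definition log_slope :: "real \<Rightarrow> real" where
  "log_slope r = (if r = 1 then 1 else ln r / (r - 1))"

lemma ln_chord_slopes:
  fixes a b c :: real
  assumes "0 < a" "a \<le> b" "b \<le> c"
  shows "(ln c - ln b) * (b - a) \<le> (ln b - ln a) * (c - b)"
proof -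
  have "ln (c / b) \<le> c / b - 1" "ln (a / b) \<le> a / b - 1"
    using assms by (auto intro!: ln_le_minus_one)
  then have 1: "ln c - ln b \<le> (c - b) / b" and 2: "(b - a) / b \<le> ln b - ln a"
    using assms by (auto simp: ln_div field_simps)
  have "(ln c - ln b) * (b - a) \<le> (c - b) / b * (b - a)"
    using 1 assms by (intro mult_right_mono) auto
  also have "\<dots> = (b - a) / b * (c - b)" by simp
  also have "\<dots> \<le> (ln b - ln a) * (c - b)"
    using 2 assms by (intro mult_right_mono) auto
  finally show ?thesis .
qed

lemma log_slope_nonneg: "0 < r \<Longrightarrow> 0 \<le> log_slope r"
  by (auto simp: log_slope_def divide_simps)

lemma log_slope_antitone:
  assumes "0 < r" "r \<le> s"
  shows "log_slope s \<le> log_slope r"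
proof -
  have ge1: "1 \<le> log_slope x" if "0 < x" "x \<le> 1" for x
    using ln_le_minus_one[of x] that by (auto simp: log_slope_def field_simps)
  have le1: "log_slope x \<le> 1" if "1 \<le> x" for x
    using ln_le_minus_one[of x] that by (auto simp: log_slope_def field_simps)
  consider "r \<le> 1" "1 \<le> s" | "1 < r" | "s < 1" by linarith
  then show ?thesis
  proof cases
    case 1
    then show ?thesis using ge1[of r] le1[of s] assms by linarith
  next
    case 2
    have "(ln s - ln r) * (r - 1) \<le> (ln r - ln 1) * (s - r)"
      by (rule ln_chord_slopes) (use 2 assms in auto)
    then show ?thesis using 2 assms by (simp add: log_slope_def field_simps)
  next
    case 3
    have "(ln 1 - ln s) * (s - r) \<le> (ln s - ln r) * (1 - s)"
      by (rule ln_chord_slopes) (use 3 assms in auto)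
    then have "ln r * (1 - s) \<le> ln s * (1 - r)" by (simp add: algebra_simps)
    then show ?thesis using 3 assms by (simp add: log_slope_def field_simps)
  qed
qed

text \<open>The substitution r = q^8 turns the fractional powers of the estimates into integer
  powers. Comparing ln q with q - 1 for q > 1 and with 1 - 1/q for q < 1 cancels the factor q - 1 of
  q^8 - 1; keeping two terms of the geometric sum gives decay like r^(-7/8) at infinity and growth
  like r^(-1/8) at 0.\<close>

lemma log_slope_le:
  assumes "0 < q"
  shows "log_slope (q ^ 8) \<le> 8 / (q * (1 + q ^ 6))"
proof -
  have geom: "q ^ 8 - 1 = (q - 1) * (1 + q + q^2 + q^3 + q^4 + q^5 + q^6 + q^7)"
    by algebra
  define p where "p = 1 + q + q^2 + q^3 + q^4 + q^5 + q^6 + q^7"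
  have p: "q + q ^ 7 \<le> p" "1 + q ^ 6 \<le> p" "0 < p"
    using assms by (auto simp: p_def add_pos_pos add_nonneg_nonneg)
  have pos: "0 < 1 + q ^ 6" using assms by (simp add: add_pos_pos)
  have slope: "log_slope (q ^ 8) = 8 * ln q / ((q - 1) * p)" if "q ^ 8 \<noteq> 1"
  proof -
    have "ln (q ^ 8) = 8 * ln q" using assms by (simp add: ln_realpow)
    with that geom show ?thesis unfolding log_slope_def p_def by (simp only: if_False)
  qed
  consider "q = 1" | "1 < q" | "q < 1" by linarith
  then show ?thesis
  proof cases
    case 1
    then show ?thesis by (simp add: log_slope_def)
  next
    case 2
    have "1 < q ^ 8" by (rule one_less_power) (use 2 in auto)
    then have "q ^ 8 \<noteq> 1" by (rule less_imp_neq[THEN not_sym])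
    then have "log_slope (q ^ 8) = 8 * ln q / ((q - 1) * p)" by (rule slope)
    also have "\<dots> \<le> (q - 1) * 8 / ((q - 1) * p)"
      by (rule divide_right_mono) (use ln_le_minus_one[of q] 2 p(3) in auto)
    also have "\<dots> = 8 / p" by (rule mult_divide_mult_cancel_left) (use 2 in simp)
    also have "\<dots> \<le> 8 / (q + q ^ 7)"
      by (rule divide_left_mono[OF p(1)]) (use p(3) assms in \<open>auto intro!: mult_pos_pos add_pos_pos\<close>)
    also have "q + q ^ 7 = q * (1 + q ^ 6)" by algebra
    finally show ?thesis .
  next
    case 3
    then have "q ^ 8 < 1 ^ 8" by (rule power_strict_mono) (use assms in auto)
    then have "q ^ 8 \<noteq> 1" unfolding power_one by (rule less_imp_neq)
    then have "log_slope (q ^ 8) = 8 * ln q / ((q - 1) * p)" by (rule slope)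
    also have "(q - 1) * p = - ((1 - q) * p)" by (simp add: algebra_simps)
    also have "8 * ln q / - ((1 - q) * p) = 8 * (- ln q) / ((1 - q) * p)" by simp
    also have "\<dots> \<le> 8 * ((1 - q) / q) / ((1 - q) * p)"
    proof (rule divide_right_mono)
      have "- ln q \<le> 1 / q - 1" using ln_le_minus_one[of "1 / q"] assms by (simp add: ln_div)
      also have "\<dots> = (1 - q) / q" using assms by (simp add: diff_divide_distrib)
      finally show "8 * - ln q \<le> 8 * ((1 - q) / q)" by linarith
    qed (use 3 p(3) in auto)
    also have "\<dots> = (1 - q) * 8 / ((1 - q) * (q * p))" by (simp add: mult_ac)
    also have "\<dots> = 8 / (q * p)" by (rule mult_divide_mult_cancel_left) (use 3 in simp)
    also have "\<dots> \<le> 8 / (q * (1 + q ^ 6))"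
      by (rule divide_left_mono[OF mult_left_mono[OF p(2)]])
        (use p(3) assms pos in \<open>auto intro!: mult_pos_pos\<close>)
    finally show ?thesis .
  qed
qed

lemma eighth_root:
  fixes r :: real
  assumes "0 < r"
  obtains q where "0 < q" "r = q ^ 8" "sqrt r = q ^ 4" "r powr (- 3 / 4) = 1 / q ^ 6"
    "r powr (1 / 4) = q ^ 2"
proof
  define q where "q = r powr (1 / 8)"
  show q: "0 < q" using assms by (simp add: q_def)
  have pw: "q ^ n = r powr (real n / 8)" for n
    using assms by (simp add: q_def powr_realpow[symmetric] powr_powr)
  show "r = q ^ 8" using assms by (simp add: pw)
  show "sqrt r = q ^ 4" using assms by (simp add: pw powr_half_sqrt)
  show "r powr (- 3 / 4) = 1 / q ^ 6"
    using pw[of 6] powr_minus[of r "3 / 4"] by (simp add: inverse_eq_divide)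
  show "r powr (1 / 4) = q ^ 2" using pw[of 2] by simp
qed

lemma log_slope_isCont: "0 < r \<Longrightarrow> isCont log_slope r"
proof (cases "r = 1")
  case True
  have "((\<lambda>y. ln y / (y - 1)) \<longlongrightarrow> 1) (at (1::real))"
    using DERIV_ln[of "1::real"] unfolding has_field_derivative_iff by simp
  then have "(log_slope \<longlongrightarrow> 1) (at 1)"
    by (rule Lim_transform_eventually)
      (auto simp: log_slope_def eventually_at_filter)
  then show ?thesis using True by (simp add: isCont_def log_slope_def)
next
  case False
  assume r: "0 < r"
  have "isCont (\<lambda>x. ln x / (x - 1)) r" using r False by (intro continuous_intros) auto
  moreover have "\<forall>\<^sub>F x in nhds r. log_slope x = ln x / (x - 1)"
    using t1_space_nhds[OF False] by eventually_elim (simp add: log_slope_def)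
  ultimately show ?thesis by (subst isCont_cong) auto
qed

lemma odd_inverse_squares_sums: "(\<lambda>k. 1 / (2 * real k + 1)\<^sup>2) sums (pi\<^sup>2 / 8)"
proof -
  have all: "(\<lambda>n. 1 / (real n + 1)\<^sup>2) sums (pi\<^sup>2 / 6)"
    using inverse_squares_sums by (simp add: add.commute)
  have grp: "(\<lambda>k. \<Sum>n = k * 2..<k * 2 + 2. 1 / (real n + 1)\<^sup>2) sums (pi\<^sup>2 / 6)"
    by (rule sums_group[OF all]) simp
  have eq: "(\<Sum>n = k * 2..<k * 2 + 2. 1 / (real n + 1)\<^sup>2)
      = 1 / (2 * real k + 1)\<^sup>2 + 1 / 4 * (1 / (real k + 1)\<^sup>2)" for k
  proof -
    have "{k * 2..<k * 2 + 2} = {2 * k, 2 * k + 1}" by auto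
    moreover have "(2 * real k + 1 + 1)\<^sup>2 = 4 * (real k + 1)\<^sup>2"
      by (simp add: power2_eq_square algebra_simps)
    ultimately show ?thesis by (simp add: add_ac)
  qed
  have "(\<lambda>k. (1 / (2 * real k + 1)\<^sup>2 + 1 / 4 * (1 / (real k + 1)\<^sup>2))
      - 1 / 4 * (1 / (real k + 1)\<^sup>2)) sums (pi\<^sup>2 / 6 - 1 / 4 * (pi\<^sup>2 / 6))"
    by (rule sums_diff[OF grp[unfolded eq] sums_mult[OF all]])
  then show ?thesis by simp
qed

lemma log_slope_inverse: "0 < r \<Longrightarrow> log_slope (1 / r) = r * log_slope r"
  by (auto simp: log_slope_def ln_div field_simps)

lemma constant_on_pos:
  fixes f :: "real \<Rightarrow> real"
  assumes "\<And>r. 0 < r \<Longrightarrow> (f has_real_derivative 0) (at r)" "0 < x" "0 < y"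
  shows "f x = f y"
  by (rule DERIV_isconst3[of 0 "max x y + 1"]) (use assms in auto)

lemma DERIV_reflect:
  fixes F :: "real \<Rightarrow> real"
  assumes "\<And>r. 0 < r \<Longrightarrow> (F has_real_derivative \<Phi> r) (at r)" "0 < r"
  shows "((\<lambda>r. F (1 / r)) has_real_derivative - \<Phi> (1 / r) / r\<^sup>2) (at r)"
proof -
  have "((\<lambda>r. 1 / r) has_real_derivative - 1 / r\<^sup>2) (at r)"
    using DERIV_inverse[of r] assms(2) by (simp add: inverse_eq_divide power2_eq_square)
  from DERIV_chain2[OF assms(1) this] assms(2) show ?thesis by simp
qed

lemma antiderivative_on_pos:
  fixes f :: "real \<Rightarrow> real"
  assumes "\<And>r. 0 < r \<Longrightarrow> isCont f r"
  obtains F where "\<And>r. 0 < r \<Longrightarrow> (F has_real_derivative f r) (at r)"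
proof -
  have "\<exists>F. \<forall>x :: real. 0 < ereal x \<longrightarrow> ereal x < \<infinity> \<longrightarrow> (F has_vector_derivative f x) (at x)"
    by (rule einterval_antiderivative) (use assms in auto)
  then show ?thesis using that by (auto simp: has_real_derivative_iff_has_vector_derivative)
qed

text \<open>With r = v^2 the integrand becomes - 4 ln v / (1 - v^2). In its geometric expansion the
  term - 4 v^(2k) ln v, with antiderivative \<open>E k\<close>, integrates to 4 / (2k + 1)^2 over
  (0, 1), and the sum over the odd squares is 4 * pi^2 / 8.\<close>

lemma log_slope_sqrt_integral_unit:
  assumes deriv: "\<And>r. 0 < r \<Longrightarrow> (F has_real_derivative log_slope r / sqrt r) (at r)"
  shows "((\<lambda>e. F 1 - F (e\<^sup>2)) \<longlongrightarrow> pi\<^sup>2 / 2) (at_right 0)"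
proof -
  define E :: "nat \<Rightarrow> real \<Rightarrow> real" where "E = (\<lambda>k v.
    4 * (v ^ (2 * k + 1) / (real (2 * k + 1))\<^sup>2 - v ^ (2 * k + 1) * ln v / real (2 * k + 1)))"
  define s :: "nat \<Rightarrow> real" where "s = (\<lambda>M. \<Sum>k<Suc M. 4 / (2 * real k + 1)\<^sup>2)"
  have E_deriv: "(E k has_real_derivative - 4 * ln v * v ^ (2 * k)) (at v)" if "0 < v" for k v
  proof -
    define m where "m = real (2 * k + 1)"
    have m: "m \<noteq> 0" by (simp add: m_def)
    have pw: "((\<lambda>v. v ^ (2 * k + 1)) has_real_derivative m * v ^ (2 * k)) (at v)"
      using DERIV_pow[of "2 * k + 1" v] by (simp add: m_def)
    have "((\<lambda>v. 4 * (v ^ (2 * k + 1) / m\<^sup>2 - v ^ (2 * k + 1) * ln v / m)) has_real_derivative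
        4 * (m * v ^ (2 * k) / m\<^sup>2 - (m * v ^ (2 * k) * ln v + 1 / v * v ^ (2 * k + 1)) / m)) (at v)"
      using DERIV_cmult[OF DERIV_diff[OF DERIV_cdivide[OF pw]
        DERIV_cdivide[OF DERIV_mult[OF pw DERIV_ln_divide[OF that]]]]] by blast
    moreover have "4 * (m * v ^ (2 * k) / m\<^sup>2 - (m * v ^ (2 * k) * ln v + 1 / v * v ^ (2 * k + 1)) / m)
        = - 4 * ln v * v ^ (2 * k)"
      using m that by (simp add: field_simps power2_eq_square)
    ultimately show ?thesis by (simp only: E_def m_def)
  qed
  have E1: "E k 1 = 4 / (2 * real k + 1)\<^sup>2" for k by (simp add: E_def add.commute)
  \<comment> \<open>The part of the integrand left after the terms k \<le> M lies between 0 and 2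
    v^(2M), hence the width 2 / (2M + 1) of the enclosure.\<close>
  have key: "s M - (\<Sum>k<Suc M. E k e) \<le> F 1 - F (e\<^sup>2) \<and>
      F 1 - F (e\<^sup>2) \<le> s M - (\<Sum>k<Suc M. E k e) + 2 / (2 * real M + 1)"
    if e: "0 < e" "e < 1" for e M
  proof -
    define D where "D = (\<lambda>v. F (v\<^sup>2) - (\<Sum>k<Suc M. E k v))"
    define d where "d = (\<lambda>v. 2 * log_slope (v\<^sup>2) + 4 * ln v * (\<Sum>k<Suc M. (v\<^sup>2) ^ k))"
    have D_deriv: "(D has_real_derivative d v) (at v)" if v: "0 < v" for v
    proof -
      have "((\<lambda>v. v\<^sup>2) has_real_derivative 2 * v) (at v)"
        using DERIV_pow[of 2 v] by simp
      from DERIV_chain2[OF deriv this] v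
      have 1: "((\<lambda>v. F (v\<^sup>2)) has_real_derivative log_slope (v\<^sup>2) / sqrt (v\<^sup>2) * (2 * v)) (at v)"
        by simp
      have 2: "((\<lambda>v. \<Sum>k<Suc M. E k v) has_real_derivative (\<Sum>k<Suc M. - 4 * ln v * v ^ (2 * k))) (at v)"
        by (rule DERIV_sum) (rule E_deriv[OF v])
      have "log_slope (v\<^sup>2) / sqrt (v\<^sup>2) * (2 * v) - (\<Sum>k<Suc M. - 4 * ln v * v ^ (2 * k)) = d v"
        using v by (simp add: d_def sum_distrib_left power_mult sum_negf del: sum.lessThan_Suc)
      with DERIV_diff[OF 1 2] show ?thesis by (simp only: D_def)
    qed
    have d_eq: "d v = 2 * log_slope (v\<^sup>2) * v ^ (2 * Suc M)" if v: "0 < v" "v < 1" for v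
    proof -
      have v2: "v\<^sup>2 < 1" using v by (simp add: power_less_one_iff)
      have slope: "log_slope (v\<^sup>2) = 2 * ln v / (v\<^sup>2 - 1)"
        using v v2 by (simp add: log_slope_def ln_realpow)
      have geo: "(\<Sum>k<Suc M. (v\<^sup>2) ^ k) = ((v\<^sup>2) ^ Suc M - 1) / (v\<^sup>2 - 1)"
        using v2 by (intro geometric_sum) simp
      have "d v = 2 * (2 * ln v / (v\<^sup>2 - 1)) + 4 * ln v * (((v\<^sup>2) ^ Suc M - 1) / (v\<^sup>2 - 1))"
        unfolding d_def geo slope ..
      also have "\<dots> = 2 * (2 * ln v / (v\<^sup>2 - 1)) * (v\<^sup>2) ^ Suc M"
        by (simp add: diff_divide_distrib algebra_simps)
      also have "\<dots> = 2 * log_slope (v\<^sup>2) * v ^ (2 * Suc M)"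
        unfolding slope power_mult ..
      finally show ?thesis .
    qed
    have d_bounds: "0 \<le> d v \<and> d v \<le> 2 * v ^ (2 * M)" if v: "0 < v" "v \<le> 1" for v
    proof (cases "v = 1")
      case True
      then show ?thesis by (simp add: d_def log_slope_def)
    next
      case False
      then have v1: "v < 1" "v\<^sup>2 < 1" using v by (auto simp: power_less_one_iff)
      have "ln (1 / v\<^sup>2) \<le> 1 / v\<^sup>2 - 1" using v by (intro ln_le_minus_one) simp
      then have "log_slope (v\<^sup>2) \<le> 1 / v\<^sup>2"
        using v v1 by (simp add: log_slope_def ln_div divide_simps)
      then have "2 * log_slope (v\<^sup>2) * v ^ (2 * Suc M) \<le> 2 * (1 / v\<^sup>2) * v ^ (2 * Suc M)"
        using v by (intro mult_right_mono) auto
      also have "\<dots> = 2 * v ^ (2 * M)" using v by (simp add: power2_eq_square)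
      finally show ?thesis using d_eq[OF v(1) v1(1)] log_slope_nonneg[of "v\<^sup>2"] v by simp
    qed
    have "D e \<le> D 1"
    proof (rule DERIV_nonneg_imp_nondecreasing[of e 1 D])
      fix v assume "e \<le> v" "v \<le> 1"
      then show "\<exists>y. (D has_real_derivative y) (at v) \<and> 0 \<le> y"
        using e D_deriv[of v] d_bounds[of v] by auto
    qed (use e in simp)
    moreover have "2 * e ^ (2 * M + 1) / (2 * real M + 1) - D e
        \<le> 2 * 1 ^ (2 * M + 1) / (2 * real M + 1) - D 1"
    proof (rule DERIV_nonneg_imp_nondecreasing[of e 1
        "\<lambda>v. 2 * v ^ (2 * M + 1) / (2 * real M + 1) - D v"])
      fix v assume "e \<le> v" "v \<le> 1"
      then have v: "0 < v" "v \<le> 1" using e by auto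
      have "((\<lambda>v. 2 * v ^ (2 * M + 1)) has_real_derivative
          2 * (real (2 * M + 1) * v ^ (2 * M))) (at v)"
        using DERIV_cmult[OF DERIV_pow[of "2 * M + 1" v]] by simp
      from DERIV_diff[OF DERIV_cdivide[OF this, of "2 * real M + 1"] D_deriv[OF v(1)]]
      have "((\<lambda>v. 2 * v ^ (2 * M + 1) / (2 * real M + 1) - D v) has_real_derivative
          2 * v ^ (2 * M) - d v) (at v)" by (simp add: add.commute)
      then show "\<exists>y. ((\<lambda>v. 2 * v ^ (2 * M + 1) / (2 * real M + 1) - D v) has_real_derivative y) (at v)
          \<and> 0 \<le> y"
        using d_bounds[OF v] by (intro exI conjI) auto
    qed (use e in simp)
    moreover have "0 \<le> 2 * e ^ (2 * M + 1) / (2 * real M + 1)" using e by simp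
    moreover have "D 1 = F 1 - s M" by (simp add: D_def s_def E1)
    moreover have "D e = F (e\<^sup>2) - (\<Sum>k<Suc M. E k e)" by (simp add: D_def)
    ultimately show ?thesis by simp
  qed
  have E_lim: "((\<lambda>e. \<Sum>k<Suc M. E k e) \<longlongrightarrow> 0) (at_right 0)" for M
  proof -
    have "((\<lambda>e. E k e) \<longlongrightarrow> 0) (at_right 0)" for k
    proof -
      have pw: "((\<lambda>e::real. e ^ (2 * k)) \<longlongrightarrow> 0 ^ (2 * k)) (at_right 0)"
        by (intro tendsto_intros)
      have 1: "((\<lambda>e::real. e) \<longlongrightarrow> 0) (at_right 0)" by (intro tendsto_intros)
      have 2: "((\<lambda>e::real. e * ln e) \<longlongrightarrow> 0) (at_right 0)" by real_asymp
      have "((\<lambda>e. 4 * (e ^ (2 * k) * e / (real (2 * k + 1))\<^sup>2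
          - e ^ (2 * k) * (e * ln e) / real (2 * k + 1))) \<longlongrightarrow>
          4 * (0 ^ (2 * k) * 0 / (real (2 * k + 1))\<^sup>2 - 0 ^ (2 * k) * 0 / real (2 * k + 1)))
          (at_right 0)"
        by (intro tendsto_intros pw 1 2) auto
      then show ?thesis by (simp add: E_def mult_ac)
    qed
    then show ?thesis by (intro tendsto_null_sum) auto
  qed
  have s_lim: "s \<longlonglongrightarrow> pi\<^sup>2 / 2"
  proof -
    have "(\<lambda>k. 4 * (1 / (2 * real k + 1)\<^sup>2)) sums (4 * (pi\<^sup>2 / 8))"
      by (intro sums_mult odd_inverse_squares_sums)
    then have "(\<lambda>n. \<Sum>k<n. 4 / (2 * real k + 1)\<^sup>2) \<longlonglongrightarrow> pi\<^sup>2 / 2"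
      by (simp add: sums_def)
    then show ?thesis unfolding s_def by (rule LIMSEQ_Suc)
  qed
  have unit: "\<forall>\<^sub>F e::real in at_right 0. 0 < e \<and> e < 1"
    unfolding eventually_at_right_field by (intro exI[of _ 1]) auto
  show ?thesis
  proof (rule order_tendstoI)
    fix a assume "a < pi\<^sup>2 / 2"
    then obtain M where M: "a < s M"
      using order_tendstoD(1)[OF s_lim] by (auto simp: eventually_sequentially)
    have "((\<lambda>e. s M - (\<Sum>k<Suc M. E k e)) \<longlongrightarrow> s M - 0) (at_right 0)"
      by (intro tendsto_diff tendsto_const E_lim)
    from order_tendstoD(1)[OF this, of a] M
    have "\<forall>\<^sub>F e in at_right 0. a < s M - (\<Sum>k<Suc M. E k e)" by simp
    with unit show "\<forall>\<^sub>F e in at_right 0. a < F 1 - F (e\<^sup>2)"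
    proof eventually_elim
      case (elim e)
      then show ?case using key[of e M] by linarith
    qed
  next
    fix b assume "pi\<^sup>2 / 2 < b"
    moreover have "(\<lambda>M. s M + 2 / (2 * real M + 1)) \<longlonglongrightarrow> pi\<^sup>2 / 2 + 0"
      by (intro tendsto_add s_lim) real_asymp
    ultimately obtain M where M: "s M + 2 / (2 * real M + 1) < b"
      using order_tendstoD(2) by (force simp: eventually_sequentially)
    have "((\<lambda>e. s M - (\<Sum>k<Suc M. E k e) + 2 / (2 * real M + 1)) \<longlongrightarrow>
        s M - 0 + 2 / (2 * real M + 1)) (at_right 0)"
      by (intro tendsto_diff tendsto_add tendsto_const E_lim)
    from order_tendstoD(2)[OF this, of b] M
    have "\<forall>\<^sub>F e in at_right 0. s M - (\<Sum>k<Suc M. E k e) + 2 / (2 * real M + 1) < b" by simp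
    with unit show "\<forall>\<^sub>F e in at_right 0. F 1 - F (e\<^sup>2) < b"
    proof eventually_elim
      case (elim e)
      then show ?case using key[of e M] by linarith
    qed
  qed
qed

text \<open>Reflection of r to 1/r preserves the first integrand with its measure, so the full
  integral is twice the one over (0, 1). In the second, the weights 1 / (1 + r) and 1 / (1 + 1/r) of
  reflected points add up to 1, so its full integral is half of the first.\<close>

lemma log_slope_sqrt_antiderivatives:
  obtains F G where
    "\<And>r. 0 < r \<Longrightarrow> (F has_real_derivative log_slope r / sqrt r) (at r)"
    "((\<lambda>X. F X - F (1 / X)) \<longlongrightarrow> pi\<^sup>2) at_top"
    "\<And>r. 0 < r \<Longrightarrow> (G has_real_derivative log_slope r / (sqrt r * (1 + r))) (at r)"
    "((\<lambda>X. G X - G (1 / X)) \<longlongrightarrow> pi\<^sup>2 / 2) at_top"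
proof -
  obtain F where F: "\<And>r. 0 < r \<Longrightarrow> (F has_real_derivative log_slope r / sqrt r) (at r)"
    by (rule antiderivative_on_pos[of "\<lambda>r. log_slope r / sqrt r"])
      (auto intro!: continuous_intros log_slope_isCont)
  obtain G where G: "\<And>r. 0 < r \<Longrightarrow> (G has_real_derivative log_slope r / (sqrt r * (1 + r))) (at r)"
    by (rule antiderivative_on_pos[of "\<lambda>r. log_slope r / (sqrt r * (1 + r))"])
      (auto intro!: continuous_intros log_slope_isCont)
  have sq: "sqrt r * sqrt r = r" "sqrt (1 / r) = 1 / sqrt r" "0 < sqrt r" if "0 < r" for r
    using that by (auto simp: real_sqrt_divide)
  have F_sym: "F X + F (1 / X) = F 1 + F (1 / 1)" if "0 < X" for X
  proof (rule constant_on_pos[of "\<lambda>r. F r + F (1 / r)"])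
    fix r :: real assume r: "0 < r"
    have "log_slope r / sqrt r + - (log_slope (1 / r) / sqrt (1 / r)) / r\<^sup>2 = 0"
    proof -
      have "log_slope (1 / r) / sqrt (1 / r) / r\<^sup>2 = log_slope r * (r * sqrt r) / r\<^sup>2"
        unfolding log_slope_inverse[OF r] sq[OF r] by simp
      also have "\<dots> = log_slope r / sqrt r"
        using sq(1,3)[OF r] r by (simp add: field_simps power2_eq_square)
      finally show ?thesis by simp
    qed
    with DERIV_add[OF F[OF r] DERIV_reflect[OF F r]]
    show "((\<lambda>r. F r + F (1 / r)) has_real_derivative 0) (at r)" by (simp only:)
  qed (use that in auto)
  have G_sym: "G X - G (1 / X) - F X = G 1 - G (1 / 1) - F 1" if "0 < X" for X
  proof (rule constant_on_pos[of "\<lambda>r. G r - G (1 / r) - F r"])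
    fix r :: real assume r: "0 < r"
    have "log_slope r / (sqrt r * (1 + r)) - - (log_slope (1 / r) / (sqrt (1 / r) * (1 + 1 / r))) / r\<^sup>2
        - log_slope r / sqrt r = 0"
    proof -
      have "log_slope (1 / r) / (sqrt (1 / r) * (1 + 1 / r)) / r\<^sup>2
          = r * log_slope r / (1 / sqrt r * ((1 + r) / r)) / r\<^sup>2"
        unfolding log_slope_inverse[OF r] sq[OF r] using r by (simp add: add_divide_distrib)
      also have "\<dots> = log_slope r * sqrt r / (1 + r)"
        using r sq(3)[OF r] by (simp add: divide_simps power2_eq_square)
      also have "\<dots> = log_slope r * (r / sqrt r) / (1 + r)"
        using sq(1,3)[OF r] by (metis nonzero_eq_divide_eq less_irrefl)
      finally have "log_slope (1 / r) / (sqrt (1 / r) * (1 + 1 / r)) / r\<^sup>2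
          = log_slope r * (r / sqrt r) / (1 + r)" .
      moreover have "log_slope r / (sqrt r * (1 + r)) + log_slope r * (r / sqrt r) / (1 + r)
          = log_slope r / sqrt r"
        using r sq(3)[OF r] by (simp add: divide_simps) (simp add: algebra_simps)
      ultimately show ?thesis by simp
    qed
    with DERIV_diff[OF DERIV_diff[OF G[OF r] DERIV_reflect[OF G r]] F[OF r]]
    show "((\<lambda>r. G r - G (1 / r) - F r) has_real_derivative 0) (at r)" by (simp only:)
  qed (use that in auto)
  have "filterlim (\<lambda>X::real. sqrt (1 / X)) (at_right 0) at_top" by real_asymp
  from filterlim_compose[OF log_slope_sqrt_integral_unit[OF F] this]
  have lim: "((\<lambda>X. F 1 - F ((sqrt (1 / X))\<^sup>2)) \<longlongrightarrow> pi\<^sup>2 / 2) at_top" by simp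
  have half: "((\<lambda>X. F 1 - F (1 / X)) \<longlongrightarrow> pi\<^sup>2 / 2) at_top"
    by (rule Lim_transform_eventually[OF lim eventually_mono[OF eventually_gt_at_top[of 0]]]) simp
  have "((\<lambda>X. 2 * (F 1 - F (1 / X))) \<longlongrightarrow> 2 * (pi\<^sup>2 / 2)) at_top"
    by (intro tendsto_mult tendsto_const half)
  then have "((\<lambda>X. 2 * (F 1 - F (1 / X))) \<longlongrightarrow> pi\<^sup>2) at_top" by simp
  then have F_lim: "((\<lambda>X. F X - F (1 / X)) \<longlongrightarrow> pi\<^sup>2) at_top"
  proof (rule Lim_transform_eventually)
    show "\<forall>\<^sub>F X in at_top. 2 * (F 1 - F (1 / X)) = F X - F (1 / X)"
      using eventually_gt_at_top[of 0]
    proof eventually_elim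
      case (elim X)
      with F_sym[of X] show ?case by simp
    qed
  qed
  have G_lim: "((\<lambda>X. G X - G (1 / X)) \<longlongrightarrow> pi\<^sup>2 / 2) at_top"
  proof (rule Lim_transform_eventually[OF half])
    show "\<forall>\<^sub>F X in at_top. F 1 - F (1 / X) = G X - G (1 / X)"
      using eventually_gt_at_top[of 0]
    proof eventually_elim
      case (elim X)
      with F_sym[of X] G_sym[of X] show ?case by simp
    qed
  qed
  show ?thesis using that F F_lim G G_lim by blast
qed

lemma log_slope_riemann_sum:
  assumes "0 < h"
  shows "summable (\<lambda>k. log_slope ((real k + 1 / 2) * h) / sqrt ((real k + 1 / 2) * h))" (is ?s1)
    and "\<bar>h * (\<Sum>k. log_slope ((real k + 1 / 2) * h) / sqrt ((real k + 1 / 2) * h)) - pi\<^sup>2\<bar>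
      \<le> 32 * h powr (1 / 4)" (is ?b1)
    and "summable (\<lambda>k. log_slope ((real k + 1 / 2) * h)
      / (sqrt ((real k + 1 / 2) * h) * (1 + (real k + 1 / 2) * h)))" (is ?s2)
    and "\<bar>h * (\<Sum>k. log_slope ((real k + 1 / 2) * h)
      / (sqrt ((real k + 1 / 2) * h) * (1 + (real k + 1 / 2) * h))) - pi\<^sup>2 / 2\<bar>
      \<le> 32 * h powr (1 / 4)" (is ?b2)
proof -
  obtain F G where
    F: "\<And>r. 0 < r \<Longrightarrow> (F has_real_derivative log_slope r / sqrt r) (at r)"
      "((\<lambda>X. F X - F (1 / X)) \<longlongrightarrow> pi\<^sup>2) at_top" and
    G: "\<And>r. 0 < r \<Longrightarrow> (G has_real_derivative log_slope r / (sqrt r * (1 + r))) (at r)"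
      "((\<lambda>X. G X - G (1 / X)) \<longlongrightarrow> pi\<^sup>2 / 2) at_top"
    using log_slope_sqrt_antiderivatives by blast
  have anti1: "log_slope s / sqrt s \<le> log_slope r / sqrt r" if "0 < r" "r \<le> s" for r s
    using log_slope_antitone[OF that] log_slope_nonneg[of r] that by (intro frac_le) auto
  have anti2: "log_slope s / (sqrt s * (1 + s)) \<le> log_slope r / (sqrt r * (1 + r))"
    if "0 < r" "r \<le> s" for r s
    using log_slope_antitone[OF that] log_slope_nonneg[of r] that
    by (intro frac_le mult_mono mult_pos_pos) auto
  have bound1: "log_slope r / sqrt r \<le> 8 * r powr (- 3 / 4)" if r: "0 < r" for r
  proof -
    obtain q where q: "0 < q" "r = q ^ 8" "sqrt r = q ^ 4" "r powr (- 3 / 4) = 1 / q ^ 6"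
      using eighth_root[OF r] by metis
    have pos: "0 < 1 + q ^ 6" using q(1) by (simp add: add_pos_pos)
    have "q \<le> 1 + q ^ 6"
    proof (cases "q \<le> 1")
      case True
      have "0 \<le> q ^ 6" using q(1) by simp
      with True show ?thesis by linarith
    next
      case False
      then have "q ^ 1 \<le> q ^ 6" by (intro power_increasing) auto
      then show ?thesis by simp
    qed
    then have "1 / (1 + q ^ 6) \<le> 1 / q" using q(1) by (intro divide_left_mono) (auto simp: pos)
    have "log_slope r / sqrt r \<le> 8 / (q * (1 + q ^ 6)) / q ^ 4"
      unfolding q(3) unfolding q(2) using log_slope_le[OF q(1)] q(1) by (intro divide_right_mono) auto
    also have "\<dots> = 8 / q ^ 5 * (1 / (1 + q ^ 6))"
      by (simp add: eval_nat_numeral)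
    also have "\<dots> \<le> 8 / q ^ 5 * (1 / q)"
      using \<open>1 / (1 + q ^ 6) \<le> 1 / q\<close> q(1) by (intro mult_left_mono) auto
    also have "\<dots> = 8 * (1 / q ^ 6)" by (simp add: eval_nat_numeral)
    finally show ?thesis unfolding q(4) .
  qed
  have bound2: "log_slope r / (sqrt r * (1 + r)) \<le> 8 * r powr (- 3 / 4)" if r: "0 < r" for r
  proof -
    have "log_slope r / (sqrt r * (1 + r)) \<le> log_slope r / (sqrt r * 1)"
      using log_slope_nonneg[OF r] r by (intro divide_left_mono mult_left_mono mult_pos_pos) auto
    also have "\<dots> \<le> 8 * r powr (- 3 / 4)" using bound1[OF r] by simp
    finally show ?thesis .
  qed
  have nonneg: "0 \<le> log_slope r / sqrt r" "0 \<le> log_slope r / (sqrt r * (1 + r))" if "0 < r" for r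
    using log_slope_nonneg[OF that] that by auto
  show ?s1 by (rule riemann_sum_antitone(1)[OF anti1 nonneg(1) F(1) bound1 F(2) assms])
  have "4 * 8 = (32 :: real)" by simp
  with riemann_sum_antitone(2)[OF anti1 nonneg(1) F(1) bound1 F(2) assms] show ?b1 by simp
  show ?s2 by (rule riemann_sum_antitone(1)[OF anti2 nonneg(2) G(1) bound2 G(2) assms])
  from riemann_sum_antitone(2)[OF anti2 nonneg(2) G(1) bound2 G(2) assms] show ?b2 by simp
qed

text \<open>Up to sign this function is what remains of the query kernel once the pole is split off;
  its integral pi is minus the zeroth moment. The antiderivative comes from partial fractions in
  sqrt r.\<close>

lemma smooth_part_riemann_sum:
  assumes "0 < h"
  shows "summable (\<lambda>k. 2 / ((1 + sqrt ((real k + 1 / 2) * h)) * (1 + (real k + 1 / 2) * h)))" (is ?s)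
    and "\<bar>h * (\<Sum>k. 2 / ((1 + sqrt ((real k + 1 / 2) * h)) * (1 + (real k + 1 / 2) * h))) - pi\<bar>
      \<le> 8 * h powr (1 / 4)" (is ?b)
proof -
  define \<Phi> :: "real \<Rightarrow> real" where "\<Phi> = (\<lambda>r. 2 / ((1 + sqrt r) * (1 + r)))"
  define F :: "real \<Rightarrow> real" where
    "F = (\<lambda>r. ln (1 + r) - 2 * ln (1 + sqrt r) + 2 * arctan (sqrt r))"
  have anti: "\<Phi> s \<le> \<Phi> r" if "0 < r" "r \<le> s" for r s
    unfolding \<Phi>_def using that by (intro frac_le mult_mono mult_pos_pos add_pos_nonneg) auto
  have nonneg: "0 \<le> \<Phi> r" if "0 < r" for r
    using that by (simp add: \<Phi>_def)
  have deriv: "(F has_real_derivative \<Phi> r) (at r)" if r: "0 < r" for r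
  proof -
    define v where "v = sqrt r"
    have v: "0 < v" "r = v\<^sup>2" using r by (auto simp: v_def)
    have sq: "(sqrt has_real_derivative inverse v / 2) (at r)"
      using DERIV_real_sqrt[OF r] by (simp add: v_def)
    have 1: "((\<lambda>r. ln (1 + r)) has_real_derivative 1 / (1 + r) * (0 + 1)) (at r)"
      using r by (intro DERIV_chain2[OF DERIV_ln_divide] derivative_intros) auto
    have 2: "((\<lambda>r. ln (1 + sqrt r)) has_real_derivative 1 / (1 + sqrt r) * (0 + inverse v / 2)) (at r)"
      using r by (intro DERIV_chain2[OF DERIV_ln_divide] DERIV_add DERIV_const sq) (auto simp: add_pos_nonneg)
    have 3: "((\<lambda>r. arctan (sqrt r)) has_real_derivative inverse (1 + (sqrt r)\<^sup>2) * (inverse v / 2)) (at r)"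
      by (intro DERIV_chain2[OF DERIV_arctan] sq)
    have "1 / (1 + r) * (0 + 1) - 2 * (1 / (1 + sqrt r) * (0 + inverse v / 2))
        + 2 * (inverse (1 + (sqrt r)\<^sup>2) * (inverse v / 2)) = \<Phi> r"
    proof -
      have ne: "1 + v\<^sup>2 \<noteq> 0" "1 + v \<noteq> 0" using v(1) by (auto simp: add_nonneg_eq_0_iff)
      have "1 / (1 + v\<^sup>2) - 2 * (1 / (1 + v) * (inverse v / 2)) + 2 * (inverse (1 + v\<^sup>2) * (inverse v / 2))
        = 2 / ((1 + v) * (1 + v\<^sup>2))"
        using v(1) ne by (simp add: inverse_eq_divide divide_simps) (simp add: algebra_simps power2_eq_square)
      then show ?thesis by (simp add: \<Phi>_def v_def[symmetric] flip: v(2))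
    qed
    moreover have "(F has_real_derivative 1 / (1 + r) * (0 + 1)
        - 2 * (1 / (1 + sqrt r) * (0 + inverse v / 2))
        + 2 * (inverse (1 + (sqrt r)\<^sup>2) * (inverse v / 2))) (at r)"
      unfolding F_def by (rule DERIV_add[OF DERIV_diff[OF 1 DERIV_cmult[OF 2]] DERIV_cmult[OF 3]])
    ultimately show ?thesis by (simp only:)
  qed
  have bound: "\<Phi> r \<le> 2 * r powr (- 3 / 4)" if r: "0 < r" for r
  proof -
    obtain q where q: "0 < q" "r = q ^ 8" "sqrt r = q ^ 4" "r powr (- 3 / 4) = 1 / q ^ 6"
      using eighth_root[OF r] by metis
    have "q ^ 6 \<le> (1 + q ^ 4) * (1 + q ^ 8)"
    proof (cases "q \<le> 1")
      case True
      then have "q ^ 6 \<le> 1" using q(1) by (simp add: power_le_one)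
      moreover have "1 * 1 \<le> (1 + q ^ 4) * (1 + q ^ 8)" by (intro mult_mono) auto
      ultimately show ?thesis by linarith
    next
      case False
      then have "q ^ 6 \<le> q ^ 8" by (intro power_increasing) auto
      moreover have "1 * q ^ 8 \<le> (1 + q ^ 4) * (1 + q ^ 8)" by (intro mult_mono) auto
      ultimately show ?thesis by linarith
    qed
    then show ?thesis unfolding \<Phi>_def q(4) q(3) unfolding q(2)
      using q(1) by (simp add: frac_le)
  qed
  have lim: "((\<lambda>X. F X - F (1 / X)) \<longlongrightarrow> pi) at_top"
    unfolding F_def by real_asymp
  note R = riemann_sum_antitone[OF anti nonneg deriv bound lim assms]
  show ?s using R(1) by (simp add: \<Phi>_def)
  show ?b using R(2) by (simp add: \<Phi>_def)
qed

text \<open>Substituting r = v^4 turns the integral into that of 8 / (1 + v^2). The function is the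
  majorant for the second logarithmic moment, which has to be bounded but not evaluated.\<close>

lemma dominating_riemann_sum:
  assumes "0 < h"
  shows "summable (\<lambda>k. 2 * ((real k + 1 / 2) * h) powr (- 3 / 4) / (1 + sqrt ((real k + 1 / 2) * h)))" (is ?s)
    and "\<bar>h * (\<Sum>k. 2 * ((real k + 1 / 2) * h) powr (- 3 / 4) / (1 + sqrt ((real k + 1 / 2) * h))) - 4 * pi\<bar>
      \<le> 8 * h powr (1 / 4)" (is ?b)
proof -
  define \<Phi> :: "real \<Rightarrow> real" where "\<Phi> = (\<lambda>r. 2 * r powr (- 3 / 4) / (1 + sqrt r))"
  define F :: "real \<Rightarrow> real" where "F = (\<lambda>r. 8 * arctan (r powr (1 / 4)))"
  have anti: "\<Phi> s \<le> \<Phi> r" if "0 < r" "r \<le> s" for r s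
    unfolding \<Phi>_def using that
    by (intro frac_le mult_left_mono powr_mono2' add_pos_nonneg) auto
  have nonneg: "0 \<le> \<Phi> r" if "0 < r" for r
    using that by (simp add: \<Phi>_def)
  have deriv: "(F has_real_derivative \<Phi> r) (at r)" if r: "0 < r" for r
  proof -
    have "(F has_real_derivative 8 * (inverse (1 + (r powr (1 / 4))\<^sup>2) * (1 / 4 * r powr (1 / 4 - 1)))) (at r)"
      unfolding F_def
      by (rule DERIV_cmult[OF DERIV_chain2[OF DERIV_arctan has_real_derivative_powr[OF r]]])
    moreover have "(r powr (1 / 4))\<^sup>2 = sqrt r"
      using r by (simp add: powr_half_sqrt[symmetric] powr_power)
    moreover have "r powr (1 / 4 - 1) = r powr (- 3 / 4)"
      by (rule arg_cong[of _ _ "(powr) r"]) linarith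
    moreover have "8 * (inverse d * (1 / 4 * p)) = 2 * p / d" for p d :: real
      by (simp add: inverse_eq_divide)
    ultimately show ?thesis unfolding \<Phi>_def by metis
  qed
  have bound: "\<Phi> r \<le> 2 * r powr (- 3 / 4)" if r: "0 < r" for r
  proof -
    have "\<Phi> r \<le> 2 * r powr (- 3 / 4) / 1"
      unfolding \<Phi>_def using r by (intro divide_left_mono) (auto intro: add_pos_nonneg)
    then show ?thesis by simp
  qed
  have lim: "((\<lambda>X. F X - F (1 / X)) \<longlongrightarrow> 4 * pi) at_top"
    unfolding F_def by real_asymp
  note R = riemann_sum_antitone[OF anti nonneg deriv bound lim assms]
  show ?s using R(1) by (simp add: \<Phi>_def)
  show ?b using R(2) by (simp add: \<Phi>_def)
qed

text \<open>The partial sums telescope because the summands run through all half-integers, each sign once.\<close>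

lemma half_integer_reciprocals_cancel:
  "(\<lambda>k. 1 / (real X - (real k + 1 / 2)) + 1 / (real X + (real k + 1 / 2))) sums 0"
proof -
  define t where "t = (\<lambda>k. 1 / (real X - (real k + 1 / 2)) + 1 / (real X + (real k + 1 / 2)))"
  have sum_split: "(\<Sum>i<M + N. f i) = (\<Sum>i<M. f i) + (\<Sum>i<N. f (M + i))"
    for f :: "nat \<Rightarrow> real" and M N
    by (induction N) auto
  have partial: "(\<Sum>k<m + X. t k) = (\<Sum>i<2 * X. 1 / (real m + real i + 1 / 2))" for m
  proof (induction m)
    case 0
    have "(\<Sum>k<X. 1 / (real X - (real k + 1 / 2))) = (\<Sum>k<X. 1 / (real k + 1 / 2))"
      by (subst sum.nat_diff_reindex[symmetric]) (auto intro!: sum.cong simp: of_nat_diff)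
    moreover have "(\<Sum>i<X + X. 1 / (real i + 1 / 2))
        = (\<Sum>i<X. 1 / (real i + 1 / 2)) + (\<Sum>i<X. 1 / (real (X + i) + 1 / 2))"
      using sum_split[of "\<lambda>i. 1 / (real i + 1 / 2)"] .
    ultimately show ?case by (simp add: t_def sum.distrib mult_2 add_ac)
  next
    case (Suc m)
    define g where "g = (\<lambda>i. 1 / (real m + real i + 1 / 2))"
    have "(\<Sum>i<2 * X. 1 / (real (Suc m) + real i + 1 / 2)) = (\<Sum>i<2 * X. g (Suc i))"
      by (simp add: g_def add_ac)
    also have "\<dots> = (\<Sum>i<2 * X. g i) + g (2 * X) - g 0"
      using sum.lessThan_Suc_shift[of g "2 * X"] by simp
    also have "g (2 * X) - g 0 = t (m + X)"
    proof -
      have "real X - (real (m + X) + 1 / 2) = - (real m + 1 / 2)" by simp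
      then have "1 / (real X - (real (m + X) + 1 / 2)) = 1 / - (real m + 1 / 2)"
        by (rule arg_cong)
      also have "\<dots> = - g 0"
        by (simp only: g_def minus_divide_right of_nat_0 add_0_right)
      finally have "1 / (real X - (real (m + X) + 1 / 2)) = - g 0" .
      moreover have "1 / (real X + (real (m + X) + 1 / 2)) = g (2 * X)"
        by (simp add: g_def algebra_simps)
      ultimately show ?thesis by (simp add: t_def)
    qed
    then have "(\<Sum>i<2 * X. g i) + g (2 * X) - g 0 = (\<Sum>k<Suc m + X. t k)"
      using Suc by (simp add: g_def)
    finally show ?case by simp
  qed
  have "(\<lambda>m. \<Sum>i<2 * X. 1 / (real m + real i + 1 / 2)) \<longlonglongrightarrow> 0"
    by (rule tendsto_null_sum) real_asymp
  then have "(\<lambda>m. \<Sum>k<m + X. t k) \<longlonglongrightarrow> 0" unfolding partial .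
  then have "(\<lambda>K. \<Sum>k<K. t k) \<longlonglongrightarrow> 0" by (rule LIMSEQ_offset)
  then show ?thesis by (simp add: sums_def t_def)
qed

section \<open>Moments of the query kernel sampled at half-integers\<close>

text \<open>The three pairs of claims concern the orders 0, 1 and 2 in ln r. Order 0 splits into a
  pole part, whose sum over half-integers vanishes exactly because \<open>X\<close> is an integer,
  and a smooth part; in orders 1 and 2 the zero of ln r removes the pole. The factor
  \<open>exp (\<bar>ln (r k)\<bar> / 16)\<close> leaves room for the Taylor remainder of packets
  with \<sigma> \<le> 1/16.\<close>

lemma hilbert_symbol_sums:
  fixes X :: nat and r :: "nat \<Rightarrow> real"
  assumes X: "1 \<le> X"
  defines "r \<equiv> \<lambda>k. (real k + 1 / 2) / real X"
    and "\<kappa> \<equiv> \<lambda>r. 2 * sqrt r / (1 - r\<^sup>2)"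
  shows "summable (\<lambda>k. \<kappa> (r k))"
    and "\<bar>(\<Sum>k. \<kappa> (r k)) / real X + pi\<bar> \<le> 8 * real X powr (- 1 / 4)"
    and "summable (\<lambda>k. \<kappa> (r k) * ln (r k))"
    and "\<bar>(\<Sum>k. \<kappa> (r k) * ln (r k)) / real X + pi\<^sup>2\<bar> \<le> 128 * real X powr (- 1 / 4)"
    and "summable (\<lambda>k. \<bar>\<kappa> (r k)\<bar> * ((ln (r k))\<^sup>2 * exp (\<bar>ln (r k)\<bar> / 16)))"
    and "(\<Sum>k. \<bar>\<kappa> (r k)\<bar> * ((ln (r k))\<^sup>2 * exp (\<bar>ln (r k)\<bar> / 16))) / real X \<le> 6000"
proof -
  define h where "h = 1 / real X"
  have h: "0 < h" "h powr (1 / 4) = real X powr (- 1 / 4)" "h \<le> 1"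
    using X by (auto simp: h_def powr_minus powr_divide inverse_eq_divide)
  have r_pos: "0 < r k" for k using X by (simp add: r_def)
  have r_h: "(real k + 1 / 2) * h = r k" for k by (simp add: r_def h_def)
  have r_ne: "r k \<noteq> 1" for k
  proof
    assume "r k = 1"
    then have "2 * real k + 1 = 2 * real X" using X by (simp add: r_def field_simps)
    then have "real (2 * k + 1) = real (2 * X)" by simp
    then have "2 * k + 1 = 2 * X" by (simp only: of_nat_eq_iff)
    then show False by presburger
  qed
  have div: "s / real X = h * s" for s by (simp add: h_def)
  have sq: "sqrt (r k) * sqrt (r k) = r k" "0 < sqrt (r k)" for k
    using r_pos[of k] by auto
  have r2: "(r k)\<^sup>2 \<noteq> 1" for k
    using r_ne[of k] r_pos[of k] by (auto simp: power2_eq_1_iff)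

  note L = log_slope_riemann_sum[OF h(1), unfolded r_h h(2)]
  note M = smooth_part_riemann_sum[OF h(1), unfolded r_h h(2)]
  note N = dominating_riemann_sum[OF h(1), unfolded r_h h(2)]

  \<comment> \<open>With v = sqrt r this is 2 v / (1 - v^4) = 1 / (1 - v^2) + 1 / (1 + v^2) - 2 /
    ((1 + v) (1 + v^2)); the first two fractions are the part that cancels over the
    half-integers.\<close>
  have c0: "\<kappa> (r k) = real X * (1 / (real X - (real k + 1 / 2)) + 1 / (real X + (real k + 1 / 2)))
      - 2 / ((1 + sqrt (r k)) * (1 + r k))" for k
  proof -
    define v where "v = sqrt (r k)"
    have v: "0 < v" "r k = v\<^sup>2" using r_pos[of k] by (auto simp: v_def)
    have v1: "v \<noteq> 1" using r_ne[of k] v by auto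
    have y: "real k + 1 / 2 = real X * v\<^sup>2" using X by (simp add: v(2)[symmetric] r_def)
    have "1 - v\<^sup>2 \<noteq> 0" using r_ne[of k] v(2) by simp
    moreover have "1 + v\<^sup>2 \<noteq> 0" "1 + v \<noteq> 0" "1 - v \<noteq> 0"
      using v v1 by (auto simp: add_nonneg_eq_0_iff)
    moreover have "real X * (1 / (real X - real X * v\<^sup>2) + 1 / (real X + real X * v\<^sup>2))
        = 1 / (1 - v\<^sup>2) + 1 / (1 + v\<^sup>2)"
    proof -
      have e: "real X - real X * v\<^sup>2 = real X * (1 - v\<^sup>2)" "real X + real X * v\<^sup>2 = real X * (1 + v\<^sup>2)"
        by (simp_all add: algebra_simps)
      have c: "real X * (1 / (real X * a)) = 1 / a" for a using X by simp
      show ?thesis unfolding e by (subst distrib_left) (simp only: c)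
    qed
    moreover have "1 / (1 - v\<^sup>2) + 1 / (1 + v\<^sup>2) - 2 / ((1 + v) * (1 + v\<^sup>2)) = 2 * v / (1 - (v\<^sup>2)\<^sup>2)"
    proof -
      have e: "1 - v\<^sup>2 = (1 - v) * (1 + v)" "1 - (v\<^sup>2)\<^sup>2 = (1 - v) * (1 + v) * (1 + v\<^sup>2)" by algebra+
      define d where "d = (1 - v) * ((1 + v) * (1 + v\<^sup>2))"
      have third: "(1 - v) * 2 / d = 2 / ((1 + v) * (1 + v\<^sup>2))"
        unfolding d_def by (rule mult_divide_mult_cancel_left[OF calculation(4)])
      have "1 / ((1 - v) * (1 + v)) = (1 + v\<^sup>2) / d" "1 / (1 + v\<^sup>2) = (1 - v) * (1 + v) / d"
        unfolding d_def using calculation(2-4) by simp_all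
      then have "1 / ((1 - v) * (1 + v)) + 1 / (1 + v\<^sup>2) - 2 / ((1 + v) * (1 + v\<^sup>2))
          = ((1 + v\<^sup>2) + (1 - v) * (1 + v) - (1 - v) * 2) / d"
        by (simp only: add_divide_distrib diff_divide_distrib third)
      also have "(1 + v\<^sup>2) + (1 - v) * (1 + v) - (1 - v) * 2 = 2 * v" by algebra
      finally show ?thesis unfolding e d_def by (simp only: mult.assoc)
    qed
    ultimately show ?thesis
      unfolding \<kappa>_def y using v by (simp add: v_def[symmetric])
  qed
  \<comment> \<open>The integrals pi^2 and pi^2 / 2 thus combine to the first moment - 2 (pi^2 -
    pi^2 / 2) = - pi^2.\<close>
  have c1: "\<kappa> (r k) * ln (r k) = - 2 * (log_slope (r k) / sqrt (r k)
      - log_slope (r k) / (sqrt (r k) * (1 + r k)))" for k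
  proof -
    define v l where "v = sqrt (r k)" and "l = ln (r k)"
    have v: "0 < v" "r k = v\<^sup>2" using r_pos[of k] by (auto simp: v_def)
    have ne: "v\<^sup>2 - 1 \<noteq> 0" "1 + v\<^sup>2 \<noteq> 0" "v \<noteq> 0"
      using r_ne[of k] v by (auto simp: add_nonneg_eq_0_iff)
    have e: "1 - (v\<^sup>2)\<^sup>2 = - ((v\<^sup>2 - 1) * (1 + v\<^sup>2))" by algebra
    have slope: "log_slope (r k) = l / (v\<^sup>2 - 1)"
      using r_ne[of k] by (simp add: log_slope_def l_def v(2))
    have "l / (v\<^sup>2 - 1) / v - l / (v\<^sup>2 - 1) / (v * (1 + v\<^sup>2))
        = l / (v\<^sup>2 - 1) * (1 / v - 1 / (v * (1 + v\<^sup>2)))"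
      by (simp add: right_diff_distrib)
    also have "1 / v - 1 / (v * (1 + v\<^sup>2)) = v / (1 + v\<^sup>2)"
      using ne by (simp add: divide_simps) (simp add: algebra_simps power2_eq_square)
    finally have fin: "- 2 * (l / (v\<^sup>2 - 1) / v - l / (v\<^sup>2 - 1) / (v * (1 + v\<^sup>2)))
        = 2 * v / - ((v\<^sup>2 - 1) * (1 + v\<^sup>2)) * l" by simp
    have "sqrt (r k) = v" by (simp add: v_def)
    moreover have "1 + r k = 1 + v\<^sup>2" by (simp only: v(2))
    moreover have "1 - (r k)\<^sup>2 = - ((v\<^sup>2 - 1) * (1 + v\<^sup>2))" unfolding v(2) by (rule e)
    ultimately show ?thesis unfolding slope \<kappa>_def l_def[symmetric] by (simp only: fin)
  qed
  \<comment> \<open>One factor ln r cancels the pole through \<open>log_slope\<close>; the other is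
    absorbed into the exponential, |ln r| exp (|ln r| / 16) \<le> 16 exp (|ln r| / 8), which for r =
    q^8 is at most 16 (q + 1/q).\<close>
  have c2: "\<bar>\<kappa> (r k)\<bar> * ((ln (r k))\<^sup>2 * exp (\<bar>ln (r k)\<bar> / 16))
      \<le> 256 * (2 * r k powr (- 3 / 4) / (1 + sqrt (r k)))" for k
  proof -
    obtain q where q: "0 < q" "r k = q ^ 8" "sqrt (r k) = q ^ 4" "r k powr (- 3 / 4) = 1 / q ^ 6"
      using eighth_root[OF r_pos[of k]] by metis
    define w where "w = \<bar>ln (r k)\<bar>"
    have w: "w = 8 * \<bar>ln q\<bar>" using q(1) unfolding w_def q(2) by (simp add: ln_realpow abs_mult)
    have "w / 16 \<le> exp (w / 16)" using exp_ge_add_one_self[of "w / 16"] by linarith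
    then have "w * exp (w / 16) \<le> 16 * exp (w / 16) * exp (w / 16)"
      by (intro mult_right_mono) auto
    also have "\<dots> = 16 * exp (\<bar>ln q\<bar>)" by (simp add: w exp_add[symmetric])
    also have "exp (\<bar>ln q\<bar>) \<le> q + 1 / q"
      using q(1) by (cases "0 \<le> ln q") (auto simp: exp_minus inverse_eq_divide)
    finally have 1: "w * exp (w / 16) \<le> 16 * (q + 1 / q)" by simp
    have pos: "0 < 1 + q ^ 6" "0 < 1 + q ^ 8" "0 < 1 + q ^ 4" using q(1) by (auto simp: add_pos_pos)
    have slope: "\<bar>ln (r k)\<bar> = \<bar>1 - r k\<bar> * log_slope (r k)"
    proof -
      have "ln (r k) = (r k - 1) * log_slope (r k)" using r_ne[of k] by (simp add: log_slope_def)
      then show ?thesis using log_slope_nonneg[OF r_pos[of k]] by (simp add: abs_mult abs_minus_commute)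
    qed
    have "\<bar>\<kappa> (r k)\<bar> * w = 2 * q ^ 4 / (1 + q ^ 8) * log_slope (r k)"
    proof -
      have e: "1 - (r k)\<^sup>2 = (1 - r k) * (1 + r k)" by algebra
      have "\<bar>\<kappa> (r k)\<bar> = 2 * q ^ 4 / (\<bar>1 - r k\<bar> * (1 + r k))"
        unfolding \<kappa>_def e q(3) using q(1) r_pos[of k] by (simp add: abs_mult)
      then have "\<bar>\<kappa> (r k)\<bar> * w = 2 * q ^ 4 * (\<bar>1 - r k\<bar> * log_slope (r k)) / (\<bar>1 - r k\<bar> * (1 + r k))"
        unfolding w_def slope by simp
      also have "\<dots> = 2 * q ^ 4 * log_slope (r k) / (1 + r k)"
        using r_ne[of k] by simp
      finally show ?thesis by (simp add: q(2))
    qed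
    also have "\<dots> \<le> 2 * q ^ 4 / (1 + q ^ 8) * (8 / (q * (1 + q ^ 6)))"
      unfolding q(2) using log_slope_le[OF q(1)] pos q(1) by (intro mult_left_mono) auto
    finally have 2: "\<bar>\<kappa> (r k)\<bar> * w \<le> 2 * q ^ 4 / (1 + q ^ 8) * (8 / (q * (1 + q ^ 6)))" .
    have "\<bar>\<kappa> (r k)\<bar> * ((ln (r k))\<^sup>2 * exp (\<bar>ln (r k)\<bar> / 16)) = (\<bar>\<kappa> (r k)\<bar> * w) * (w * exp (w / 16))"
      by (simp add: w_def power2_eq_square)
    also have "\<dots> \<le> 2 * q ^ 4 / (1 + q ^ 8) * (8 / (q * (1 + q ^ 6))) * (16 * (q + 1 / q))"
      by (rule mult_mono[OF 2 1]) (use pos q(1) in \<open>auto simp: w_def\<close>)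
    also have "\<dots> = 256 * (q\<^sup>2 * (1 + q\<^sup>2)) / ((1 + q ^ 8) * (1 + q ^ 6))"
    proof -
      have "q + 1 / q = (1 + q\<^sup>2) / q" using q(1) by (simp add: field_simps power2_eq_square)
      moreover have "q ^ 4 = q\<^sup>2 * (q * q)" by algebra
      moreover have "2 * (a * (q * q)) / b * (8 / (q * c)) * (16 * (s / q)) = 256 * (a * s) / (b * c)"
        for a b c s using q(1) by (cases "b = 0"; cases "c = 0"; simp add: field_simps)
      ultimately show ?thesis by metis
    qed
    \<comment> \<open>The target is 256 times the majorant
      \<open>2 * r powr (- 3 / 4) / (1 + sqrt r)\<close> written in q. The inequality (1 + q^2) (1 +
      q^4) \<le> 2 (1 + q^6) behind it is (q^2 - 1)^2 (q^2 + 1) \<ge> 0.\<close>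
    also have "\<dots> \<le> 512 / (q ^ 6 * (1 + q ^ 4))"
    proof -
      have a: "(1 + q\<^sup>2) * (1 + q ^ 4) \<le> 2 * (1 + q ^ 6)"
      proof -
        have "0 \<le> (q\<^sup>2 - 1)\<^sup>2 * (q\<^sup>2 + 1)" by simp
        also have "\<dots> = 2 * (1 + q ^ 6) - (1 + q\<^sup>2) * (1 + q ^ 4)" by algebra
        finally show ?thesis by simp
      qed
      have "256 * (q\<^sup>2 * (1 + q\<^sup>2)) * (q ^ 6 * (1 + q ^ 4)) = 256 * (q ^ 8 * ((1 + q\<^sup>2) * (1 + q ^ 4)))"
        by algebra
      also have "\<dots> \<le> 256 * ((1 + q ^ 8) * (2 * (1 + q ^ 6)))"
        by (rule mult_left_mono[OF mult_mono[OF _ a]]) auto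
      also have "\<dots> = 512 * ((1 + q ^ 8) * (1 + q ^ 6))" by simp
      finally have le: "256 * (q\<^sup>2 * (1 + q\<^sup>2)) * (q ^ 6 * (1 + q ^ 4))
          \<le> 512 * ((1 + q ^ 8) * (1 + q ^ 6))" .
      have "a * d \<le> c * b \<Longrightarrow> 0 < b \<Longrightarrow> 0 < d \<Longrightarrow> a / b \<le> c / d" for a b c d :: real
        by (simp add: divide_simps mult_ac)
      from this[OF le] show ?thesis using pos q(1) by simp
    qed
    also have "\<dots> = 256 * (2 * (1 / q ^ 6) / (1 + q ^ 4))" by simp
    finally show ?thesis unfolding q(3,4) .
  qed

  have rec: "(\<lambda>k. real X * (1 / (real X - (real k + 1 / 2)) + 1 / (real X + (real k + 1 / 2)))) sums 0"
    using sums_mult[OF half_integer_reciprocals_cancel[of X], of "real X"] by simp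
  have s0: "(\<lambda>k. \<kappa> (r k)) sums (0 - (\<Sum>k. 2 / ((1 + sqrt (r k)) * (1 + r k))))"
    unfolding c0 by (intro sums_diff rec summable_sums M(1))
  then show "summable (\<lambda>k. \<kappa> (r k))" by (rule sums_summable)
  show "\<bar>(\<Sum>k. \<kappa> (r k)) / real X + pi\<bar> \<le> 8 * real X powr (- 1 / 4)"
    unfolding div sums_unique[OF s0, symmetric] using M(2) by (simp add: algebra_simps)
  have s1: "(\<lambda>k. \<kappa> (r k) * ln (r k)) sums (- 2 * ((\<Sum>k. log_slope (r k) / sqrt (r k))
      - (\<Sum>k. log_slope (r k) / (sqrt (r k) * (1 + r k)))))"
    unfolding c1 by (intro sums_mult sums_diff summable_sums L)
  then show "summable (\<lambda>k. \<kappa> (r k) * ln (r k))" by (rule sums_summable)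
  show "\<bar>(\<Sum>k. \<kappa> (r k) * ln (r k)) / real X + pi\<^sup>2\<bar> \<le> 128 * real X powr (- 1 / 4)"
    unfolding div sums_unique[OF s1, symmetric] using L(2,4) by (simp add: algebra_simps)
  have dom: "summable (\<lambda>k. 256 * (2 * r k powr (- 3 / 4) / (1 + sqrt (r k))))"
    by (intro summable_mult N(1))
  show s2: "summable (\<lambda>k. \<bar>\<kappa> (r k)\<bar> * ((ln (r k))\<^sup>2 * exp (\<bar>ln (r k)\<bar> / 16)))"
    by (rule summable_comparison_test'[OF dom, of 0]) (use c2 in simp)
  have "(\<Sum>k. \<bar>\<kappa> (r k)\<bar> * ((ln (r k))\<^sup>2 * exp (\<bar>ln (r k)\<bar> / 16)))
      \<le> (\<Sum>k. 256 * (2 * r k powr (- 3 / 4) / (1 + sqrt (r k))))"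
    by (rule suminf_le[OF c2 s2 dom])
  also have "\<dots> = 256 * (\<Sum>k. 2 * r k powr (- 3 / 4) / (1 + sqrt (r k)))"
    by (rule suminf_mult[OF N(1)])
  finally have "h * (\<Sum>k. \<bar>\<kappa> (r k)\<bar> * ((ln (r k))\<^sup>2 * exp (\<bar>ln (r k)\<bar> / 16)))
      \<le> h * (256 * (\<Sum>k. 2 * r k powr (- 3 / 4) / (1 + sqrt (r k))))"
    using h(1) by (intro mult_left_mono) auto
  also have "\<dots> \<le> 256 * (4 * pi + 8)"
  proof -
    have "real X powr (- 1 / 4) \<le> 1"
      using X by (simp add: powr_minus inverse_eq_divide ge_one_powr_ge_zero divide_le_eq)
    with N(2) show ?thesis by (simp add: algebra_simps abs_le_iff)
  qed
  also have "\<dots> \<le> 6000" using pi_less_4 pi_approx by simp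
  finally show "(\<Sum>k. \<bar>\<kappa> (r k)\<bar> * ((ln (r k))\<^sup>2 * exp (\<bar>ln (r k)\<bar> / 16))) / real X \<le> 6000"
    by (simp only: div)
qed

section \<open>The profile of the packets\<close>

text \<open>This profile is chosen because its first two derivatives and its translates are bounded
  by multiples of itself, so every error is again a multiple of the packet, and because its square
  is the derivative of tanh, which makes the masses of packets explicit.\<close>

definition sech :: "real \<Rightarrow> real" where "sech x = 1 / cosh x"

lemma sech_pos: "0 < sech x"
  by (simp add: sech_def)

lemma sech_shift: "sech (x + d) \<le> exp \<bar>d\<bar> * sech x"
proof -
  have mean: "a \<le> E * A \<Longrightarrow> b \<le> E * B \<Longrightarrow> (a + b) / 2 \<le> E * ((A + B) / 2)" for a b E A B :: real
    by (simp add: distrib_left)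
  have "cosh x \<le> exp \<bar>d\<bar> * cosh (x + d)"
    unfolding cosh_field_def by (rule mean) (simp_all flip: exp_add)
  then show ?thesis
    by (simp add: sech_def field_simps)
qed

text \<open>The second derivative 2 sinh^2 / cosh^3 - 1 / cosh lies between - sech and sech, and
  \<open>sech_shift\<close> moves this bound from the intermediate point back to x.\<close>

lemma sech_taylor: "\<bar>sech (x + d) - (sech x - d * (tanh x * sech x))\<bar> \<le> d\<^sup>2 * exp \<bar>d\<bar> * sech x"
proof (cases "d = 0")
  case False
  define D where "D = (\<lambda>m::nat. if m = 0 then sech
    else if m = 1 then (\<lambda>x. - sinh x / (cosh x)\<^sup>2)
    else (\<lambda>x. 2 * (sinh x)\<^sup>2 / (cosh x) ^ 3 - 1 / cosh x))"
  have D0: "DERIV sech t :> - sinh t / (cosh t)\<^sup>2" for t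
    unfolding sech_def by (auto intro!: derivative_eq_intros simp: power2_eq_square)
  have D1: "DERIV (\<lambda>x. - sinh x / (cosh x)\<^sup>2) t :> 2 * (sinh t)\<^sup>2 / (cosh t) ^ 3 - 1 / cosh t" for t :: real
  proof -
    have c: "cosh t \<noteq> 0" by simp
    have "DERIV (\<lambda>x. - sinh x) t :> - cosh t" "DERIV (\<lambda>x. (cosh x)\<^sup>2) t :> 2 * cosh t * sinh t"
      by (auto intro!: derivative_eq_intros)
    from DERIV_divide[OF this] have "DERIV (\<lambda>x. - sinh x / (cosh x)\<^sup>2) t :>
      (- cosh t * (cosh t)\<^sup>2 - - sinh t * (2 * cosh t * sinh t)) / ((cosh t)\<^sup>2 * (cosh t)\<^sup>2)"
      by simp
    also have "(- cosh t * (cosh t)\<^sup>2 - - sinh t * (2 * cosh t * sinh t)) / ((cosh t)\<^sup>2 * (cosh t)\<^sup>2)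
        = 2 * (sinh t)\<^sup>2 / (cosh t) ^ 3 - 1 / cosh t"
      using c by (simp add: field_simps power2_eq_square power3_eq_cube)
    finally show ?thesis .
  qed
  have "\<exists>t. (if x + d < x then x + d < t \<and> t < x else x < t \<and> t < x + d) \<and>
      sech (x + d) = (\<Sum>m<2. (D m x / fact m) * (x + d - x) ^ m) + (D 2 t / fact 2) * (x + d - x)\<^sup>2"
  proof (rule Taylor[where a = "min x (x + d)" and b = "max x (x + d)"])
    show "\<forall>m t. m < 2 \<and> min x (x + d) \<le> t \<and> t \<le> max x (x + d) \<longrightarrow> DERIV (D m) t :> D (Suc m) t"
      using D0 D1 by (auto simp: D_def less_Suc_eq numeral_2_eq_2)
  qed (use False in \<open>auto simp: D_def\<close>)
  then obtain t where T: "if x + d < x then x + d < t \<and> t < x else x < t \<and> t < x + d"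
    and eq: "sech (x + d) = (\<Sum>m<2. (D m x / fact m) * (x + d - x) ^ m) + (D 2 t / fact 2) * (x + d - x)\<^sup>2"
    by blast
  from T have t: "\<bar>t - x\<bar> \<le> \<bar>d\<bar>" by (auto split: if_splits)
  have "- sinh x / (cosh x)\<^sup>2 = - (tanh x * sech x)"
    by (simp add: tanh_def sech_def power2_eq_square)
  then have eq': "sech (x + d) = sech x - d * (tanh x * sech x) + D 2 t / 2 * d\<^sup>2"
    using eq by (simp add: D_def numeral_2_eq_2)
  have "\<bar>D 2 t\<bar> \<le> sech t"
  proof -
    have c: "0 < cosh t" by simp
    have "(sinh t)\<^sup>2 \<le> (cosh t)\<^sup>2" by (simp add: sinh_square_eq)
    then have "2 * (sinh t)\<^sup>2 / cosh t ^ 3 \<le> 2 * (cosh t)\<^sup>2 / cosh t ^ 3"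
      by (intro divide_right_mono) auto
    also have "\<dots> = 2 / cosh t" using c by (simp add: power2_eq_square power3_eq_cube)
    finally have "2 * (sinh t)\<^sup>2 / cosh t ^ 3 \<le> 2 / cosh t" .
    moreover have "0 \<le> 2 * (sinh t)\<^sup>2 / cosh t ^ 3" by simp
    ultimately show ?thesis by (simp add: D_def sech_def abs_le_iff)
  qed
  also have "sech t \<le> exp \<bar>t - x\<bar> * sech x" using sech_shift[of x "t - x"] by simp
  also have "\<dots> \<le> exp \<bar>d\<bar> * sech x"
    using t sech_pos[of x] by (intro mult_right_mono) auto
  finally have "\<bar>D 2 t\<bar> \<le> exp \<bar>d\<bar> * sech x" .
  then have "\<bar>D 2 t\<bar> / 2 * d\<^sup>2 \<le> exp \<bar>d\<bar> * sech x * d\<^sup>2"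
    by (intro mult_right_mono) auto
  then show ?thesis by (simp add: eq' abs_mult mult_ac)
qed simp

section \<open>The discrete Hilbert transform and wave packets\<close>

lemma summable_on_dominated:
  fixes f :: "'a \<Rightarrow> 'b :: banach" and g :: "'a \<Rightarrow> real"
  assumes "g summable_on A" "\<And>x. x \<in> A \<Longrightarrow> norm (f x) \<le> g x"
  shows "f summable_on A"
  by (rule abs_summable_summable, rule summable_on_comparison_test[OF assms(1)])
    (use assms(2) in auto)

text \<open>Site a has position a + 1/2, so the map of a to - 1 - a reflects positions at the
  origin. Sums over all sites are folded along this reflection.\<close>

lemma range_int_split:
  "range int \<inter> range (\<lambda>k. - 1 - int k) = {}" "range int \<union> range (\<lambda>k. - 1 - int k) = UNIV"
proof -
  have "x \<in> range int \<union> range (\<lambda>k. - 1 - int k)" for x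
  proof (cases "0 \<le> x")
    case True
    then have "x = int (nat x)" by simp
    then show ?thesis by blast
  next
    case False
    then have "x = - 1 - int (nat (- 1 - x))" by simp
    then show ?thesis by blast
  qed
  then show "range int \<union> range (\<lambda>k. - 1 - int k) = UNIV" by blast
qed auto

lemma of_int_neq_half_integer: "real_of_int e \<noteq> real k + 1 / 2"
proof
  assume "real_of_int e = real k + 1 / 2"
  then have "real_of_int (2 * e) = real_of_int (2 * int k + 1)" by simp
  then have "2 * e = 2 * int k + 1" by (simp only: of_int_eq_iff)
  then show False by presburger
qed

lemma abs_mult_le_squares: "\<bar>u * v\<bar> \<le> u\<^sup>2 + v\<^sup>2" for u v :: real
proof -
  have "2 * (\<bar>u\<bar> * \<bar>v\<bar>) \<le> u\<^sup>2 + v\<^sup>2"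
    using zero_le_power2[of "\<bar>u\<bar> - \<bar>v\<bar>"] by (simp add: power2_diff)
  moreover have "0 \<le> \<bar>u\<bar> * \<bar>v\<bar>" by simp
  ultimately show ?thesis unfolding abs_mult by linarith
qed

lemma powr_minus_half_square: "0 < z \<Longrightarrow> (z powr (- 1 / 2))\<^sup>2 = 1 / z" for z :: real
proof -
  assume "0 < z"
  have "(z powr (- 1 / 2))\<^sup>2 = z powr (- 1 / 2 + - 1 / 2)" by (simp only: power2_eq_square powr_add)
  also have "\<dots> = 1 / z" using \<open>0 < z\<close> by (simp add: powr_minus inverse_eq_divide)
  finally show ?thesis .
qed

lemma has_sum_int_pairs:
  fixes t :: "int \<Rightarrow> real"
  assumes "(t has_sum s) UNIV"
  shows "(\<lambda>k. t (int k) + t (- 1 - int k)) sums s"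
proof -
  define A B where "A = range int" and "B = range (\<lambda>k. - 1 - int k)"
  have AB: "A \<inter> B = {}" and UN: "A \<union> B = UNIV"
    unfolding A_def B_def by (rule range_int_split)+
  have "t summable_on UNIV" using assms by (auto simp: summable_on_def)
  then obtain s1 s2 where s1: "(t has_sum s1) A" and s2: "(t has_sum s2) B"
    using summable_on_subset_banach[of t UNIV] by (meson subset_UNIV summable_on_def)
  have "s = s1 + s2"
    using has_sum_unique[OF assms has_sum_Un_disjoint[OF s1 s2 AB, unfolded UN]] .
  moreover have "((\<lambda>k. t (int k)) has_sum s1) UNIV"
    using s1 unfolding A_def by (subst (asm) has_sum_reindex) (auto simp: o_def)
  moreover have "((\<lambda>k. t (- 1 - int k)) has_sum s2) UNIV"
    using s2 unfolding B_def by (subst (asm) has_sum_reindex) (auto simp: o_def inj_on_def)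
  ultimately show ?thesis by (auto dest!: has_sum_imp_sums intro: sums_add)
qed

lemma nonneg_has_sum_int:
  fixes t :: "int \<Rightarrow> real"
  assumes "\<And>x. 0 \<le> t x" "(\<lambda>k. t (int k)) sums s1" "(\<lambda>k. t (- 1 - int k)) sums s2"
  shows "(t has_sum s1 + s2) UNIV"
proof -
  have 1: "((\<lambda>k. t (int k)) has_sum s1) UNIV" "((\<lambda>k. t (- 1 - int k)) has_sum s2) UNIV"
    using assms by (auto intro: sums_nonneg_imp_has_sum)
  have 2: "(t has_sum s1) (range int)" "(t has_sum s2) (range (\<lambda>k. - 1 - int k))"
    using 1 by (subst has_sum_reindex; auto simp: o_def inj_on_def)+
  show ?thesis
    using has_sum_Un_disjoint[OF 2 range_int_split(1)] by (simp only: range_int_split(2))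
qed

section \<open>The discrete Hilbert kernel and its orthogonality\<close>

text \<open>Its Fourier series is i sgn \<theta> exp (- i \<theta> / 2) on (- pi, pi): the sign of
  the momentum combined with a displacement by half a site. The displacement makes the symbol
  exactly unimodular, which the kernel 1 / (pi m) does not achieve.\<close>

definition hilbert_kernel :: "int \<Rightarrow> real" where
  "hilbert_kernel m = 1 / (pi * (of_int m + 1 / 2))"

lemma hilbert_kernel_square_has_sum: "((\<lambda>m. (hilbert_kernel m)\<^sup>2) has_sum 1) UNIV"
proof -
  have eq: "(hilbert_kernel (int k))\<^sup>2 = 4 / pi\<^sup>2 * (1 / (2 * real k + 1)\<^sup>2)"
    "(hilbert_kernel (- 1 - int k))\<^sup>2 = 4 / pi\<^sup>2 * (1 / (2 * real k + 1)\<^sup>2)" for k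
  proof -
    have e: "real_of_int (int k) + 1 / 2 = (2 * real k + 1) / 2"
      "real_of_int (- 1 - int k) + 1 / 2 = - ((2 * real k + 1) / 2)" by (simp_all add: field_simps)
    have "hilbert_kernel (int k) = 2 / (pi * (2 * real k + 1))"
      "hilbert_kernel (- 1 - int k) = - (2 / (pi * (2 * real k + 1)))"
      unfolding hilbert_kernel_def e by simp_all
    then show "(hilbert_kernel (int k))\<^sup>2 = 4 / pi\<^sup>2 * (1 / (2 * real k + 1)\<^sup>2)"
      "(hilbert_kernel (- 1 - int k))\<^sup>2 = 4 / pi\<^sup>2 * (1 / (2 * real k + 1)\<^sup>2)"
      by (simp_all add: power_divide power_mult_distrib)
  qed
  have "(\<lambda>k. 4 / pi\<^sup>2 * (1 / (2 * real k + 1)\<^sup>2)) sums (4 / pi\<^sup>2 * (pi\<^sup>2 / 8))"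
    by (intro sums_mult odd_inverse_squares_sums)
  then have "(\<lambda>k. 4 / pi\<^sup>2 * (1 / (2 * real k + 1)\<^sup>2)) sums (1 / 2)" by simp
  with nonneg_has_sum_int[of "\<lambda>m. (hilbert_kernel m)\<^sup>2" "1 / 2" "1 / 2"] show ?thesis
    by (simp add: eq)
qed

text \<open>Square summability gives absolute convergence, so the sum may be taken over pairs of
  positions y and - y. Partial fractions of 1 / (y (y + d)) then leave two sums of reciprocals over
  half-integers, seen from 0 and from d, both zero by
  \<open>half_integer_reciprocals_cancel\<close>.\<close>

lemma hilbert_kernel_shift_orthogonal:
  assumes "d \<noteq> 0"
  shows "((\<lambda>m. hilbert_kernel m * hilbert_kernel (m + d)) has_sum 0) UNIV"
proof -
  have bij: "bij_betw (\<lambda>m. m + d) UNIV UNIV" by (rule bij_betw_byWitness[where f' = "\<lambda>m. m - d"]) auto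
  have shift: "((\<lambda>m. (hilbert_kernel (m + d))\<^sup>2) has_sum 1) UNIV"
    using hilbert_kernel_square_has_sum
      has_sum_reindex_bij_betw[OF bij, of "\<lambda>m. (hilbert_kernel m)\<^sup>2"] by blast
  have "(\<lambda>m. hilbert_kernel m * hilbert_kernel (m + d)) summable_on UNIV"
  proof (rule summable_on_dominated)
    show "(\<lambda>m. (hilbert_kernel m)\<^sup>2 + (hilbert_kernel (m + d))\<^sup>2) summable_on UNIV"
      using hilbert_kernel_square_has_sum shift by (intro summable_on_add) (auto simp: summable_on_def)
    show "norm (hilbert_kernel m * hilbert_kernel (m + d))
        \<le> (hilbert_kernel m)\<^sup>2 + (hilbert_kernel (m + d))\<^sup>2" for m
      using abs_mult_le_squares by simp
  qed
  then obtain s where s: "((\<lambda>m. hilbert_kernel m * hilbert_kernel (m + d)) has_sum s) UNIV"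
    by (auto simp: summable_on_def)
  have cancel: "(\<lambda>k. 1 / (of_int e + (real k + 1 / 2)) + 1 / (of_int e - (real k + 1 / 2))) sums 0" for e :: int
  proof (cases "0 \<le> e")
    case True
    then obtain X where "e = int X" by (rule nonneg_int_cases)
    then show ?thesis using half_integer_reciprocals_cancel[of X] by (simp add: add.commute)
  next
    case False
    then have "e = - int (nat (- e))" by simp
    then obtain X where X: "e = - int X" by blast
    have "- (1 / (real X - (real k + 1 / 2)) + 1 / (real X + (real k + 1 / 2)))
        = 1 / (of_int e + (real k + 1 / 2)) + 1 / (of_int e - (real k + 1 / 2))" for k
    proof -
      have "of_int e + (real k + 1 / 2) = - (real X - (real k + 1 / 2))"
        "of_int e - (real k + 1 / 2) = - (real X + (real k + 1 / 2))" using X by auto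
      then show ?thesis by (simp only: minus_add_distrib minus_divide_right)
    qed
    with sums_minus[OF half_integer_reciprocals_cancel[of X]] show ?thesis by simp
  qed
  have "hilbert_kernel (int k) * hilbert_kernel (int k + d)
      + hilbert_kernel (- 1 - int k) * hilbert_kernel (- 1 - int k + d)
      = 1 / (pi\<^sup>2 * of_int d) * ((1 / (of_int 0 + (real k + 1 / 2)) + 1 / (of_int 0 - (real k + 1 / 2)))
        - (1 / (of_int d + (real k + 1 / 2)) + 1 / (of_int d - (real k + 1 / 2))))" for k
  proof -
    define y D where "y = real k + 1 / 2" and "D = real_of_int d"
    have y: "y \<noteq> 0" by (simp add: y_def)
    have half: "of_int e \<noteq> y" for e unfolding y_def by (rule of_int_neq_half_integer)
    have ne: "D + y \<noteq> 0" "D - y \<noteq> 0" "D \<noteq> 0"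
      using half[of d] half[of "- d"] assms by (auto simp: D_def)
    have k: "hilbert_kernel (int k) = 1 / (pi * y)" "hilbert_kernel (- 1 - int k) = 1 / (pi * (- y))"
      "hilbert_kernel (int k + d) = 1 / (pi * (D + y))" "hilbert_kernel (- 1 - int k + d) = 1 / (pi * (D - y))"
      by (simp_all add: hilbert_kernel_def y_def D_def algebra_simps)
    have e: "1 / (a * b) = 1 / (b - a) * (1 / a - 1 / b)" if "a \<noteq> 0" "b \<noteq> 0" "b - a \<noteq> 0" for a b :: real
      using that by (simp add: field_simps)
    have "1 / (pi * y) * (1 / (pi * (D + y))) + 1 / (pi * (- y)) * (1 / (pi * (D - y)))
        = 1 / pi\<^sup>2 * (1 / (y * (D + y)) + 1 / ((- y) * (D - y)))"
    proof -
      have "1 / (pi * a) * (1 / (pi * b)) + 1 / (pi * c) * (1 / (pi * d))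
          = 1 / pi\<^sup>2 * (1 / (a * b) + 1 / (c * d))" for a b c d :: real
        by (simp add: power2_eq_square distrib_left mult_ac)
      then show ?thesis .
    qed
    also have "1 / (y * (D + y)) = 1 / D * (1 / y - 1 / (D + y))"
      using e[of y "D + y"] y ne by simp
    also have "1 / ((- y) * (D - y)) = 1 / D * (1 / (- y) - 1 / (D - y))"
      using e[of "- y" "D - y"] y ne by simp
    also have "1 / pi\<^sup>2 * (1 / D * (1 / y - 1 / (D + y)) + 1 / D * (1 / (- y) - 1 / (D - y)))
        = 1 / (pi\<^sup>2 * D) * ((1 / (0 + y) + 1 / (0 - y)) - (1 / (D + y) + 1 / (D - y)))"
      by (simp add: algebra_simps)
    finally show ?thesis unfolding k by (simp only: y_def D_def of_int_0)
  qed
  with sums_mult[OF sums_diff[OF cancel[of 0] cancel[of d]], of "1 / (pi\<^sup>2 * of_int d)"]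
    has_sum_int_pairs[OF s]
  have "s = 0" by (simp only: diff_self mult_zero_right) (rule sums_unique2)
  with s show ?thesis by simp
qed

section \<open>Wave packets: comparison of values and sums of squares\<close>

text \<open>Squaring turns the power into the density of the measure d (ln y), so masses depend only
  on the profile as a function of ln y, and moving \<open>c\<close> changes the length
  scale.\<close>

definition packet :: "real \<Rightarrow> real \<Rightarrow> real \<Rightarrow> real" where
  "packet \<sigma> c y = \<bar>y\<bar> powr (- 1 / 2) * sech (\<sigma> * (ln \<bar>y\<bar> - c))"

lemma packet_nonneg: "0 \<le> packet \<sigma> c y"
  using sech_pos[of "\<sigma> * (ln \<bar>y\<bar> - c)"] by (simp add: packet_def)

lemma packet_uminus [simp]: "packet \<sigma> c (- y) = packet \<sigma> c y"
  by (simp add: packet_def)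

lemma packet_abs: "packet \<sigma> c \<bar>y\<bar> = packet \<sigma> c y"
  by (simp add: packet_def)

lemma packet_shift_center:
  assumes "0 \<le> \<sigma>" shows "packet \<sigma> (c - d) y \<le> exp (\<sigma> * \<bar>d\<bar>) * packet \<sigma> c y"
proof -
  have "sech (\<sigma> * (ln \<bar>y\<bar> - c) + \<sigma> * d) \<le> exp \<bar>\<sigma> * d\<bar> * sech (\<sigma> * (ln \<bar>y\<bar> - c))"
    by (rule sech_shift)
  then have "\<bar>y\<bar> powr (- 1 / 2) * sech (\<sigma> * (ln \<bar>y\<bar> - (c - d)))
      \<le> \<bar>y\<bar> powr (- 1 / 2) * (exp (\<sigma> * \<bar>d\<bar>) * sech (\<sigma> * (ln \<bar>y\<bar> - c)))"
    using assms by (intro mult_left_mono) (auto simp: algebra_simps abs_mult)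
  then show ?thesis by (simp add: packet_def mult_ac)
qed

lemma packet_ratio:
  assumes "0 < p" "0 < q" "0 \<le> \<sigma>"
  shows "packet \<sigma> c q \<le> exp (\<sigma> * \<bar>ln (q / p)\<bar> - ln (q / p) / 2) * packet \<sigma> c p"
proof -
  define d where "d = ln (q / p)"
  have d: "ln q = ln p + d" using assms by (simp add: d_def ln_div)
  have "q powr (- 1 / 2) = exp (- d / 2) * p powr (- 1 / 2)"
    using assms by (simp add: powr_def d flip: exp_add) (simp add: algebra_simps)
  moreover have "sech (\<sigma> * (ln p - c) + \<sigma> * d) \<le> exp \<bar>\<sigma> * d\<bar> * sech (\<sigma> * (ln p - c))"
    by (rule sech_shift)
  then have "sech (\<sigma> * (ln q - c)) \<le> exp (\<sigma> * \<bar>d\<bar>) * sech (\<sigma> * (ln p - c))"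
    using assms by (simp add: d algebra_simps abs_mult)
  ultimately have "packet \<sigma> c q
      \<le> exp (- d / 2) * p powr (- 1 / 2) * (exp (\<sigma> * \<bar>d\<bar>) * sech (\<sigma> * (ln p - c)))"
    using assms by (simp add: packet_def mult_left_mono)
  also have "\<dots> = exp (\<sigma> * \<bar>d\<bar> - d / 2) * packet \<sigma> c p"
  proof -
    have "exp (- d / 2) * exp (\<sigma> * \<bar>d\<bar>) = exp (\<sigma> * \<bar>d\<bar> - d / 2)" by (simp flip: exp_add)
    then show ?thesis using assms by (simp add: packet_def mult_ac)
  qed
  finally show ?thesis by (simp add: d_def)
qed

lemma packet_antitone:
  assumes "0 < p" "p \<le> q" "0 \<le> \<sigma>" "\<sigma> \<le> 1 / 2"
  shows "packet \<sigma> c q \<le> packet \<sigma> c p"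
proof -
  have ln: "0 \<le> ln (q / p)" using assms by simp
  then have "\<sigma> * \<bar>ln (q / p)\<bar> - ln (q / p) / 2 \<le> 0"
    using mult_right_mono[OF assms(4) ln] by simp
  then have "exp (\<sigma> * \<bar>ln (q / p)\<bar> - ln (q / p) / 2) * packet \<sigma> c p \<le> 1 * packet \<sigma> c p"
    using packet_nonneg by (intro mult_right_mono) auto
  with packet_ratio[of p q \<sigma> c] assms show ?thesis by linarith
qed

text \<open>For \<sigma> \<le> 1/2 the power and the secant together change by a factor of at most
  exp |ln (q / p)| in either direction. This bound serves both for the half-site displacement of the
  kernel and for the translation of the initial packet to the answer.\<close>

lemma packet_perturb:
  assumes "0 < p" "0 < q" "0 \<le> \<sigma>" "\<sigma> \<le> 1 / 2"
  shows "\<bar>packet \<sigma> c q - packet \<sigma> c p\<bar> \<le> (exp \<bar>ln (q / p)\<bar> - 1) * packet \<sigma> c p"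
proof -
  define d where "d = \<bar>ln (q / p)\<bar>"
  have le: "packet \<sigma> c v \<le> exp d * packet \<sigma> c u" if "0 < u" "0 < v" "\<bar>ln (v / u)\<bar> = d" for u v
  proof -
    have "\<sigma> * d \<le> 1 / 2 * d" using assms that by (intro mult_right_mono) auto
    moreover have "- ln (v / u) \<le> d" using that(3) by linarith
    ultimately have "\<sigma> * \<bar>ln (v / u)\<bar> - ln (v / u) / 2 \<le> d" unfolding that(3) by linarith
    then have "exp (\<sigma> * \<bar>ln (v / u)\<bar> - ln (v / u) / 2) * packet \<sigma> c u \<le> exp d * packet \<sigma> c u"
      using packet_nonneg by (intro mult_right_mono) auto
    with packet_ratio[OF that(1,2) assms(3), of c] show ?thesis by linarith
  qed
  have "\<bar>ln (p / q)\<bar> = d" using assms by (simp add: d_def ln_div abs_minus_commute)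
  from le[OF assms(2,1) this] have "packet \<sigma> c p \<le> exp d * packet \<sigma> c q" .
  then have "exp (- d) * packet \<sigma> c p \<le> exp (- d) * (exp d * packet \<sigma> c q)"
    by (intro mult_left_mono) auto
  also have "\<dots> = packet \<sigma> c q" by (simp add: mult.assoc[symmetric] flip: exp_add)
  finally have lower: "exp (- d) * packet \<sigma> c p \<le> packet \<sigma> c q" .
  have "2 \<le> exp d + exp (- d)"
    using exp_ge_add_one_self[of d] exp_ge_add_one_self[of "- d"] by linarith
  then have "0 \<le> (exp d + exp (- d) - 2) * packet \<sigma> c p"
    using packet_nonneg by (intro mult_nonneg_nonneg) auto
  with lower le[OF assms(1,2)] show ?thesis
    by (simp add: abs_le_iff algebra_simps d_def)
qed

text \<open>The squared packet is the exact derivative of \<open>F\<close>, and the packet is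
  antitone, so the sums are compared with increments of \<open>F\<close> cell by cell.\<close>

lemma packet_sum_bounds:
  fixes a b :: nat and \<sigma> c :: real
  assumes "0 < \<sigma>" "\<sigma> \<le> 1 / 2" "a \<le> b"
  defines "y \<equiv> \<lambda>k. real k + 1 / 2" and "F \<equiv> \<lambda>y. tanh (\<sigma> * (ln y - c)) / \<sigma>"
  shows "(\<Sum>k = Suc a..b. (packet \<sigma> c (y k))\<^sup>2) \<le> F (y b) - F (y a)"
    and "F (y b) - F (y a) \<le> (\<Sum>k = a..<b. (packet \<sigma> c (y k))\<^sup>2)"
proof -
  have sq: "(packet \<sigma> c z)\<^sup>2 = 1 / z * (1 - (tanh (\<sigma> * (ln z - c)))\<^sup>2)" if "0 < z" for z
  proof -
    have "(z powr (- 1 / 2))\<^sup>2 = 1 / z" by (rule powr_minus_half_square[OF that])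
    moreover have "(sech x)\<^sup>2 = 1 - (tanh x)\<^sup>2" for x
    proof -
      have "(cosh x)\<^sup>2 \<noteq> 0" by simp
      then have "1 - (tanh x)\<^sup>2 = ((cosh x)\<^sup>2 - (sinh x)\<^sup>2) / (cosh x)\<^sup>2"
        by (simp add: tanh_def power_divide diff_divide_distrib)
      then show ?thesis by (simp add: sech_def power_divide sinh_square_eq)
    qed
    ultimately show ?thesis using that by (simp add: packet_def power_mult_distrib)
  qed
  have deriv: "(F has_real_derivative (packet \<sigma> c z)\<^sup>2) (at z)" if "0 < z" for z
  proof -
    have "((\<lambda>y. tanh (\<sigma> * (ln y - c))) has_real_derivative
        (1 - (tanh (\<sigma> * (ln z - c)))\<^sup>2) * (\<sigma> * (1 / z - 0))) (at z)"
      using that by (intro has_field_derivative_tanh DERIV_cmult DERIV_diff DERIV_ln_divide DERIV_const) auto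
    from DERIV_cdivide[OF this, of \<sigma>] show ?thesis
      using assms(1) by (simp add: F_def sq[OF that] mult.commute)
  qed
  have cell: "(packet \<sigma> c (y (Suc k)))\<^sup>2 \<le> F (y (Suc k)) - F (y k)
      \<and> F (y (Suc k)) - F (y k) \<le> (packet \<sigma> c (y k))\<^sup>2" for k
  proof -
    have "\<exists>z. y k < z \<and> z < y (Suc k) \<and> F (y (Suc k)) - F (y k) = (y (Suc k) - y k) * (packet \<sigma> c z)\<^sup>2"
      by (rule MVT2) (auto simp: y_def intro!: deriv)
    then obtain z where z: "y k < z" "z < y (Suc k)" "F (y (Suc k)) - F (y k) = (packet \<sigma> c z)\<^sup>2"
      by (auto simp: y_def)
    have "packet \<sigma> c (y (Suc k)) \<le> packet \<sigma> c z" "packet \<sigma> c z \<le> packet \<sigma> c (y k)"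
      using z assms(1,2) by (auto intro!: packet_antitone simp: y_def)
    then show ?thesis using z(3) packet_nonneg by (simp add: power_mono)
  qed
  show "(\<Sum>k = Suc a..b. (packet \<sigma> c (y k))\<^sup>2) \<le> F (y b) - F (y a)"
    using assms(3)
  proof (induction b rule: dec_induct)
    case (step b)
    then show ?case using cell[of b] by simp
  qed simp
  show "F (y b) - F (y a) \<le> (\<Sum>k = a..<b. (packet \<sigma> c (y k))\<^sup>2)"
    using assms(3)
  proof (induction b rule: dec_induct)
    case (step b)
    then show ?case using cell[of b] by simp
  qed simp
qed

lemma exp_pi_le:
  assumes "0 < \<sigma>" "\<sigma> \<le> 1 / 16"
  shows "exp (\<sigma> * pi) \<le> 3"
proof -
  have "\<sigma> * pi \<le> 1 / 16 * 4" using assms pi_less_4 by (intro mult_mono) auto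
  then have "exp (\<sigma> * pi) \<le> exp 1" by simp
  then show ?thesis by (rule order_trans[OF _ exp_le])
qed

section \<open>The action of one query on a packet\<close>

text \<open>Taylor expansion of the profile in \<sigma> ln r reduces the sum to the moments of the
  kernel. Divided by - pi, the moments - pi and - pi^2 give g - \<sigma> pi g tanh x, which is also
  the first-order expansion of the packet whose center is moved by pi. Only second-order remainders
  and discretization errors survive.\<close>

lemma packet_hilbert_transform:
  fixes X :: nat and \<sigma> c :: real
  assumes X: "1 \<le> X" and \<sigma>: "0 < \<sigma>" "\<sigma> \<le> 1 / 16"
  defines "y \<equiv> \<lambda>k::nat. real k + 1 / 2"
  shows "\<bar>- (\<Sum>k. packet \<sigma> c (y k) * (2 * y k / ((real X)\<^sup>2 - (y k)\<^sup>2))) / pi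
      - packet \<sigma> (c - pi) (real X)\<bar>
    \<le> 7000 * (\<sigma>\<^sup>2 + real X powr (- 1 / 4)) * packet \<sigma> c (real X)"
proof -
  define r where "r = (\<lambda>k::nat. (real k + 1 / 2) / real X)"
  define \<kappa> :: "real \<Rightarrow> real" where "\<kappa> = (\<lambda>r. 2 * sqrt r / (1 - r\<^sup>2))"
  define x g p \<eta> where "x = \<sigma> * (ln (real X) - c)" and "g = sech x"
    and "p = real X powr (- 1 / 2)" and "\<eta> = real X powr (- 1 / 4)"
  define \<rho> where "\<rho> = (\<lambda>k. sech (x + \<sigma> * ln (r k)) - (g - \<sigma> * ln (r k) * (tanh x * g)))"
  have rk: "(real k + 1 / 2) / real X = r k" for k by (simp add: r_def)
  have \<kappa>z: "2 * sqrt z / (1 - z\<^sup>2) = \<kappa> z" for z by (simp add: \<kappa>_def)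
  note K = hilbert_symbol_sums[OF X, unfolded rk \<kappa>z, folded \<eta>_def]
  have r_pos: "0 < r k" for k using X by (simp add: r_def)
  have g: "0 < g" by (simp add: g_def sech_pos)
  have p: "0 < p" using X by (simp add: p_def)
  have summand: "packet \<sigma> c (y k) * (2 * y k / ((real X)\<^sup>2 - (y k)\<^sup>2))
      = p / real X * (g * \<kappa> (r k) - \<sigma> * (tanh x * g) * (\<kappa> (r k) * ln (r k)) + \<kappa> (r k) * \<rho> k)" for k
  proof -
    have yr: "y k = real X * r k" using X by (simp add: y_def r_def)
    have ln: "ln (y k) = ln (real X) + ln (r k)" using X r_pos[of k] by (simp add: yr ln_mult)
    have pw: "y k powr (- 1 / 2) = p * r k powr (- 1 / 2)"
      using X r_pos[of k] by (simp add: yr p_def powr_mult)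
    have sq: "r k powr (- 1 / 2) * r k = sqrt (r k)"
    proof -
      have "r k powr (- 1 / 2) * r k = r k powr (- 1 / 2) * r k powr 1" using r_pos[of k] by simp
      also have "\<dots> = r k powr (1 / 2)" unfolding powr_add[symmetric] by simp
      finally show ?thesis using r_pos[of k] by (simp add: powr_half_sqrt)
    qed
    have frac: "2 * y k / ((real X)\<^sup>2 - (y k)\<^sup>2) = 1 / real X * (2 * r k / (1 - (r k)\<^sup>2))"
    proof -
      have "(real X)\<^sup>2 - (real X * r k)\<^sup>2 = real X * (real X * (1 - (r k)\<^sup>2))"
        by (simp add: power2_eq_square algebra_simps)
      then show ?thesis unfolding yr using X by simp
    qed
    have "packet \<sigma> c (y k) * (2 * y k / ((real X)\<^sup>2 - (y k)\<^sup>2))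
        = p / real X * (2 * (r k powr (- 1 / 2) * r k) / (1 - (r k)\<^sup>2)) * sech (x + \<sigma> * ln (r k))"
    proof -
      have "packet \<sigma> c (y k) = y k powr (- 1 / 2) * sech (x + \<sigma> * ln (r k))"
        using ln by (simp add: packet_def x_def algebra_simps y_def)
      then show ?thesis unfolding frac pw by simp
    qed
    also have "\<dots> = p / real X * \<kappa> (r k) * sech (x + \<sigma> * ln (r k))"
      unfolding sq \<kappa>_def ..
    also have "sech (x + \<sigma> * ln (r k)) = g - \<sigma> * ln (r k) * (tanh x * g) + \<rho> k"
      by (simp add: \<rho>_def)
    also have "q * b * (g - \<sigma> * l * t + z) = q * (g * b - \<sigma> * t * (b * l) + b * z)" for q b l t z
      by (simp add: algebra_simps)
    finally show ?thesis .
  qed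
  have rho: "\<bar>\<kappa> (r k) * \<rho> k\<bar> \<le> \<sigma>\<^sup>2 * g * (\<bar>\<kappa> (r k)\<bar> * ((ln (r k))\<^sup>2 * exp (\<bar>ln (r k)\<bar> / 16)))" for k
  proof -
    have "\<bar>\<rho> k\<bar> \<le> (\<sigma> * ln (r k))\<^sup>2 * exp \<bar>\<sigma> * ln (r k)\<bar> * g"
      unfolding \<rho>_def g_def by (rule sech_taylor)
    also have "\<dots> \<le> (\<sigma> * ln (r k))\<^sup>2 * exp (\<bar>ln (r k)\<bar> / 16) * g"
    proof -
      have "\<sigma> * \<bar>ln (r k)\<bar> \<le> 1 / 16 * \<bar>ln (r k)\<bar>" using \<sigma> by (intro mult_right_mono) auto
      then show ?thesis using g \<sigma> by (intro mult_right_mono mult_left_mono) (auto simp: abs_mult)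
    qed
    finally have "\<bar>\<kappa> (r k)\<bar> * \<bar>\<rho> k\<bar> \<le> \<bar>\<kappa> (r k)\<bar> * ((\<sigma> * ln (r k))\<^sup>2 * exp (\<bar>ln (r k)\<bar> / 16) * g)"
      by (intro mult_left_mono) auto
    then show ?thesis by (simp add: abs_mult power_mult_distrib mult_ac)
  qed
  have dom: "summable (\<lambda>k. \<sigma>\<^sup>2 * g * (\<bar>\<kappa> (r k)\<bar> * ((ln (r k))\<^sup>2 * exp (\<bar>ln (r k)\<bar> / 16))))"
    by (intro summable_mult K(5))
  have srho: "summable (\<lambda>k. \<bar>\<kappa> (r k) * \<rho> k\<bar>)"
    by (rule summable_comparison_test'[OF dom, of 0]) (use rho in simp)
  have srho': "summable (\<lambda>k. \<kappa> (r k) * \<rho> k)" by (rule summable_rabs_cancel[OF srho])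
  define A B E where "A = (\<Sum>k. \<kappa> (r k)) / real X" and "B = (\<Sum>k. \<kappa> (r k) * ln (r k)) / real X"
    and "E = (\<Sum>k. \<kappa> (r k) * \<rho> k) / real X"
  have "(\<lambda>k. packet \<sigma> c (y k) * (2 * y k / ((real X)\<^sup>2 - (y k)\<^sup>2))) sums
      (p / real X * (g * (\<Sum>k. \<kappa> (r k)) - \<sigma> * (tanh x * g) * (\<Sum>k. \<kappa> (r k) * ln (r k))
        + (\<Sum>k. \<kappa> (r k) * \<rho> k)))"
    unfolding summand
    by (intro sums_mult sums_add sums_diff summable_sums K(1,3) srho')
  then have "(\<Sum>k. packet \<sigma> c (y k) * (2 * y k / ((real X)\<^sup>2 - (y k)\<^sup>2)))
      = p / real X * (g * (\<Sum>k. \<kappa> (r k)) - \<sigma> * (tanh x * g) * (\<Sum>k. \<kappa> (r k) * ln (r k))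
        + (\<Sum>k. \<kappa> (r k) * \<rho> k))" by (rule sums_unique[symmetric])
  also have "\<dots> = p * (g * A - \<sigma> * (tanh x * g) * B + E)"
    by (simp add: A_def B_def E_def add_divide_distrib diff_divide_distrib distrib_left right_diff_distrib)
  finally have total: "(\<Sum>k. packet \<sigma> c (y k) * (2 * y k / ((real X)\<^sup>2 - (y k)\<^sup>2)))
      = p * (g * A - \<sigma> * (tanh x * g) * B + E)" .
  have A: "\<bar>A + pi\<bar> \<le> 8 * \<eta>" using K(2) by (simp add: A_def)
  have B: "\<bar>B + pi\<^sup>2\<bar> \<le> 128 * \<eta>" using K(4) by (simp add: B_def)
  have E: "\<bar>E\<bar> \<le> 6000 * \<sigma>\<^sup>2 * g"
  proof -
    have "\<bar>\<Sum>k. \<kappa> (r k) * \<rho> k\<bar> \<le> (\<Sum>k. \<bar>\<kappa> (r k) * \<rho> k\<bar>)" by (rule summable_rabs[OF srho])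
    also have "\<dots> \<le> (\<Sum>k. \<sigma>\<^sup>2 * g * (\<bar>\<kappa> (r k)\<bar> * ((ln (r k))\<^sup>2 * exp (\<bar>ln (r k)\<bar> / 16))))"
      by (rule suminf_le[OF rho srho dom])
    also have "\<dots> = \<sigma>\<^sup>2 * g * (\<Sum>k. \<bar>\<kappa> (r k)\<bar> * ((ln (r k))\<^sup>2 * exp (\<bar>ln (r k)\<bar> / 16)))"
      by (rule suminf_mult[OF K(5)])
    finally have "\<bar>\<Sum>k. \<kappa> (r k) * \<rho> k\<bar> / real X \<le> \<sigma>\<^sup>2 * g *
        (\<Sum>k. \<bar>\<kappa> (r k)\<bar> * ((ln (r k))\<^sup>2 * exp (\<bar>ln (r k)\<bar> / 16))) / real X"
      by (intro divide_right_mono) auto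
    also have "\<dots> \<le> \<sigma>\<^sup>2 * g * 6000"
      using K(6) g by (simp only: times_divide_eq_right[symmetric]) (intro mult_left_mono; simp)
    finally show ?thesis by (simp add: E_def mult_ac)
  qed
  have T: "\<bar>sech (x + \<sigma> * pi) - (g - \<sigma> * pi * (tanh x * g))\<bar> \<le> 48 * \<sigma>\<^sup>2 * g"
  proof -
    have "exp \<bar>\<sigma> * pi\<bar> \<le> 3" using \<sigma> exp_pi_le[OF \<sigma>] by (simp add: abs_mult)
    moreover have "pi\<^sup>2 \<le> 4\<^sup>2" using pi_less_4 by (intro power_mono) auto
    ultimately have "(\<sigma>\<^sup>2 * pi\<^sup>2) * exp \<bar>\<sigma> * pi\<bar> * g \<le> (\<sigma>\<^sup>2 * 4\<^sup>2) * 3 * g"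
      using g by (intro mult_right_mono mult_mono) auto
    then show ?thesis using sech_taylor[of x "\<sigma> * pi"] by (simp add: g_def power_mult_distrib)
  qed
  have target: "packet \<sigma> (c - pi) (real X) = p * sech (x + \<sigma> * pi)"
    by (simp add: packet_def p_def x_def algebra_simps)
  have source: "packet \<sigma> c (real X) = p * g"
    by (simp add: packet_def p_def x_def g_def)
  have th: "\<bar>tanh x\<bar> \<le> 1" using tanh_real_bounds[of x] by (auto simp: abs_le_iff)
  \<comment> \<open>The error splits into four parts: the discretization errors of the two moments,
    the Taylor remainder inside the sum, and the Taylor remainder of the target packet.\<close>
  have "- (g * A - \<sigma> * (tanh x * g) * B + E) / pi - sech (x + \<sigma> * pi)
      = - (g * (A + pi)) / pi + \<sigma> * (tanh x * g) * (B + pi\<^sup>2) / pi - E / pi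
        - (sech (x + \<sigma> * pi) - (g - \<sigma> * pi * (tanh x * g)))"
  proof -
    have "g * (A + pi) / pi = g * A / pi + g" "\<sigma> * (tanh x * g) * (B + pi\<^sup>2) / pi
        = \<sigma> * (tanh x * g) * B / pi + \<sigma> * (tanh x * g) * pi"
      by (simp_all add: distrib_left add_divide_distrib power2_eq_square)
    then show ?thesis by (simp add: add_divide_distrib diff_divide_distrib)
  qed
  also have "\<bar>\<dots>\<bar> \<le> g * (8 * \<eta>) + g * (128 * \<eta>) + 6000 * \<sigma>\<^sup>2 * g + 48 * \<sigma>\<^sup>2 * g"
  proof -
    have le: "\<bar>z / pi\<bar> \<le> \<bar>z\<bar>" for z
      using pi_gt3 mult_left_mono[of 1 pi "\<bar>z\<bar>"] by (simp add: abs_divide divide_le_eq)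
    have "\<bar>g * (A + pi)\<bar> \<le> g * (8 * \<eta>)"
      using mult_left_mono[OF A, of g] g by (simp add: abs_mult)
    with le[of "g * (A + pi)"] have 1: "\<bar>g * (A + pi) / pi\<bar> \<le> g * (8 * \<eta>)" by linarith
    have "\<bar>\<sigma> * tanh x\<bar> \<le> 1 * 1"
      unfolding abs_mult using \<sigma> th by (intro mult_mono) auto
    then have "\<bar>\<sigma> * tanh x\<bar> * \<bar>B + pi\<^sup>2\<bar> \<le> 1 * (128 * \<eta>)"
      using B by (intro mult_mono) auto
    from mult_left_mono[OF this, of g] g
    have "\<bar>\<sigma> * (tanh x * g) * (B + pi\<^sup>2)\<bar> \<le> g * (128 * \<eta>)" by (simp add: abs_mult mult_ac)
    with le[of "\<sigma> * (tanh x * g) * (B + pi\<^sup>2)"]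
    have 2: "\<bar>\<sigma> * (tanh x * g) * (B + pi\<^sup>2) / pi\<bar> \<le> g * (128 * \<eta>)" by linarith
    have 3: "\<bar>E / pi\<bar> \<le> 6000 * \<sigma>\<^sup>2 * g" using le[of E] E by linarith
    have tri: "\<bar>- a / pi + b - d - e\<bar> \<le> \<bar>a / pi\<bar> + \<bar>b\<bar> + \<bar>d\<bar> + \<bar>e\<bar>" for a b d e :: real
      unfolding minus_divide_left[symmetric] by arith
    show ?thesis
      using tri[of "g * (A + pi)" "\<sigma> * (tanh x * g) * (B + pi\<^sup>2) / pi" "E / pi"
        "sech (x + \<sigma> * pi) - (g - \<sigma> * pi * (tanh x * g))"] 1 2 3 T by linarith
  qed
  also have "\<dots> \<le> 7000 * (\<sigma>\<^sup>2 + \<eta>) * g"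
  proof -
    have "0 \<le> \<sigma>\<^sup>2 * g" "0 \<le> \<eta> * g" using g by (auto simp: \<eta>_def)
    then show ?thesis by (simp add: algebra_simps)
  qed
  finally have "p * \<bar>- (g * A - \<sigma> * (tanh x * g) * B + E) / pi - sech (x + \<sigma> * pi)\<bar>
      \<le> p * (7000 * (\<sigma>\<^sup>2 + \<eta>) * g)" using p by (intro mult_left_mono) auto
  moreover have "\<bar>- (p * (g * A - \<sigma> * (tanh x * g) * B + E)) / pi - p * sech (x + \<sigma> * pi)\<bar>
      = p * \<bar>- (g * A - \<sigma> * (tanh x * g) * B + E) / pi - sech (x + \<sigma> * pi)\<bar>"
  proof -
    have e: "- (p * z) / pi - p * w = p * (- z / pi - w)" for z w by (simp add: algebra_simps)
    show ?thesis unfolding e abs_mult using p by simp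
  qed
  ultimately show ?thesis unfolding total target source \<eta>_def[symmetric] by (simp add: mult_ac)
qed

lemma packet_square_summable:
  assumes "0 < \<sigma>" "\<sigma> \<le> 1 / 2"
  shows "summable (\<lambda>k. (packet \<sigma> c (real k + 1 / 2))\<^sup>2)"
    and "(\<Sum>k. (packet \<sigma> c (real k + 1 / 2))\<^sup>2) \<le> (packet \<sigma> c (1 / 2))\<^sup>2 + 2 / \<sigma>"
proof -
  have le: "(\<Sum>k<K. (packet \<sigma> c (real k + 1 / 2))\<^sup>2) \<le> (packet \<sigma> c (1 / 2))\<^sup>2 + 2 / \<sigma>" for K
  proof -
    have "(\<Sum>k<K. (packet \<sigma> c (real k + 1 / 2))\<^sup>2) \<le> (\<Sum>k<Suc K. (packet \<sigma> c (real k + 1 / 2))\<^sup>2)"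
      by simp
    also have "\<dots> = (packet \<sigma> c (1 / 2))\<^sup>2 + (\<Sum>k = Suc 0..K. (packet \<sigma> c (real k + 1 / 2))\<^sup>2)"
      by (simp only: lessThan_Suc_atMost atMost_atLeast0 sum.atLeast_Suc_atMost[of 0 K] le0) simp
    also have "(\<Sum>k = Suc 0..K. (packet \<sigma> c (real k + 1 / 2))\<^sup>2)
        \<le> tanh (\<sigma> * (ln (real K + 1 / 2) - c)) / \<sigma> - tanh (\<sigma> * (ln (real 0 + 1 / 2) - c)) / \<sigma>"
      by (rule packet_sum_bounds(1)) (use assms in auto)
    also have "\<dots> \<le> 1 / \<sigma> - - 1 / \<sigma>"
      using assms tanh_real_bounds by (intro diff_mono divide_right_mono) (auto simp: less_imp_le)
    finally show ?thesis by simp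
  qed
  show s: "summable (\<lambda>k. (packet \<sigma> c (real k + 1 / 2))\<^sup>2)"
    by (rule summableI_nonneg_bounded[OF _ le]) simp
  show "(\<Sum>k. (packet \<sigma> c (real k + 1 / 2))\<^sup>2) \<le> (packet \<sigma> c (1 / 2))\<^sup>2 + 2 / \<sigma>"
    by (rule suminf_le_const[OF s le])
qed

lemma even_has_sum_int:
  fixes t :: "int \<Rightarrow> real"
  assumes "\<And>x. 0 \<le> t x" "\<And>x. t (- 1 - x) = t x" "summable (\<lambda>k. t (int k))"
  shows "(t has_sum 2 * (\<Sum>k. t (int k))) UNIV"
  using nonneg_has_sum_int[of t "\<Sum>k. t (int k)" "\<Sum>k. t (int k)"] assms
  by (simp add: summable_sums)

lemma packet_int_square_has_sum:
  assumes "0 < \<sigma>" "\<sigma> \<le> 1 / 2"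
  shows "((\<lambda>a::int. (packet \<sigma> c (of_int a + 1 / 2))\<^sup>2) has_sum
    2 * (\<Sum>k. (packet \<sigma> c (real k + 1 / 2))\<^sup>2)) UNIV"
proof -
  have "packet \<sigma> c (of_int (- 1 - x) + 1 / 2) = packet \<sigma> c (of_int x + 1 / 2)" for x :: int
  proof -
    have "of_int (- 1 - x) + 1 / 2 = - (real_of_int x + 1 / 2)" by simp
    then show ?thesis by (simp only: packet_uminus)
  qed
  then show ?thesis
    using even_has_sum_int[of "\<lambda>a. (packet \<sigma> c (of_int a + 1 / 2))\<^sup>2"] packet_square_summable(1)[OF assms]
    by simp
qed

lemma hilbert_kernel_reflect_square_has_sum: "((\<lambda>b. (hilbert_kernel (a - b))\<^sup>2) has_sum 1) UNIV"
proof -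
  have "bij_betw (\<lambda>b. a - b) UNIV UNIV"
    by (rule bij_betw_byWitness[where f' = "\<lambda>m. a - m"]) auto
  from has_sum_reindex_bij_betw[OF this, of "\<lambda>m. (hilbert_kernel m)\<^sup>2"]
  show ?thesis using hilbert_kernel_square_has_sum by simp
qed

text \<open>The kernel argument a - b + 1/2 is the distance from the input position b + 1/2 to the
  integer point X = a + 1, so every output is evaluated midway between input sites. The positions y
  and - y carry opposite signs and contribute 1 / (X - y) - 1 / (X + y).\<close>

lemma packet_hilbert_pairs:
  fixes a :: int and \<sigma> c :: real
  assumes \<sigma>: "0 < \<sigma>" "\<sigma> \<le> 1 / 2"
  defines "y \<equiv> \<lambda>k::nat. real k + 1 / 2"
    and "t \<equiv> \<lambda>b. hilbert_kernel (a - b) * ((if b < 0 then - 1 else 1) * packet \<sigma> c (of_int b + 1 / 2))"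
  shows "t summable_on UNIV"
    and "infsum t UNIV = (\<Sum>k. packet \<sigma> c (y k) * (2 * y k / ((of_int (a + 1))\<^sup>2 - (y k)\<^sup>2))) / pi"
proof -
  show summ: "t summable_on UNIV"
  proof (rule summable_on_dominated)
    show "(\<lambda>b. (hilbert_kernel (a - b))\<^sup>2 + (packet \<sigma> c (of_int b + 1 / 2))\<^sup>2) summable_on UNIV"
      using hilbert_kernel_reflect_square_has_sum packet_int_square_has_sum[OF \<sigma>]
      by (intro summable_on_add) (auto simp: summable_on_def)
    show "norm (t b) \<le> (hilbert_kernel (a - b))\<^sup>2 + (packet \<sigma> c (of_int b + 1 / 2))\<^sup>2" for b
      using abs_mult_le_squares[of "hilbert_kernel (a - b)" "packet \<sigma> c (of_int b + 1 / 2)"]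
      by (simp add: t_def abs_mult)
  qed
  have pair: "t (int k) + t (- 1 - int k)
      = packet \<sigma> c (y k) * (2 * y k / ((of_int (a + 1))\<^sup>2 - (y k)\<^sup>2)) * (1 / pi)" for k
  proof -
    define X where "X = real_of_int (a + 1)"
    have half: "of_int e \<noteq> y k" for e unfolding y_def by (rule of_int_neq_half_integer)
    have ne: "X - y k \<noteq> 0" "X + y k \<noteq> 0"
      using half[of "a + 1"] half[of "- (a + 1)"] by (auto simp: X_def simp del: of_int_add)
    have "of_int (a - int k) + 1 / 2 = X - y k" "of_int (a - (- 1 - int k)) + 1 / 2 = X + y k"
      by (simp_all add: X_def y_def)
    then have h: "hilbert_kernel (a - int k) = 1 / (pi * (X - y k))"
      "hilbert_kernel (a - (- 1 - int k)) = 1 / (pi * (X + y k))"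
      by (simp_all only: hilbert_kernel_def)
    have "real_of_int (- 1 - int k) + 1 / 2 = - y k" by (simp add: y_def)
    then have p: "packet \<sigma> c (of_int (- 1 - int k) + 1 / 2) = packet \<sigma> c (y k)"
      by (simp only: packet_uminus)
    have "X\<^sup>2 - (y k)\<^sup>2 = (X - y k) * (X + y k)" by algebra
    moreover have "1 / (X - y k) - 1 / (X + y k) = 2 * y k / ((X - y k) * (X + y k))"
      using ne by (simp add: diff_frac_eq)
    ultimately have frac: "2 * y k / (X\<^sup>2 - (y k)\<^sup>2) = 1 / (X - y k) - 1 / (X + y k)" by simp
    have "t (int k) + t (- 1 - int k) = 1 / (pi * (X - y k)) * packet \<sigma> c (y k)
        - 1 / (pi * (X + y k)) * packet \<sigma> c (y k)"
      unfolding t_def h p by (simp add: y_def)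
    also have "\<dots> = packet \<sigma> c (y k) * (1 / (X - y k) - 1 / (X + y k)) * (1 / pi)"
      by (simp add: algebra_simps)
    also have "1 / (X - y k) - 1 / (X + y k) = 2 * y k / (X\<^sup>2 - (y k)\<^sup>2)" by (rule frac[symmetric])
    finally show ?thesis unfolding X_def .
  qed
  have sums: "(\<lambda>k. packet \<sigma> c (y k) * (2 * y k / ((of_int (a + 1))\<^sup>2 - (y k)\<^sup>2)) * (1 / pi)) sums infsum t UNIV"
    using has_sum_int_pairs[OF has_sum_infsum[OF summ]] unfolding pair .
  have "(\<lambda>k. packet \<sigma> c (y k) * (2 * y k / ((of_int (a + 1))\<^sup>2 - (y k)\<^sup>2))) sums (infsum t UNIV * pi)"
    using sums_mult2[OF sums, of pi] by simp
  then show "infsum t UNIV = (\<Sum>k. packet \<sigma> c (y k) * (2 * y k / ((of_int (a + 1))\<^sup>2 - (y k)\<^sup>2))) / pi"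
    by (simp add: sums_unique[symmetric])
qed

text \<open>The shift of the center by \<open>pi\<close> is the source of the constant \<open>1 / pi\<close>.\<close>

lemma packet_step:
  obtains C where "0 < C"
    "\<And>\<sigma> c a. 0 < \<sigma> \<Longrightarrow> \<sigma> \<le> 1 / 16 \<Longrightarrow>
      \<bar>- (\<Sum>\<^sub>\<infinity>b. hilbert_kernel (a - b) * ((if b < 0 then - 1 else 1) * packet \<sigma> c (of_int b + 1 / 2)))
        - packet \<sigma> (c - pi) (of_int a + 1 / 2)\<bar>
      \<le> C * (\<sigma>\<^sup>2 + \<bar>of_int a + 1 / 2\<bar> powr (- 1 / 4)) * packet \<sigma> c (of_int a + 1 / 2)"
proof -
  define Z where "Z = (\<Sum>k. 2 * (2 * real k + 1) powr (- 5 / 4))"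
  have Z_summable: "summable (\<lambda>k. 2 * (2 * real k + 1) powr (- 5 / 4))"
  proof (rule summable_mult, rule summable_comparison_test_ev)
    show "summable (\<lambda>k. real k powr (- 5 / 4))" by (simp add: summable_real_powr_iff)
    show "\<forall>\<^sub>F k in sequentially. norm ((2 * real k + 1) powr (- 5 / 4)) \<le> real k powr (- 5 / 4)"
      using eventually_gt_at_top[of 0] by eventually_elim (auto intro!: powr_mono2')
  qed
  have Z0: "0 \<le> Z" unfolding Z_def by (intro suminf_nonneg Z_summable) simp
  show thesis
  proof
    show "0 < 60000 + Z" using Z0 by simp
  next
    fix \<sigma> c :: real and a :: int
    assume \<sigma>: "0 < \<sigma>" "\<sigma> \<le> 1 / 16"
    then have \<sigma>': "\<sigma> \<le> 1 / 2" by simp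
    define z where "z = real_of_int a + 1 / 2"
    define S where "S = (\<Sum>k. packet \<sigma> c (real k + 1 / 2) *
      (2 * (real k + 1 / 2) / ((of_int (a + 1))\<^sup>2 - (real k + 1 / 2)\<^sup>2)))"
    have eq: "(\<Sum>\<^sub>\<infinity>b. hilbert_kernel (a - b) * ((if b < 0 then - 1 else 1) * packet \<sigma> c (of_int b + 1 / 2))) = S / pi"
      unfolding S_def by (rule packet_hilbert_pairs(2)[OF \<sigma>(1) \<sigma>'])
    have c_shift: "packet \<sigma> (c - pi) w \<le> 3 * packet \<sigma> c w" for w
    proof -
      have "exp (\<sigma> * \<bar>pi\<bar>) \<le> 3" using exp_pi_le[OF \<sigma>] by simp
      then have "exp (\<sigma> * \<bar>pi\<bar>) * packet \<sigma> c w \<le> 3 * packet \<sigma> c w"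
        using packet_nonneg by (intro mult_right_mono) auto
      with packet_shift_center[of \<sigma> c pi w] \<sigma> show ?thesis by linarith
    qed
    have "\<bar>- (S / pi) - packet \<sigma> (c - pi) z\<bar>
        \<le> (60000 + Z) * (\<sigma>\<^sup>2 + \<bar>z\<bar> powr (- 1 / 4)) * packet \<sigma> c z"
    \<comment> \<open>The evaluation point a + 1 is 0 here, and rescaling by it is impossible. Since
      the weight |z|^(-1/4) exceeds 1, a bound by a multiple of the packet is enough;
      \<open>packet_ratio\<close> reduces it to the convergent sum of q^(-5/4) over q = 2k +
      1.\<close>
    proof (cases "a = - 1")
      case True
      then have z: "\<bar>z\<bar> = 1 / 2" "packet \<sigma> c' z = packet \<sigma> c' (1 / 2)" for c'
        using packet_uminus[of \<sigma> c' "1 / 2"] by (auto simp: z_def)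
      have le: "\<bar>packet \<sigma> c (real k + 1 / 2) * (2 * (real k + 1 / 2) / (0 - (real k + 1 / 2)\<^sup>2))\<bar>
          \<le> packet \<sigma> c (1 / 2) * (2 * (2 * (2 * real k + 1) powr (- 5 / 4)))" for k
      proof -
        define q where "q = 2 * real k + 1"
        have q: "1 \<le> q" "real k + 1 / 2 = q / 2" by (auto simp: q_def)
        have "packet \<sigma> c (q / 2) \<le> exp (\<sigma> * \<bar>ln ((q / 2) / (1 / 2))\<bar> - ln ((q / 2) / (1 / 2)) / 2) * packet \<sigma> c (1 / 2)"
          by (rule packet_ratio) (use q \<sigma> in auto)
        also have "\<dots> = exp (\<sigma> * ln q - ln q / 2) * packet \<sigma> c (1 / 2)" using q by simp
        also have "\<dots> \<le> q powr (- 1 / 4) * packet \<sigma> c (1 / 2)"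
        proof (rule mult_right_mono[OF _ packet_nonneg])
          have "\<sigma> * ln q \<le> 1 / 16 * ln q" using \<sigma> q by (intro mult_right_mono) auto
          then have "\<sigma> * ln q - ln q / 2 \<le> - 1 / 4 * ln q" using ln_ge_zero[OF q(1)] by linarith
          then show "exp (\<sigma> * ln q - ln q / 2) \<le> q powr (- 1 / 4)" using q by (simp add: powr_def)
        qed
        finally have pk: "packet \<sigma> c (q / 2) \<le> q powr (- 1 / 4) * packet \<sigma> c (1 / 2)" .
        have "\<bar>2 * (q / 2) / (0 - (q / 2)\<^sup>2)\<bar> = 4 / q"
          using q by (simp add: power2_eq_square abs_mult)
        then have "\<bar>packet \<sigma> c (q / 2) * (2 * (q / 2) / (0 - (q / 2)\<^sup>2))\<bar> = packet \<sigma> c (q / 2) * (4 / q)"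
          using packet_nonneg[of \<sigma> c "q / 2"] by (simp only: abs_mult abs_of_nonneg)
        also have "\<dots> \<le> q powr (- 1 / 4) * packet \<sigma> c (1 / 2) * (4 / q)"
          using pk q by (intro mult_right_mono) auto
        also have "\<dots> = packet \<sigma> c (1 / 2) * (2 * (2 * (q powr (- 1 / 4) / q)))" by simp
        also have "q powr (- 1 / 4) / q = q powr (- 5 / 4)"
        proof -
          have "q powr (- 1 / 4) / q powr 1 = q powr (- 1 / 4 - 1)" by (rule powr_diff[symmetric])
          then show ?thesis using q by simp
        qed
        finally show ?thesis unfolding q(2) by (simp only: q_def)
      qed
      have dom: "summable (\<lambda>k. packet \<sigma> c (1 / 2) * (2 * (2 * (2 * real k + 1) powr (- 5 / 4))))"
        by (intro summable_mult[OF summable_mult[OF Z_summable]])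
      have sabs: "summable (\<lambda>k. \<bar>packet \<sigma> c (real k + 1 / 2) * (2 * (real k + 1 / 2) / (0 - (real k + 1 / 2)\<^sup>2))\<bar>)"
        by (rule summable_comparison_test'[OF dom, of 0]) (use le in simp)
      have "S = (\<Sum>k. packet \<sigma> c (real k + 1 / 2) * (2 * (real k + 1 / 2) / (0 - (real k + 1 / 2)\<^sup>2)))"
        unfolding S_def using True by simp
      then have "\<bar>S\<bar> \<le> (\<Sum>k. \<bar>packet \<sigma> c (real k + 1 / 2) * (2 * (real k + 1 / 2) / (0 - (real k + 1 / 2)\<^sup>2))\<bar>)"
        using summable_rabs[OF sabs] by simp
      also have "\<dots> \<le> (\<Sum>k. packet \<sigma> c (1 / 2) * (2 * (2 * (2 * real k + 1) powr (- 5 / 4))))"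
        by (rule suminf_le[OF le sabs dom])
      also have "\<dots> = packet \<sigma> c (1 / 2) * (2 * Z)"
        unfolding Z_def by (simp only: suminf_mult[OF Z_summable] suminf_mult[OF summable_mult[OF Z_summable]])
      finally have S: "\<bar>S\<bar> \<le> packet \<sigma> c (1 / 2) * (2 * Z)" .
      have "\<bar>- (S / pi) - packet \<sigma> (c - pi) z\<bar> \<le> \<bar>S\<bar> / pi + packet \<sigma> (c - pi) z"
      proof -
        have "\<bar>- (S / pi) - packet \<sigma> (c - pi) z\<bar> \<le> \<bar>S / pi\<bar> + \<bar>packet \<sigma> (c - pi) z\<bar>" by arith
        then show ?thesis using packet_nonneg[of \<sigma> "c - pi" z] by (simp add: abs_divide)
      qed
      also have "\<bar>S\<bar> / pi \<le> \<bar>S\<bar> / 2" using pi_gt3 by (intro divide_left_mono) auto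
      also have "\<bar>S\<bar> / 2 \<le> Z * packet \<sigma> c z" using S by (simp add: z mult.commute)
      also have "packet \<sigma> (c - pi) z \<le> 3 * packet \<sigma> c z" by (rule c_shift)
      also have "Z * packet \<sigma> c z + 3 * packet \<sigma> c z \<le> (60000 + Z) * 1 * packet \<sigma> c z"
        using packet_nonneg[of \<sigma> c z] by (simp add: algebra_simps)
      also have "\<dots> \<le> (60000 + Z) * (\<sigma>\<^sup>2 + \<bar>z\<bar> powr (- 1 / 4)) * packet \<sigma> c z"
      proof (rule mult_right_mono[OF mult_left_mono packet_nonneg])
        have "1 = (1::real) powr (- 1 / 4)" by simp
        also have "\<dots> \<le> (1 / 2) powr (- 1 / 4)" by (intro powr_mono2') auto
        finally show "1 \<le> \<sigma>\<^sup>2 + \<bar>z\<bar> powr (- 1 / 4)" unfolding z using zero_le_power2[of \<sigma>] by linarith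
      qed (use Z0 in simp)
      finally show ?thesis by simp
    next
      case False
      define X where "X = nat \<bar>a + 1\<bar>"
      have X: "1 \<le> X" "(real_of_int (a + 1))\<^sup>2 = (real X)\<^sup>2" using False by (auto simp: X_def)
      define w where "w = \<bar>z\<bar>"
      have w: "1 / 2 \<le> w" "\<bar>w - real X\<bar> = 1 / 2" "w \<le> real X \<Longrightarrow> real X = w + 1 / 2"
        and w_pos: "0 < w"
        using False by (auto simp: w_def z_def X_def abs_if)
      have w3: "real X < w \<Longrightarrow> 3 / 2 \<le> w" using w X(1) by linarith
      \<comment> \<open>The transform is evaluated at a + 1, but the packet is wanted at a + 1/2. In
        absolute value these points differ by 1/2, in a direction that depends on the sign of a, a
        relative change of at most 1 / w.\<close>
      have ratio: "exp \<bar>ln (real X / w)\<bar> - 1 \<le> 1 / w"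
      proof (cases "w \<le> real X")
        case True
        then have "0 \<le> ln (real X / w)" using w_pos X by simp
        then have "exp \<bar>ln (real X / w)\<bar> = real X / w" using w_pos X by simp
        moreover have "real X / w - 1 = 1 / 2 / w"
          using w(3)[OF True] w_pos by (simp add: add_divide_distrib)
        moreover have "1 / 2 / w \<le> 1 / w" using w_pos by (intro divide_right_mono) auto
        ultimately show ?thesis by simp
      next
        case False
        then have f: "w = real X + 1 / 2" "3 / 2 \<le> w" using w w3 by auto
        have "ln (real X / w) \<le> 0" using w_pos X False by simp
        then have "\<bar>ln (real X / w)\<bar> = ln (w / real X)" using w_pos X(1) by (simp add: ln_div)
        moreover have "0 < w / real X" using w_pos X(1) by simp
        ultimately have "exp \<bar>ln (real X / w)\<bar> = w / real X" by (simp only: exp_ln)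
        moreover have "w / real X - 1 = 1 / (2 * real X)"
          using X(1) by (simp add: f(1) add_divide_distrib)
        moreover have "1 / (2 * real X) \<le> 1 / w" using X(1) f w_pos by (intro divide_left_mono) auto
        ultimately show ?thesis by simp
      qed
      have lew: "1 / w \<le> 2" using w(1) w_pos by (simp add: divide_simps)
      have near: "\<bar>packet \<sigma> c' (real X) - packet \<sigma> c' w\<bar> \<le> 1 / w * packet \<sigma> c' w" for c'
        using packet_perturb[of w "real X" \<sigma> c'] w_pos X \<sigma> \<sigma>'
          mult_right_mono[OF ratio packet_nonneg[of \<sigma> c' w]] by simp
      have srcX: "packet \<sigma> c (real X) \<le> 3 * packet \<sigma> c w"
        using near[of c] mult_right_mono[OF lew packet_nonneg[of \<sigma> c w]] by (simp add: abs_le_iff)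
      have powX: "real X powr (- 1 / 4) \<le> 2 * w powr (- 1 / 4)"
      proof -
        have "w / 2 \<le> real X" using w X(1) by linarith
        then have "real X powr (- 1 / 4) \<le> (w / 2) powr (- 1 / 4)" using w_pos by (intro powr_mono2') auto
        also have "\<dots> = 2 powr (1 / 4) * w powr (- 1 / 4)"
          using w_pos by (simp add: powr_divide powr_minus field_simps)
        also have "\<dots> \<le> 2 * w powr (- 1 / 4)"
          using powr_mono[of "1 / 4" 1 "2 :: real"] by (intro mult_right_mono) auto
        finally show ?thesis .
      qed
      have invw: "1 / w \<le> 2 * w powr (- 1 / 4)"
      proof -
        have "1 / w = w powr (- 3 / 4) * w powr (- 1 / 4)"
          unfolding powr_add[symmetric] using w_pos by (simp add: powr_minus_divide)
        also have "w powr (- 3 / 4) \<le> (1 / 2) powr (- 3 / 4)" using w by (intro powr_mono2') auto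
        also have "(1 / 2 :: real) powr (- 3 / 4) = 2 powr (3 / 4)"
          by (simp add: powr_divide powr_minus field_simps)
        also have "(2 :: real) powr (3 / 4) \<le> 2"
          using powr_mono[of "3 / 4" 1 "2 :: real"] by simp
        finally show ?thesis by (simp add: mult_right_mono)
      qed
      define e where "e = \<sigma>\<^sup>2 + w powr (- 1 / 4)"
      have e: "0 \<le> e" "\<sigma>\<^sup>2 + real X powr (- 1 / 4) \<le> 2 * e" "1 / w \<le> 2 * e"
      proof -
        have "0 \<le> s \<Longrightarrow> 0 \<le> v \<Longrightarrow> u \<le> 2 * v \<Longrightarrow> 0 \<le> s + v \<and> s + u \<le> 2 * (s + v) \<and> u \<le> 2 * (s + v)"
          for s u v :: real by simp
        from this[OF zero_le_power2[of \<sigma>] powr_ge_zero powX] this[OF zero_le_power2[of \<sigma>] powr_ge_zero invw]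
        show "0 \<le> e" "\<sigma>\<^sup>2 + real X powr (- 1 / 4) \<le> 2 * e" "1 / w \<le> 2 * e"
          unfolding e_def by blast+
      qed
      have "\<bar>- S / pi - packet \<sigma> (c - pi) (real X)\<bar>
          \<le> 7000 * (\<sigma>\<^sup>2 + real X powr (- 1 / 4)) * packet \<sigma> c (real X)"
        using packet_hilbert_transform[OF X(1) \<sigma>, of c] unfolding S_def X(2) .
      also have "\<dots> \<le> 7000 * (2 * e) * (3 * packet \<sigma> c w)"
        using e srcX packet_nonneg by (intro mult_mono) auto
      finally have 1: "\<bar>- S / pi - packet \<sigma> (c - pi) (real X)\<bar> \<le> 42000 * (e * packet \<sigma> c w)" by simp
      have "1 / w * packet \<sigma> (c - pi) w \<le> 2 * e * (3 * packet \<sigma> c w)"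
        using e c_shift packet_nonneg by (intro mult_mono) auto
      with near[of "c - pi"]
      have 2: "\<bar>packet \<sigma> (c - pi) (real X) - packet \<sigma> (c - pi) w\<bar> \<le> 6 * (e * packet \<sigma> c w)" by simp
      have 3: "0 \<le> e * packet \<sigma> c w" "0 \<le> Z * (e * packet \<sigma> c w)"
        using e packet_nonneg Z0 by auto
      have "\<bar>- (S / pi) - packet \<sigma> (c - pi) w\<bar> \<le> 60000 * (e * packet \<sigma> c w) + Z * (e * packet \<sigma> c w)"
        using 1 2 3 by simp
      then show ?thesis
        using packet_abs[of \<sigma> c z] packet_abs[of \<sigma> "c - pi" z]
        by (simp add: e_def w_def algebra_simps)
    qed
    then show "\<bar>- (\<Sum>\<^sub>\<infinity>b. hilbert_kernel (a - b) * ((if b < 0 then - 1 else 1) * packet \<sigma> c (of_int b + 1 / 2)))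
        - packet \<sigma> (c - pi) (of_int a + 1 / 2)\<bar>
      \<le> (60000 + Z) * (\<sigma>\<^sup>2 + \<bar>of_int a + 1 / 2\<bar> powr (- 1 / 4)) * packet \<sigma> c (of_int a + 1 / 2)"
      unfolding eq z_def .
  qed
qed

section \<open>Norms, tails and translations of packets\<close>

lemma one_minus_tanh_le: "1 - tanh x \<le> 2 * exp (- 2 * x)" for x :: real
proof -
  define e where "e = exp (- 2 * x)"
  have e: "0 < e" by (simp add: e_def)
  have "1 - tanh x = 1 - (1 - e) / (1 + e)" by (simp add: tanh_real_altdef e_def)
  also have "\<dots> = 2 * e / (1 + e)" using e by (simp add: field_simps)
  also have "\<dots> \<le> 2 * e / 1" using e by (intro divide_left_mono) auto
  finally show ?thesis by (simp add: e_def)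
qed

lemma sech_le_exp: "sech x \<le> 2 * exp x"
proof -
  have "cosh x \<ge> exp (- x) / 2" by (simp add: cosh_field_def)
  then have "1 / cosh x \<le> 1 / (exp (- x) / 2)" by (intro divide_left_mono) auto
  also have "1 / (exp (- x) / 2) = 2 * exp x" by (simp add: exp_minus field_simps)
  finally show ?thesis by (simp only: sech_def)
qed

lemma sech_le_1: "sech x \<le> 1"
  using cosh_real_ge_1[of x] by (simp add: sech_def divide_simps)

lemma packet_square_le:
  assumes "0 < y"
  shows "(packet \<sigma> c y)\<^sup>2 \<le> 4 * exp (2 * \<sigma> * (ln y - c)) / y"
proof -
  have "(sech (\<sigma> * (ln y - c)))\<^sup>2 \<le> (2 * exp (\<sigma> * (ln y - c)))\<^sup>2"
    by (intro power_mono sech_le_exp less_imp_le[OF sech_pos])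
  also have "\<dots> = 4 * exp (2 * \<sigma> * (ln y - c))"
    by (simp add: power_mult_distrib exp_double[symmetric] mult.assoc)
  finally have "(sech (\<sigma> * (ln y - c)))\<^sup>2 \<le> 4 * exp (2 * \<sigma> * (ln y - c))" .
  moreover have "(y powr (- 1 / 2))\<^sup>2 = 1 / y" by (rule powr_minus_half_square[OF assms])
  ultimately have "(y powr (- 1 / 2))\<^sup>2 * (sech (\<sigma> * (ln y - c)))\<^sup>2 \<le> 1 / y * (4 * exp (2 * \<sigma> * (ln y - c)))"
    using assms by (intro mult_mono) auto
  then show ?thesis using assms by (simp add: packet_def power_mult_distrib)
qed

lemma even_sum_int_le:
  fixes t :: "int \<Rightarrow> real"
  assumes "\<And>x. 0 \<le> t x" "\<And>x. t (- 1 - x) = t x" "\<And>m. (\<Sum>k<m. t (int k)) \<le> B" "finite A"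
  shows "sum t A \<le> 2 * B"
proof -
  have s: "summable (\<lambda>k. t (int k))" by (rule summableI_nonneg_bounded[OF assms(1,3)])
  have "sum t A \<le> 2 * (\<Sum>k. t (int k))"
    by (rule finite_sum_le_has_sum[OF even_has_sum_int[OF assms(1,2) s] assms(4)]) (use assms in auto)
  moreover have "(\<Sum>k. t (int k)) \<le> B" by (rule suminf_le_const[OF s assms(3)])
  ultimately show ?thesis by simp
qed

lemma reflect_half: "real_of_int (- 1 - x) + 1 / 2 = - (real_of_int x + 1 / 2)"
  by simp

lemma packet_int_sum_le:
  assumes "0 < \<sigma>" "\<sigma> \<le> 1 / 2" "finite A"
  shows "(\<Sum>a\<in>A. (packet \<sigma> c (of_int a + 1 / 2))\<^sup>2) \<le> 8 / \<sigma>"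
proof -
  have half: "(packet \<sigma> c (1 / 2))\<^sup>2 \<le> 2"
  proof -
    have "packet \<sigma> c (1 / 2) \<le> (1 / 2) powr (- 1 / 2) * 1"
      unfolding packet_def by (simp add: mult_left_le sech_le_1)
    then have "(packet \<sigma> c (1 / 2))\<^sup>2 \<le> ((1 / 2) powr (- 1 / 2))\<^sup>2"
      using packet_nonneg by (intro power_mono) auto
    also have "\<dots> = 2" by (subst powr_minus_half_square) auto
    finally show ?thesis .
  qed
  have "(\<Sum>k<m. (packet \<sigma> c (of_int (int k) + 1 / 2))\<^sup>2) \<le> 4 / \<sigma>" for m
  proof -
    have "(\<Sum>k<m. (packet \<sigma> c (real k + 1 / 2))\<^sup>2) \<le> (\<Sum>k. (packet \<sigma> c (real k + 1 / 2))\<^sup>2)"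
      by (rule sum_le_suminf[OF packet_square_summable(1)[OF assms(1,2)]]) auto
    also have "\<dots> \<le> 2 + 2 / \<sigma>" using packet_square_summable(2)[OF assms(1,2), of c] half by linarith
    also have "\<dots> \<le> 4 / \<sigma>" using assms by (simp add: field_simps)
    finally show ?thesis by simp
  qed
  from even_sum_int_le[of "\<lambda>a. (packet \<sigma> c (of_int a + 1 / 2))\<^sup>2", OF _ _ this assms(3)]
  show ?thesis by (simp only: reflect_half packet_uminus) simp
qed

text \<open>For c \<ge> 0 the argument of tanh at the innermost site 1/2 is at most 0, so each
  half-line carries at least the increase of tanh from 0 to 1, divided by \<sigma>. This controls
  the normalizing factor of the states.\<close>

lemma packet_int_square_sum_ge:
  assumes "0 < \<sigma>" "\<sigma> \<le> 1 / 2" "0 \<le> c"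
  shows "2 / \<sigma> \<le> (\<Sum>\<^sub>\<infinity>a::int. (packet \<sigma> c (of_int a + 1 / 2))\<^sup>2)"
proof -
  have "1 / \<sigma> \<le> (\<Sum>k. (packet \<sigma> c (real k + 1 / 2))\<^sup>2)"
  proof (rule LIMSEQ_le_const2)
    have "filterlim (\<lambda>b. \<sigma> * (ln (real b + 1 / 2) - c)) at_top sequentially"
      using assms(1) by real_asymp
    from filterlim_compose[OF tanh_real_at_top this]
    show "(\<lambda>b. tanh (\<sigma> * (ln (real b + 1 / 2) - c)) / \<sigma>) \<longlonglongrightarrow> 1 / \<sigma>"
      using assms(1) by (intro tendsto_intros) auto
    show "\<exists>N. \<forall>b\<ge>N. tanh (\<sigma> * (ln (real b + 1 / 2) - c)) / \<sigma> \<le> (\<Sum>k. (packet \<sigma> c (real k + 1 / 2))\<^sup>2)"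
    proof (intro exI allI impI)
      fix b :: nat
      have "\<sigma> * (ln (real 0 + 1 / 2) - c) \<le> 0"
      proof (rule mult_nonneg_nonpos)
        have "ln (real 0 + 1 / 2) \<le> 0" by simp
        then show "ln (real 0 + 1 / 2) - c \<le> 0" using assms(3) by linarith
      qed (use assms(1) in simp)
      then have "tanh (\<sigma> * (ln (real 0 + 1 / 2) - c)) / \<sigma> \<le> 0"
        using assms(1) by (simp add: divide_nonpos_pos)
      then have "tanh (\<sigma> * (ln (real b + 1 / 2) - c)) / \<sigma>
          \<le> tanh (\<sigma> * (ln (real b + 1 / 2) - c)) / \<sigma> - tanh (\<sigma> * (ln (real 0 + 1 / 2) - c)) / \<sigma>" by simp
      also have "\<dots> \<le> (\<Sum>k = 0..<b. (packet \<sigma> c (real k + 1 / 2))\<^sup>2)"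
        by (rule packet_sum_bounds(2)) (use assms in auto)
      also have "\<dots> \<le> (\<Sum>k. (packet \<sigma> c (real k + 1 / 2))\<^sup>2)"
        by (rule sum_le_suminf[OF packet_square_summable(1)[OF assms(1,2)]]) auto
      finally show "tanh (\<sigma> * (ln (real b + 1 / 2) - c)) / \<sigma> \<le> (\<Sum>k. (packet \<sigma> c (real k + 1 / 2))\<^sup>2)" .
    qed
  qed
  then show ?thesis using infsumI[OF packet_int_square_has_sum[OF assms(1,2), of c]] by simp
qed

text \<open>In the squared step error, the Taylor part contributes \<sigma>^4 times a mass of order
  1 / \<sigma>. The discretization part concentrates near the lattice scale, where exp (- 2 \<sigma>
  c) measures how little of the packet is present; \<sigma> \<le> 1/16 makes the exponent 2 \<sigma>
  - 1/4 negative, so that the summable power y^(-5/4) can be split off.\<close>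

lemma packet_weighted_sum:
  obtains Z where "0 \<le> Z"
    "\<And>\<sigma> c A. 0 < \<sigma> \<Longrightarrow> \<sigma> \<le> 1 / 16 \<Longrightarrow> finite A \<Longrightarrow>
      (\<Sum>a\<in>A. ((\<sigma>\<^sup>2 + \<bar>of_int a + 1 / 2\<bar> powr (- 1 / 4)) * packet \<sigma> c (of_int a + 1 / 2))\<^sup>2)
        \<le> 16 * \<sigma> ^ 3 + Z * exp (- 2 * \<sigma> * c)"
proof -
  define Z where "Z = (\<Sum>k. (real k + 1 / 2) powr (- 5 / 4))"
  have Z_summable: "summable (\<lambda>k. (real k + 1 / 2) powr (- 5 / 4))"
  proof (rule summable_comparison_test_ev)
    show "summable (\<lambda>k. real k powr (- 5 / 4))" by (simp add: summable_real_powr_iff)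
    show "\<forall>\<^sub>F k in sequentially. norm ((real k + 1 / 2) powr (- 5 / 4)) \<le> real k powr (- 5 / 4)"
      using eventually_gt_at_top[of 0] by eventually_elim (auto intro!: powr_mono2')
  qed
  have Z0: "0 \<le> Z" unfolding Z_def by (intro suminf_nonneg Z_summable) simp
  show thesis
  proof
    show "0 \<le> 32 * Z" using Z0 by simp
  next
    fix \<sigma> c :: real and A :: "int set"
    assume \<sigma>: "0 < \<sigma>" "\<sigma> \<le> 1 / 16" and A: "finite A"
    define y where "y = (\<lambda>a. real_of_int a + 1 / 2)"
    define t where "t = (\<lambda>a. \<bar>y a\<bar> powr (- 1 / 2) * (packet \<sigma> c (y a))\<^sup>2)"
    have term_le: "t (int k) \<le> 8 * exp (- 2 * \<sigma> * c) * (real k + 1 / 2) powr (- 5 / 4)" for k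
    proof -
      define z where "z = real k + 1 / 2"
      have z: "1 / 2 \<le> z" "0 < z" by (auto simp: z_def)
      have "(packet \<sigma> c z)\<^sup>2 \<le> 4 * exp (2 * \<sigma> * (ln z - c)) / z" by (rule packet_square_le[OF z(2)])
      also have "exp (2 * \<sigma> * (ln z - c)) = exp (- 2 * \<sigma> * c) * z powr (2 * \<sigma>)"
        using z by (simp add: powr_def flip: exp_add) (simp add: algebra_simps)
      also have "4 * (exp (- 2 * \<sigma> * c) * z powr (2 * \<sigma>)) / z
          = 4 * exp (- 2 * \<sigma> * c) * z powr (2 * \<sigma> - 1)"
        using z by (simp add: powr_diff)
      finally have 1: "(packet \<sigma> c z)\<^sup>2 \<le> 4 * exp (- 2 * \<sigma> * c) * z powr (2 * \<sigma> - 1)" .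
      have 2: "z powr (2 * \<sigma> - 1 / 4) \<le> 2"
      proof -
        have "z powr (2 * \<sigma> - 1 / 4) \<le> (1 / 2) powr (2 * \<sigma> - 1 / 4)"
          using z \<sigma> by (intro powr_mono2') auto
        also have "\<dots> = 2 powr (1 / 4 - 2 * \<sigma>)" by (simp add: powr_divide powr_diff)
        also have "\<dots> \<le> 2 powr 1" using \<sigma> by (intro powr_mono) auto
        finally show ?thesis by simp
      qed
      have "z powr (- 1 / 2) * (packet \<sigma> c z)\<^sup>2
          \<le> z powr (- 1 / 2) * (4 * exp (- 2 * \<sigma> * c) * z powr (2 * \<sigma> - 1))"
        using 1 by (intro mult_left_mono) auto
      also have "\<dots> = 4 * exp (- 2 * \<sigma> * c) * (z powr (- 1 / 2) * z powr (2 * \<sigma> - 1))" by simp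
      also have "z powr (- 1 / 2) * z powr (2 * \<sigma> - 1) = z powr (2 * \<sigma> - 1 / 4) * z powr (- 5 / 4)"
        unfolding powr_add[symmetric] by (simp add: algebra_simps)
      also have "4 * exp (- 2 * \<sigma> * c) * (z powr (2 * \<sigma> - 1 / 4) * z powr (- 5 / 4))
          \<le> 4 * exp (- 2 * \<sigma> * c) * (2 * z powr (- 5 / 4))"
        using 2 by (intro mult_left_mono mult_right_mono) auto
      finally show ?thesis using z by (simp add: t_def y_def z_def)
    qed
    have t_sum: "(\<Sum>k<m. t (int k)) \<le> 8 * exp (- 2 * \<sigma> * c) * Z" for m
    proof -
      have "(\<Sum>k<m. t (int k)) \<le> (\<Sum>k<m. 8 * exp (- 2 * \<sigma> * c) * (real k + 1 / 2) powr (- 5 / 4))"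
        by (intro sum_mono term_le)
      also have "\<dots> = 8 * exp (- 2 * \<sigma> * c) * (\<Sum>k<m. (real k + 1 / 2) powr (- 5 / 4))"
        by (simp add: sum_distrib_left)
      also have "\<dots> \<le> 8 * exp (- 2 * \<sigma> * c) * Z"
        unfolding Z_def by (intro mult_left_mono sum_le_suminf Z_summable) auto
      finally show ?thesis .
    qed
    have y_reflect: "y (- 1 - x) = - y x" for x by (simp add: y_def)
    have tA: "sum t A \<le> 2 * (8 * exp (- 2 * \<sigma> * c) * Z)"
      by (rule even_sum_int_le[OF _ _ t_sum A]) (auto simp: t_def y_reflect)
    have pA: "(\<Sum>a\<in>A. (packet \<sigma> c (y a))\<^sup>2) \<le> 8 / \<sigma>"
      unfolding y_def by (rule packet_int_sum_le) (use \<sigma> A in auto)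
    have "((\<sigma>\<^sup>2 + \<bar>y a\<bar> powr (- 1 / 4)) * packet \<sigma> c (y a))\<^sup>2
        \<le> 2 * \<sigma> ^ 4 * (packet \<sigma> c (y a))\<^sup>2 + 2 * t a" for a
    proof -
      have "(u + v)\<^sup>2 \<le> 2 * u\<^sup>2 + 2 * v\<^sup>2" for u v :: real
        using zero_le_power2[of "u - v"] by (simp add: power2_eq_square algebra_simps)
      from mult_right_mono[OF this[of "\<sigma>\<^sup>2" "\<bar>y a\<bar> powr (- 1 / 4)"] zero_le_power2[of "packet \<sigma> c (y a)"]]
      have "((\<sigma>\<^sup>2 + \<bar>y a\<bar> powr (- 1 / 4)) * packet \<sigma> c (y a))\<^sup>2
          \<le> (2 * (\<sigma>\<^sup>2)\<^sup>2 + 2 * (\<bar>y a\<bar> powr (- 1 / 4))\<^sup>2) * (packet \<sigma> c (y a))\<^sup>2"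
        by (simp add: power_mult_distrib)
      also have "(\<bar>y a\<bar> powr (- 1 / 4))\<^sup>2 = \<bar>y a\<bar> powr (- 1 / 2)"
        unfolding power2_eq_square powr_add[symmetric] by simp
      finally show ?thesis by (simp add: t_def algebra_simps flip: power_mult)
    qed
    then have "(\<Sum>a\<in>A. ((\<sigma>\<^sup>2 + \<bar>y a\<bar> powr (- 1 / 4)) * packet \<sigma> c (y a))\<^sup>2)
        \<le> (\<Sum>a\<in>A. 2 * \<sigma> ^ 4 * (packet \<sigma> c (y a))\<^sup>2 + 2 * t a)" by (rule sum_mono)
    also have "\<dots> = 2 * \<sigma> ^ 4 * (\<Sum>a\<in>A. (packet \<sigma> c (y a))\<^sup>2) + 2 * sum t A"
      by (simp add: sum.distrib sum_distrib_left)
    also have "\<dots> \<le> 2 * \<sigma> ^ 4 * (8 / \<sigma>) + 2 * (2 * (8 * exp (- 2 * \<sigma> * c) * Z))"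
      using pA tA by (intro add_mono mult_left_mono) auto
    also have "\<dots> = 16 * \<sigma> ^ 3 + 32 * Z * exp (- 2 * \<sigma> * c)"
      using \<sigma> by (simp add: eval_nat_numeral)
    finally show "(\<Sum>a\<in>A. ((\<sigma>\<^sup>2 + \<bar>of_int a + 1 / 2\<bar> powr (- 1 / 4)) * packet \<sigma> c (of_int a + 1 / 2))\<^sup>2)
        \<le> 16 * \<sigma> ^ 3 + 32 * Z * exp (- 2 * \<sigma> * c)" unfolding y_def .
  qed
qed

lemma packet_tail:
  assumes \<sigma>: "0 < \<sigma>" "\<sigma> \<le> 1 / 2" and A: "finite A" "\<And>a. a \<in> A \<Longrightarrow> real K + 1 / 2 < \<bar>of_int a + 1 / 2\<bar>"
  shows "(\<Sum>a\<in>A. (packet \<sigma> c (of_int a + 1 / 2))\<^sup>2) \<le> 4 / \<sigma> * exp (2 * \<sigma> * (c - ln (real K + 1 / 2)))"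
proof -
  define y where "y = (\<lambda>a. real_of_int a + 1 / 2)"
  define F where "F = (\<lambda>y. tanh (\<sigma> * (ln y - c)) / \<sigma>)"
  define t where "t = (\<lambda>a. if real K + 1 / 2 < \<bar>y a\<bar> then (packet \<sigma> c (y a))\<^sup>2 else 0)"
  have "(\<Sum>k<m. t (int k)) \<le> 2 / \<sigma> * exp (2 * \<sigma> * (c - ln (real K + 1 / 2)))" for m
  proof -
    have "(\<Sum>k<m. t (int k)) = (\<Sum>k\<in>{..<m} \<inter> {k. K < k}. (packet \<sigma> c (real k + 1 / 2))\<^sup>2)"
      unfolding sum.inter_restrict[OF finite_lessThan]
      by (rule sum.cong) (auto simp: t_def y_def)
    also have "\<dots> \<le> (\<Sum>k = Suc K..K + m. (packet \<sigma> c (real k + 1 / 2))\<^sup>2)"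
      by (rule sum_mono2) auto
    also have "\<dots> \<le> F (real (K + m) + 1 / 2) - F (real K + 1 / 2)"
      unfolding F_def by (rule packet_sum_bounds(1)[OF \<sigma>]) simp
    also have "\<dots> \<le> 1 / \<sigma> - F (real K + 1 / 2)"
      using \<sigma> tanh_real_bounds unfolding F_def by (intro diff_right_mono divide_right_mono) (auto simp: less_imp_le)
    also have "\<dots> = (1 - tanh (\<sigma> * (ln (real K + 1 / 2) - c))) / \<sigma>"
      by (simp add: F_def diff_divide_distrib)
    also have "\<dots> \<le> 2 * exp (- 2 * (\<sigma> * (ln (real K + 1 / 2) - c))) / \<sigma>"
      using \<sigma> one_minus_tanh_le by (intro divide_right_mono) auto
    also have "\<dots> = 2 / \<sigma> * exp (2 * \<sigma> * (c - ln (real K + 1 / 2)))"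
      by (simp add: algebra_simps)
    finally show ?thesis .
  qed
  note bound = this
  have "y (- 1 - x) = - y x" for x by (simp add: y_def)
  then have "sum t A \<le> 2 * (2 / \<sigma> * exp (2 * \<sigma> * (c - ln (real K + 1 / 2))))"
    by (intro even_sum_int_le[OF _ _ bound A(1)]) (auto simp: t_def)
  moreover have "sum t A = (\<Sum>a\<in>A. (packet \<sigma> c (of_int a + 1 / 2))\<^sup>2)"
    by (rule sum.cong) (use A in \<open>auto simp: t_def y_def\<close>)
  ultimately show ?thesis by simp
qed

text \<open>The comparison with an integral omits the innermost site 1/2, which gives the first
  summand; the second is the lower tail of tanh.\<close>

lemma packet_head:
  assumes \<sigma>: "0 < \<sigma>" "\<sigma> \<le> 1 / 2" and A: "finite A" "\<And>a. a \<in> A \<Longrightarrow> \<bar>of_int a + 1 / 2\<bar> \<le> real K + 1 / 2"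
  shows "(\<Sum>a\<in>A. (packet \<sigma> c (of_int a + 1 / 2))\<^sup>2)
    \<le> 16 * exp (- 2 * \<sigma> * c) + 4 / \<sigma> * exp (2 * \<sigma> * (ln (real K + 1 / 2) - c))"
proof -
  define y where "y = (\<lambda>a. real_of_int a + 1 / 2)"
  define F where "F = (\<lambda>y. tanh (\<sigma> * (ln y - c)) / \<sigma>)"
  define t where "t = (\<lambda>a. if \<bar>y a\<bar> \<le> real K + 1 / 2 then (packet \<sigma> c (y a))\<^sup>2 else 0)"
  have half: "(packet \<sigma> c (1 / 2))\<^sup>2 \<le> 8 * exp (- 2 * \<sigma> * c)"
  proof -
    have "(packet \<sigma> c (1 / 2))\<^sup>2 \<le> 4 * exp (2 * \<sigma> * (ln (1 / 2) - c)) / (1 / 2)"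
      by (rule packet_square_le) simp
    moreover have "exp (2 * \<sigma> * (ln (1 / 2) - c)) \<le> exp (- 2 * \<sigma> * c)"
      using \<sigma> by (simp add: ln_div algebra_simps)
    moreover have "u \<le> 4 * v / (1 / 2) \<Longrightarrow> v \<le> w \<Longrightarrow> u \<le> 8 * w" for u v w :: real by simp
    ultimately show ?thesis by blast
  qed
  have "(\<Sum>k<m. t (int k)) \<le> 8 * exp (- 2 * \<sigma> * c) + 2 / \<sigma> * exp (2 * \<sigma> * (ln (real K + 1 / 2) - c))" for m
  proof -
    have "(\<Sum>k<m. t (int k)) = (\<Sum>k\<in>{..<m} \<inter> {k. k \<le> K}. (packet \<sigma> c (real k + 1 / 2))\<^sup>2)"
      unfolding sum.inter_restrict[OF finite_lessThan]
      by (rule sum.cong) (auto simp: t_def y_def)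
    also have "\<dots> \<le> (\<Sum>k = 0..K. (packet \<sigma> c (real k + 1 / 2))\<^sup>2)"
      by (rule sum_mono2) auto
    also have "\<dots> = (packet \<sigma> c (1 / 2))\<^sup>2 + (\<Sum>k = Suc 0..K. (packet \<sigma> c (real k + 1 / 2))\<^sup>2)"
      by (subst sum.atLeast_Suc_atMost) auto
    also have "(\<Sum>k = Suc 0..K. (packet \<sigma> c (real k + 1 / 2))\<^sup>2) \<le> F (real K + 1 / 2) - F (real 0 + 1 / 2)"
      unfolding F_def by (rule packet_sum_bounds(1)[OF \<sigma>]) simp
    also have "\<dots> \<le> F (real K + 1 / 2) - (- 1 / \<sigma>)"
      using \<sigma> tanh_real_bounds unfolding F_def by (intro diff_left_mono divide_right_mono) (auto simp: less_imp_le)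
    also have "\<dots> = (1 - tanh (- (\<sigma> * (ln (real K + 1 / 2) - c)))) / \<sigma>"
      by (simp add: F_def add_divide_distrib)
    also have "\<dots> \<le> 2 * exp (- 2 * (- (\<sigma> * (ln (real K + 1 / 2) - c)))) / \<sigma>"
      using \<sigma> by (intro divide_right_mono one_minus_tanh_le) auto
    also have "\<dots> = 2 / \<sigma> * exp (2 * \<sigma> * (ln (real K + 1 / 2) - c))" by simp
    finally show ?thesis using half by simp
  qed
  note bound = this
  have "y (- 1 - x) = - y x" for x by (simp add: y_def)
  then have "sum t A \<le> 2 * (8 * exp (- 2 * \<sigma> * c) + 2 / \<sigma> * exp (2 * \<sigma> * (ln (real K + 1 / 2) - c)))"
    by (intro even_sum_int_le[OF _ _ bound A(1)]) (auto simp: t_def)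
  moreover have "sum t A = (\<Sum>a\<in>A. (packet \<sigma> c (of_int a + 1 / 2))\<^sup>2)"
    by (rule sum.cong) (use A in \<open>auto simp: t_def y_def\<close>)
  ultimately show ?thesis by simp
qed

text \<open>The starting state cannot depend on the answer, so replacing it by the packet centered
  at \<open>j\<close> has to be cheap. Within 2n of the origin both packets are bounded separately
  by their heads up to 3n. Beyond, the translation is a relative change of at most 2n / |y|, whose
  square makes the sum converge without a tail bound for the packet.\<close>

lemma packet_translate:
  fixes n j :: nat
  assumes \<sigma>: "0 < \<sigma>" "\<sigma> \<le> 1 / 2" and j: "j < n" and A: "finite A"
  shows "(\<Sum>a\<in>A. (packet \<sigma> c (of_int (a - int j) + 1 / 2) - packet \<sigma> c (of_int a + 1 / 2))\<^sup>2)
    \<le> 64 / \<sigma> * exp (2 * \<sigma> * (ln (3 * real n) - c))"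
proof -
  define y where "y = (\<lambda>a. real_of_int a + 1 / 2)"
  define E where "E = exp (2 * \<sigma> * (ln (3 * real n) - c))"
  define d where "d = (\<lambda>a. packet \<sigma> c (y (a - int j)) - packet \<sigma> c (y a))"
  define near far where "near = {a \<in> A. \<bar>y a\<bar> \<le> 2 * real n}" and "far = {a \<in> A. 2 * real n < \<bar>y a\<bar>}"
  have n: "1 \<le> n" using j by simp
  have E: "0 < E" by (simp add: E_def)
  have y_int: "\<bar>y a\<bar> \<le> real K + 1 / 2" if "\<bar>y a\<bar> < real K + 1" for a and K :: nat
  proof -
    have "of_int a < real K + 1 / 2" "- (real K + 3 / 2) < of_int a" using that by (auto simp: y_def abs_less_iff)
    then have "real_of_int a < real_of_int (int K + 1)" "real_of_int (- (int K + 2)) < real_of_int a" by auto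
    then have "a < int K + 1" "- (int K + 2) < a" by (simp_all only: of_int_less_iff)
    then have "a \<le> int K" "- int K - 1 \<le> a" by auto
    then have "real_of_int a \<le> real_of_int (int K)" "real_of_int (- int K - 1) \<le> real_of_int a"
      by (simp_all only: of_int_le_iff)
    then show ?thesis by (auto simp: y_def abs_le_iff)
  qed
  have head: "(\<Sum>a\<in>B. (packet \<sigma> c (y a))\<^sup>2) \<le> 12 / \<sigma> * E"
    if B: "finite B" "\<And>a. a \<in> B \<Longrightarrow> \<bar>y a\<bar> < 3 * real n" for B
  proof -
    define K where "K = 3 * n - 1"
    have K: "real K + 1 = 3 * real n" using n by (simp add: K_def of_nat_diff)
    have "\<And>a. a \<in> B \<Longrightarrow> \<bar>of_int a + 1 / 2\<bar> \<le> real K + 1 / 2"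
      using y_int[of _ K] B K by (simp add: y_def)
    from packet_head[OF \<sigma> B(1) this, of c]
    have "(\<Sum>a\<in>B. (packet \<sigma> c (y a))\<^sup>2)
        \<le> 16 * exp (- 2 * \<sigma> * c) + 4 / \<sigma> * exp (2 * \<sigma> * (ln (real K + 1 / 2) - c))"
      by (simp add: y_def)
    also have "exp (- 2 * \<sigma> * c) \<le> E"
    proof -
      have "0 \<le> 2 * \<sigma> * ln (3 * real n)" using \<sigma> n by simp
      then show ?thesis by (simp add: E_def algebra_simps)
    qed
    also have "exp (2 * \<sigma> * (ln (real K + 1 / 2) - c)) \<le> E"
    proof -
      have "ln (real K + 1 / 2) \<le> ln (3 * real n)" using K by (subst ln_le_cancel_iff) (use n in auto)
      then show ?thesis using \<sigma> by (simp add: E_def)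
    qed
    also have "16 * E + 4 / \<sigma> * E \<le> 12 / \<sigma> * E"
    proof -
      have "16 \<le> 8 / \<sigma>" using \<sigma> by (simp add: field_simps)
      from mult_right_mono[OF this, of E] E have "16 * E \<le> 8 / \<sigma> * E" by simp
      moreover have "8 / \<sigma> * E + 4 / \<sigma> * E = 12 / \<sigma> * E" using \<sigma> by (simp add: field_simps)
      ultimately show ?thesis by linarith
    qed
    finally show ?thesis using \<sigma> by (simp add: divide_right_mono)
  qed
  have "(\<Sum>a\<in>near. (d a)\<^sup>2) \<le> (\<Sum>a\<in>near. (packet \<sigma> c (y (a - int j)))\<^sup>2 + (packet \<sigma> c (y a))\<^sup>2)"
  proof (rule sum_mono)
    fix a
    have "0 \<le> packet \<sigma> c (y (a - int j)) * packet \<sigma> c (y a)" by (simp add: packet_nonneg)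
    then show "(d a)\<^sup>2 \<le> (packet \<sigma> c (y (a - int j)))\<^sup>2 + (packet \<sigma> c (y a))\<^sup>2"
      unfolding d_def power2_diff by linarith
  qed
  also have "\<dots> = (\<Sum>a\<in>(\<lambda>a. a - int j) ` near. (packet \<sigma> c (y a))\<^sup>2) + (\<Sum>a\<in>near. (packet \<sigma> c (y a))\<^sup>2)"
    by (subst sum.reindex) (auto simp: inj_on_def sum.distrib)
  also have "(\<Sum>a\<in>near. (packet \<sigma> c (y a))\<^sup>2) \<le> 12 / \<sigma> * E"
    by (rule head) (use A n in \<open>auto simp: near_def\<close>)
  also have "(\<Sum>a\<in>(\<lambda>a. a - int j) ` near. (packet \<sigma> c (y a))\<^sup>2) \<le> 12 / \<sigma> * E"
  proof (rule head)
    fix b assume "b \<in> (\<lambda>a. a - int j) ` near"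
    then obtain a where a: "\<bar>y a\<bar> \<le> 2 * real n" "b = a - int j" by (auto simp: near_def)
    have "real j + 1 \<le> real n" using j by simp
    moreover have "y b = y a - real j" using a(2) by (simp add: y_def)
    ultimately show "\<bar>y b\<bar> < 3 * real n" using a(1) by linarith
  qed (use A in \<open>auto simp: near_def\<close>)
  finally have near_le: "(\<Sum>a\<in>near. (d a)\<^sup>2) \<le> 24 / \<sigma> * E" using \<sigma> by (simp add: add_divide_distrib)

  have far_term: "(d a)\<^sup>2 \<le> 8 * real n * E / (y a)\<^sup>2" if a: "2 * real n < \<bar>y a\<bar>" for a
  proof -
    define p q where "p = \<bar>y a\<bar>" and "q = \<bar>y (a - int j)\<bar>"
    have jn: "real j \<le> real n" using j by simp
    have yj: "y (a - int j) = y a - real j" by (simp add: y_def)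
    have p: "2 * real n < p" "0 < p" using a n by (auto simp: p_def)
    have q: "q = p + real j \<or> q = p - real j" using a jn unfolding p_def q_def yj by arith
    then have q0: "0 < q" "p / 2 \<le> q" using p jn by auto
    have "exp \<bar>ln (q / p)\<bar> - 1 \<le> 2 * real n / p"
      using q
    proof
      assume "q = p + real j"
      then have "1 \<le> q / p" using p by simp
      then have "exp \<bar>ln (q / p)\<bar> = q / p" using q0 p by simp
      then have "exp \<bar>ln (q / p)\<bar> - 1 = real j / p" using \<open>q = p + real j\<close> p by (simp add: add_divide_distrib)
      also have "\<dots> \<le> 2 * real n / p" using jn p by (intro divide_right_mono) auto
      finally show ?thesis .
    next
      assume qj: "q = p - real j"
      then have "\<bar>ln (q / p)\<bar> = ln (p / q)" using q0 p by (simp add: ln_div)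
      moreover have "0 < p / q" using p q0 by simp
      ultimately have "exp \<bar>ln (q / p)\<bar> = p / q" by (simp only: exp_ln)
      moreover have "p = q + real j" using qj by simp
      then have "p / q - 1 = real j / q" using q0 by (simp add: add_divide_distrib)
      ultimately have "exp \<bar>ln (q / p)\<bar> - 1 = real j / q" by (simp only:)
      also have "\<dots> \<le> real n / (p / 2)" using jn q0 p by (intro frac_le) auto
      finally show ?thesis by (simp add: mult.commute)
    qed
    then have "(exp \<bar>ln (q / p)\<bar> - 1) * packet \<sigma> c p \<le> 2 * real n / p * packet \<sigma> c p"
      by (intro mult_right_mono packet_nonneg)
    with packet_perturb[OF p(2) q0(1) less_imp_le[OF \<sigma>(1)] \<sigma>(2), of c]
    have "\<bar>packet \<sigma> c q - packet \<sigma> c p\<bar> \<le> 2 * real n / p * packet \<sigma> c p" by linarith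
    then have "\<bar>d a\<bar> \<le> 2 * real n / p * packet \<sigma> c p" by (simp add: d_def p_def q_def packet_abs)
    then have "\<bar>d a\<bar>\<^sup>2 \<le> (2 * real n / p * packet \<sigma> c p)\<^sup>2" by (intro power_mono) auto
    then have "(d a)\<^sup>2 \<le> (2 * real n / p)\<^sup>2 * (packet \<sigma> c p)\<^sup>2"
      unfolding power2_abs power_mult_distrib[of "2 * real n / p" "packet \<sigma> c p"] .
    also have "\<dots> \<le> (2 * real n / p)\<^sup>2 * (4 * exp (2 * \<sigma> * (ln p - c)) / p)"
      by (intro mult_left_mono packet_square_le p) auto
    \<comment> \<open>For \<sigma> \<le> 1/2 the function p^(2 \<sigma> - 1) is antitone, so its
      value at 2n dominates.\<close>
    also have "exp (2 * \<sigma> * (ln p - c)) / p \<le> E / (2 * real n)"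
    proof -
      have N: "0 < 2 * real n" using n by simp
      have "ln (2 * real n) \<le> ln p" using p N by (subst ln_le_cancel_iff) auto
      then have "(1 - 2 * \<sigma>) * ln (2 * real n) \<le> (1 - 2 * \<sigma>) * ln p"
        using \<sigma> by (intro mult_left_mono) auto
      moreover have "2 * \<sigma> * ln (2 * real n) \<le> 2 * \<sigma> * ln (3 * real n)"
        using \<sigma> n by (intro mult_left_mono) auto
      ultimately have "2 * \<sigma> * (ln p - c) - ln p \<le> 2 * \<sigma> * (ln (3 * real n) - c) - ln (2 * real n)"
        by (simp add: algebra_simps)
      then have "exp (2 * \<sigma> * (ln p - c) - ln p) \<le> exp (2 * \<sigma> * (ln (3 * real n) - c) - ln (2 * real n))" by simp
      then show ?thesis unfolding exp_diff E_def using p N by simp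
    qed
    then have "(2 * real n / p)\<^sup>2 * (4 * exp (2 * \<sigma> * (ln p - c)) / p) \<le> (2 * real n / p)\<^sup>2 * (4 * (E / (2 * real n)))"
      by (intro mult_left_mono) auto
    also have "\<dots> = 8 * real n * E / (y a)\<^sup>2"
      using n by (simp add: power_divide power_mult_distrib p_def power2_eq_square)
    finally show ?thesis .
  qed
  define t where "t = (\<lambda>a. if 2 * real n < \<bar>y a\<bar> then 8 * real n * E / (y a)\<^sup>2 else 0)"
  have tele: "(\<Sum>k = 2 * n..<m. 1 / (real k + 1 / 2)\<^sup>2) \<le> 1 / (2 * real n) - 1 / real m" if "2 * n \<le> m" for m
    using that
  proof (induction m rule: dec_induct)
    case (step m)
    have m: "0 < real m" using step n by simp
    have "1 / (real m + 1 / 2)\<^sup>2 \<le> 1 / (real m * (real m + 1))"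
      using m by (intro divide_left_mono) (auto simp: power2_eq_square algebra_simps add_pos_pos)
    also have "\<dots> = 1 / real m - 1 / real (Suc m)" using m by (simp add: field_simps)
    finally show ?case using step by simp
  qed simp
  have t_sum: "(\<Sum>k<m. t (int k)) \<le> 4 * E" for m
  proof -
    have "(\<Sum>k<m. t (int k)) \<le> (\<Sum>k<m + 2 * n. t (int k))"
      using E by (intro sum_mono2) (auto simp: t_def)
    also have "\<dots> = (\<Sum>k = 2 * n..<m + 2 * n. 8 * real n * E * (1 / (real k + 1 / 2)\<^sup>2))"
    proof (rule sum.mono_neutral_cong_right)
      show "\<forall>k\<in>{..<m + 2 * n} - {2 * n..<m + 2 * n}. t (int k) = 0"
      proof
        fix k assume "k \<in> {..<m + 2 * n} - {2 * n..<m + 2 * n}"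
        then have "Suc k \<le> 2 * n" by auto
        then have "real (Suc k) \<le> real (2 * n)" by (simp only: of_nat_le_iff)
        then show "t (int k) = 0" by (simp add: t_def y_def)
      qed
      show "t (int k) = 8 * real n * E * (1 / (real k + 1 / 2)\<^sup>2)" if "k \<in> {2 * n..<m + 2 * n}" for k
      proof -
        have "real (2 * n) \<le> real k" using that by (simp only: atLeastLessThan_iff of_nat_le_iff)
        then show ?thesis by (simp add: t_def y_def)
      qed
    qed auto
    also have "\<dots> = 8 * real n * E * (\<Sum>k = 2 * n..<m + 2 * n. 1 / (real k + 1 / 2)\<^sup>2)"
      by (simp add: sum_distrib_left)
    also have "\<dots> \<le> 8 * real n * E * (1 / (2 * real n))"
    proof (rule mult_left_mono)
      have "0 \<le> 1 / real (m + 2 * n)" by simp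
      then show "(\<Sum>k = 2 * n..<m + 2 * n. 1 / (real k + 1 / 2)\<^sup>2) \<le> 1 / (2 * real n)"
        using tele[of "m + 2 * n"] by linarith
    qed (use E in auto)
    also have "\<dots> = 4 * E" using n by simp
    finally show ?thesis .
  qed
  have "y (- 1 - x) = - y x" for x by (simp add: y_def)
  then have "sum t far \<le> 2 * (4 * E)"
    using A E by (intro even_sum_int_le[OF _ _ t_sum]) (auto simp: t_def far_def)
  moreover have "(\<Sum>a\<in>far. (d a)\<^sup>2) \<le> sum t far"
    by (rule sum_mono) (use far_term in \<open>auto simp: t_def far_def\<close>)
  moreover have "8 * E \<le> 4 / \<sigma> * E"
    using \<sigma> E by (intro mult_right_mono) (auto simp: field_simps)
  ultimately have far_le: "(\<Sum>a\<in>far. (d a)\<^sup>2) \<le> 4 / \<sigma> * E" by linarith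
  have "A = near \<union> far" "near \<inter> far = {}" by (auto simp: near_def far_def)
  then have "(\<Sum>a\<in>A. (d a)\<^sup>2) = (\<Sum>a\<in>near. (d a)\<^sup>2) + (\<Sum>a\<in>far. (d a)\<^sup>2)"
    using A by (metis finite_Un sum.union_disjoint)
  also have "\<dots> \<le> 28 / \<sigma> * E" using near_le far_le by (simp add: add_divide_distrib[symmetric] distrib_right[symmetric])
  also have "\<dots> \<le> 64 / \<sigma> * E" using \<sigma> E by (intro mult_right_mono divide_right_mono) auto
  finally show ?thesis unfolding d_def y_def E_def .
qed

section \<open>Orthogonal kernels on the state space\<close>

definition square_summable :: "state \<Rightarrow> bool" where
  "square_summable \<psi> \<longleftrightarrow> (\<lambda>p. (cmod (\<psi> p))\<^sup>2) summable_on UNIV"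

lemma square_summable_norm:
  assumes "square_summable \<psi>"
  shows "((\<lambda>p. (cmod (\<psi> p))\<^sup>2) has_sum (state_norm \<psi>)\<^sup>2) UNIV"
proof -
  have "0 \<le> (\<Sum>\<^sub>\<infinity>p. (cmod (\<psi> p))\<^sup>2)" by (rule infsum_nonneg) simp
  then show ?thesis
    using has_sum_infsum[of "\<lambda>p. (cmod (\<psi> p))\<^sup>2" UNIV] assms
    by (simp add: square_summable_def state_norm_def)
qed

lemma state_norm_nonneg: "0 \<le> state_norm \<psi>"
  unfolding state_norm_def by (intro real_sqrt_ge_zero infsum_nonneg) simp

lemma square_summableI_finite:
  assumes "\<And>A. finite A \<Longrightarrow> (\<Sum>p\<in>A. (cmod (\<psi> p))\<^sup>2) \<le> B\<^sup>2" "0 \<le> B"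
  shows "square_summable \<psi>" and "state_norm \<psi> \<le> B"
proof -
  show s: "square_summable \<psi>"
    unfolding square_summable_def
    by (rule nonneg_bdd_above_summable_on) (use assms in \<open>auto intro!: bdd_aboveI[of _ "B\<^sup>2"]\<close>)
  have "(\<Sum>\<^sub>\<infinity>p. (cmod (\<psi> p))\<^sup>2) \<le> B\<^sup>2"
    by (rule infsum_le_finite_sums) (use s assms in \<open>auto simp: square_summable_def\<close>)
  then show "state_norm \<psi> \<le> B"
    unfolding state_norm_def using assms(2) real_le_lsqrt by simp
qed

lemma square_summable_finite_le:
  assumes "square_summable \<psi>" "finite A"
  shows "(\<Sum>p\<in>A. (cmod (\<psi> p))\<^sup>2) \<le> (state_norm \<psi>)\<^sup>2"
  by (rule finite_sum_le_has_sum[OF square_summable_norm[OF assms(1)] assms(2)]) auto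

lemma square_summable_dominated:
  assumes "square_summable \<phi>" "\<And>p. cmod (\<psi> p) \<le> cmod (\<phi> p)"
  shows "square_summable \<psi>" and "state_norm \<psi> \<le> state_norm \<phi>"
proof -
  have "(\<Sum>p\<in>A. (cmod (\<psi> p))\<^sup>2) \<le> (state_norm \<phi>)\<^sup>2" if "finite A" for A
    using square_summable_finite_le[OF assms(1) that]
      sum_mono[of A "\<lambda>p. (cmod (\<psi> p))\<^sup>2" "\<lambda>p. (cmod (\<phi> p))\<^sup>2"] assms(2)
    by (force intro: power_mono order_trans)
  from square_summableI_finite[of \<psi>, OF this state_norm_nonneg]
  show "square_summable \<psi>" "state_norm \<psi> \<le> state_norm \<phi>" by auto
qed

lemma state_norm_scale: "state_norm (\<lambda>p. c * \<psi> p) = cmod c * state_norm \<psi>"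
  unfolding state_norm_def
  by (simp add: norm_mult power_mult_distrib infsum_cmult_right' real_sqrt_mult)

lemma square_summable_scale: "square_summable \<psi> \<Longrightarrow> square_summable (\<lambda>p. c * \<psi> p)"
  unfolding square_summable_def
  by (simp add: norm_mult power_mult_distrib summable_on_cmult_right)

lemma state_norm_triangle:
  assumes "square_summable \<phi>" "square_summable \<psi>"
  shows "square_summable (\<lambda>p. \<phi> p + \<psi> p)"
    and "state_norm (\<lambda>p. \<phi> p + \<psi> p) \<le> state_norm \<phi> + state_norm \<psi>"
proof -
  have "(\<Sum>p\<in>A. (cmod (\<phi> p + \<psi> p))\<^sup>2) \<le> (state_norm \<phi> + state_norm \<psi>)\<^sup>2" if A: "finite A" for A
  proof -
    have le: "L2_set (\<lambda>p. cmod (\<xi> p)) A \<le> state_norm \<xi>" if "square_summable \<xi>" for \<xi>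
      unfolding L2_set_def using square_summable_finite_le[OF that A] state_norm_nonneg
      by (simp add: real_le_lsqrt sum_nonneg)
    have "L2_set (\<lambda>p. cmod (\<phi> p + \<psi> p)) A \<le> L2_set (\<lambda>p. cmod (\<phi> p) + cmod (\<psi> p)) A"
      by (intro L2_set_mono norm_triangle_ineq) auto
    also have "\<dots> \<le> L2_set (\<lambda>p. cmod (\<phi> p)) A + L2_set (\<lambda>p. cmod (\<psi> p)) A"
      by (rule L2_set_triangle_ineq)
    also have "\<dots> \<le> state_norm \<phi> + state_norm \<psi>"
      using le[OF assms(1)] le[OF assms(2)] by simp
    finally have "(L2_set (\<lambda>p. cmod (\<phi> p + \<psi> p)) A)\<^sup>2 \<le> (state_norm \<phi> + state_norm \<psi>)\<^sup>2"
      by (intro power_mono) auto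
    then show ?thesis by (simp add: L2_set_def sum_nonneg)
  qed
  moreover have "0 \<le> state_norm \<phi> + state_norm \<psi>" by (simp add: state_norm_nonneg)
  ultimately show "square_summable (\<lambda>p. \<phi> p + \<psi> p)"
    and "state_norm (\<lambda>p. \<phi> p + \<psi> p) \<le> state_norm \<phi> + state_norm \<psi>"
    using square_summableI_finite[of "\<lambda>p. \<phi> p + \<psi> p"] by blast+
qed

lemma state_norm_diff:
  assumes "square_summable \<phi>" "square_summable \<psi>"
  shows "square_summable (\<lambda>p. \<phi> p - \<psi> p)"
    and "state_norm (\<lambda>p. \<phi> p - \<psi> p) \<le> state_norm \<phi> + state_norm \<psi>"
  using state_norm_triangle[OF assms(1) square_summable_scale[OF assms(2), of "- 1"]]
    state_norm_scale[of "- 1" \<psi>] by simp_all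

lemma square_summable_inner:
  assumes "square_summable \<phi>" "square_summable \<psi>"
  shows "(\<lambda>p. cnj (\<phi> p) * \<psi> p) summable_on UNIV"
proof (rule summable_on_dominated)
  show "(\<lambda>p. (cmod (\<phi> p))\<^sup>2 + (cmod (\<psi> p))\<^sup>2) summable_on UNIV"
    using assms by (intro summable_on_add) (auto simp: square_summable_def)
  show "norm (cnj (\<phi> p) * \<psi> p) \<le> (cmod (\<phi> p))\<^sup>2 + (cmod (\<psi> p))\<^sup>2" for p
    using abs_mult_le_squares[of "cmod (\<phi> p)" "cmod (\<psi> p)"] by (simp add: norm_mult)
qed

lemma state_norm_add_square:
  assumes "square_summable \<phi>" "square_summable \<psi>"
  shows "(state_norm (\<lambda>p. \<phi> p + \<psi> p))\<^sup>2
    = (state_norm \<phi>)\<^sup>2 + (state_norm \<psi>)\<^sup>2 + 2 * Re (state_inner \<phi> \<psi>)"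
proof (rule has_sum_unique)
  show "((\<lambda>p. (cmod (\<phi> p + \<psi> p))\<^sup>2) has_sum (state_norm (\<lambda>p. \<phi> p + \<psi> p))\<^sup>2) UNIV"
    by (rule square_summable_norm[OF state_norm_triangle(1)[OF assms]])
  have "((\<lambda>p. Re (cnj (\<phi> p) * \<psi> p)) has_sum Re (state_inner \<phi> \<psi>)) UNIV"
    unfolding state_inner_def by (intro has_sum_Re has_sum_infsum square_summable_inner assms)
  from has_sum_add[OF has_sum_add[OF square_summable_norm[OF assms(1)] square_summable_norm[OF assms(2)]]
      has_sum_cmult_right[OF this, of 2]]
  show "((\<lambda>p. (cmod (\<phi> p + \<psi> p))\<^sup>2) has_sum
      (state_norm \<phi>)\<^sup>2 + (state_norm \<psi>)\<^sup>2 + 2 * Re (state_inner \<phi> \<psi>)) UNIV"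
  proof (rule has_sum_cong[THEN iffD1, rotated])
    fix p
    have "(cmod (a + b))\<^sup>2 = (cmod a)\<^sup>2 + (cmod b)\<^sup>2 + 2 * Re (cnj a * b)" for a b
      unfolding cmod_power2 by (simp add: power2_eq_square algebra_simps)
    then show "(cmod (\<phi> p))\<^sup>2 + (cmod (\<psi> p))\<^sup>2 + 2 * Re (cnj (\<phi> p) * \<psi> p) = (cmod (\<phi> p + \<psi> p))\<^sup>2"
      by simp
  qed
qed

text \<open>With these formulas the preservation of norms already yields the preservation of inner
  products.\<close>

lemma state_inner_polarization:
  assumes "square_summable \<phi>" "square_summable \<psi>"
  shows "Re (state_inner \<phi> \<psi>) = ((state_norm (\<lambda>p. \<phi> p + \<psi> p))\<^sup>2 - (state_norm \<phi>)\<^sup>2 - (state_norm \<psi>)\<^sup>2) / 2"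
    and "Im (state_inner \<phi> \<psi>) = ((state_norm \<phi>)\<^sup>2 + (state_norm \<psi>)\<^sup>2 - (state_norm (\<lambda>p. \<phi> p + \<i> * \<psi> p))\<^sup>2) / 2"
proof -
  show "Re (state_inner \<phi> \<psi>) = ((state_norm (\<lambda>p. \<phi> p + \<psi> p))\<^sup>2 - (state_norm \<phi>)\<^sup>2 - (state_norm \<psi>)\<^sup>2) / 2"
    using state_norm_add_square[OF assms] by simp
  have "state_inner \<phi> (\<lambda>p. \<i> * \<psi> p) = \<i> * state_inner \<phi> \<psi>"
    unfolding state_inner_def by (subst infsum_cmult_right'[symmetric]) (simp add: mult_ac)
  then show "Im (state_inner \<phi> \<psi>)
      = ((state_norm \<phi>)\<^sup>2 + (state_norm \<psi>)\<^sup>2 - (state_norm (\<lambda>p. \<phi> p + \<i> * \<psi> p))\<^sup>2) / 2"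
    using state_norm_add_square[OF assms(1) square_summable_scale[OF assms(2), of \<i>]]
      state_norm_scale[of \<i> \<psi>] by simp
qed

section \<open>Unitaries given by real orthogonal kernels\<close>

definition kernel_operator :: "(nat \<times> nat \<Rightarrow> nat \<times> nat \<Rightarrow> real) \<Rightarrow> state \<Rightarrow> state" where
  "kernel_operator \<kappa> \<psi> = (\<lambda>p. \<Sum>\<^sub>\<infinity>q. of_real (\<kappa> p q) * \<psi> q)"

text \<open>On an infinite index set orthonormal rows do not imply orthonormal columns, so both are
  required: columns make the operator isometric, rows do the same for the transpose, and the latter
  gives surjectivity. \<open>D\<close> stands for the basis labels of the Hilbert space.\<close>

definition orthogonal_kernel :: "(nat \<times> nat) set \<Rightarrow> (nat \<times> nat \<Rightarrow> nat \<times> nat \<Rightarrow> real) \<Rightarrow> bool" where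
  "orthogonal_kernel D \<kappa> \<longleftrightarrow>
     (\<forall>p q. \<kappa> p q \<noteq> 0 \<longrightarrow> p \<in> D \<and> q \<in> D) \<and>
     (\<forall>p\<in>D. \<forall>p'\<in>D. ((\<lambda>q. \<kappa> p q * \<kappa> p' q) has_sum of_bool (p = p')) UNIV) \<and>
     (\<forall>q\<in>D. \<forall>q'\<in>D. ((\<lambda>p. \<kappa> p q * \<kappa> p q') has_sum of_bool (q = q')) UNIV)"

lemma orthogonal_kernel_transpose:
  "orthogonal_kernel D \<kappa> \<Longrightarrow> orthogonal_kernel D (\<lambda>p q. \<kappa> q p)"
  by (auto simp: orthogonal_kernel_def)

lemma orthogonal_kernel_row:
  assumes "orthogonal_kernel D \<kappa>"
  shows "square_summable (\<lambda>q. of_real (\<kappa> p q))"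
proof (cases "p \<in> D")
  case True
  then have "((\<lambda>q. \<kappa> p q * \<kappa> p q) has_sum of_bool (p = p)) UNIV"
    using assms unfolding orthogonal_kernel_def by blast
  then show ?thesis
    unfolding square_summable_def by (auto simp: power2_eq_square summable_on_def)
next
  case False
  then have "\<kappa> p q = 0" for q using assms unfolding orthogonal_kernel_def by blast
  then show ?thesis by (simp add: square_summable_def)
qed

lemma kernel_operator_has_sum:
  assumes "orthogonal_kernel D \<kappa>" "square_summable \<psi>"
  shows "((\<lambda>q. of_real (\<kappa> p q) * \<psi> q) has_sum kernel_operator \<kappa> \<psi> p) UNIV"
  unfolding kernel_operator_def
  using square_summable_inner[OF orthogonal_kernel_row[OF assms(1), of p] assms(2)]
  by (intro has_sum_infsum) simp

lemma has_sum_finite_sum: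
  fixes f :: "'b \<Rightarrow> 'a \<Rightarrow> 'c :: topological_comm_monoid_add"
  assumes "\<And>i. i \<in> I \<Longrightarrow> (f i has_sum s i) A"
  shows "((\<lambda>x. \<Sum>i\<in>I. f i x) has_sum (\<Sum>i\<in>I. s i)) A"
  using assms by (induction I rule: infinite_finite_induct) (auto intro: has_sum_add)

lemma kernel_finite_isometry:
  assumes "orthogonal_kernel D \<kappa>" "finite Y" "Y \<subseteq> D"
  shows "((\<lambda>p. (cmod (\<Sum>q\<in>Y. of_real (\<kappa> p q) * \<psi> q))\<^sup>2) has_sum (\<Sum>q\<in>Y. (cmod (\<psi> q))\<^sup>2)) UNIV"
proof -
  have "((\<lambda>p. \<Sum>q\<in>Y. \<Sum>q'\<in>Y. \<psi> q * cnj (\<psi> q') * of_real (\<kappa> p q * \<kappa> p q')) has_sum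
      (\<Sum>q\<in>Y. \<Sum>q'\<in>Y. \<psi> q * cnj (\<psi> q') * of_real (of_bool (q = q')))) UNIV"
  proof (intro has_sum_finite_sum has_sum_cmult_right has_sum_of_real)
    fix q q' assume "q \<in> Y" "q' \<in> Y"
    then show "((\<lambda>p. \<kappa> p q * \<kappa> p q') has_sum of_bool (q = q')) UNIV"
      using assms unfolding orthogonal_kernel_def by blast
  qed
  from has_sum_Re[OF this]
  have "((\<lambda>p. Re (\<Sum>q\<in>Y. \<Sum>q'\<in>Y. \<psi> q * cnj (\<psi> q') * of_real (\<kappa> p q * \<kappa> p q'))) has_sum
      Re (\<Sum>q\<in>Y. \<Sum>q'\<in>Y. \<psi> q * cnj (\<psi> q') * of_real (of_bool (q = q')))) UNIV" .
  moreover have "(\<Sum>q\<in>Y. \<Sum>q'\<in>Y. \<psi> q * cnj (\<psi> q') * of_real (of_bool (q = q')))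
      = of_real (\<Sum>q\<in>Y. (cmod (\<psi> q))\<^sup>2)"
  proof -
    have "(\<Sum>q'\<in>Y. \<psi> q * cnj (\<psi> q') * of_real (of_bool (q = q'))) = of_real ((cmod (\<psi> q))\<^sup>2)"
      if "q \<in> Y" for q
    proof -
      have "(\<Sum>q'\<in>Y. \<psi> q * cnj (\<psi> q') * of_real (of_bool (q = q')))
          = (\<Sum>q'\<in>Y. if q = q' then \<psi> q * cnj (\<psi> q') else 0)"
        by (rule sum.cong) auto
      then show ?thesis using that assms(2) by (simp add: complex_norm_square del: of_real_power)
    qed
    then show ?thesis by simp
  qed
  moreover have "(\<Sum>q\<in>Y. \<Sum>q'\<in>Y. \<psi> q * cnj (\<psi> q') * of_real (\<kappa> p q * \<kappa> p q'))
      = of_real ((cmod (\<Sum>q\<in>Y. of_real (\<kappa> p q) * \<psi> q))\<^sup>2)" for p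
    unfolding complex_norm_square by (simp add: sum_product mult_ac)
  ultimately show ?thesis by (simp only: Re_complex_of_real)
qed

text \<open>No double series is interchanged. For finitely many output labels the value is a limit
  over finite sets of input labels, where the isometry is finite algebra, and the upper bound
  survives both limits.\<close>

lemma kernel_contraction:
  assumes \<kappa>: "orthogonal_kernel D \<kappa>" and \<psi>: "square_summable \<psi>"
  shows "square_summable (kernel_operator \<kappa> \<psi>)"
    and "state_norm (kernel_operator \<kappa> \<psi>) \<le> state_norm \<psi>"
proof -
  have "(\<Sum>p\<in>P. (cmod (kernel_operator \<kappa> \<psi> p))\<^sup>2) \<le> (state_norm \<psi>)\<^sup>2" if P: "finite P" for P
  proof (rule tendsto_upperbound)
    show "((\<lambda>Y. \<Sum>p\<in>P. (cmod (\<Sum>q\<in>Y. of_real (\<kappa> p q) * \<psi> q))\<^sup>2) \<longlongrightarrow>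
        (\<Sum>p\<in>P. (cmod (kernel_operator \<kappa> \<psi> p))\<^sup>2)) (finite_subsets_at_top UNIV)"
      using kernel_operator_has_sum[OF assms] unfolding has_sum_def by (intro tendsto_intros)
    have "(\<Sum>p\<in>P. (cmod (\<Sum>q\<in>Y. of_real (\<kappa> p q) * \<psi> q))\<^sup>2) \<le> (state_norm \<psi>)\<^sup>2" if Y: "finite Y" for Y
    proof -
      have "(\<Sum>q\<in>Y. of_real (\<kappa> p q) * \<psi> q) = (\<Sum>q\<in>Y \<inter> D. of_real (\<kappa> p q) * \<psi> q)" for p
      proof (rule sum.mono_neutral_right[OF Y])
        show "\<forall>q\<in>Y - Y \<inter> D. of_real (\<kappa> p q) * \<psi> q = 0"
          using \<kappa> unfolding orthogonal_kernel_def by (metis DiffD1 DiffD2 IntI mult_zero_left of_real_0)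
      qed auto
      then have "(\<Sum>p\<in>P. (cmod (\<Sum>q\<in>Y. of_real (\<kappa> p q) * \<psi> q))\<^sup>2)
          = (\<Sum>p\<in>P. (cmod (\<Sum>q\<in>Y \<inter> D. of_real (\<kappa> p q) * \<psi> q))\<^sup>2)" by simp
      also have "\<dots> \<le> (\<Sum>q\<in>Y \<inter> D. (cmod (\<psi> q))\<^sup>2)"
        by (rule finite_sum_le_has_sum[OF kernel_finite_isometry[OF \<kappa>] P]) (use Y in auto)
      also have "\<dots> \<le> (state_norm \<psi>)\<^sup>2"
        by (rule square_summable_finite_le[OF \<psi>]) (use Y in auto)
      finally show ?thesis .
    qed
    then show "\<forall>\<^sub>F Y in finite_subsets_at_top UNIV.
        (\<Sum>p\<in>P. (cmod (\<Sum>q\<in>Y. of_real (\<kappa> p q) * \<psi> q))\<^sup>2) \<le> (state_norm \<psi>)\<^sup>2"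
      by (intro eventually_finite_subsets_at_top_weakI) auto
  qed simp
  from square_summableI_finite[of "kernel_operator \<kappa> \<psi>", OF this state_norm_nonneg]
  show "square_summable (kernel_operator \<kappa> \<psi>)"
    and "state_norm (kernel_operator \<kappa> \<psi>) \<le> state_norm \<psi>" by auto
qed

lemma kernel_operator_add:
  assumes "orthogonal_kernel D \<kappa>" "square_summable \<phi>" "square_summable \<psi>"
  shows "kernel_operator \<kappa> (\<lambda>p. \<phi> p + \<psi> p) = (\<lambda>p. kernel_operator \<kappa> \<phi> p + kernel_operator \<kappa> \<psi> p)"
proof
  fix p
  from has_sum_add[OF kernel_operator_has_sum[OF assms(1,2)] kernel_operator_has_sum[OF assms(1,3)], of p p]
  show "kernel_operator \<kappa> (\<lambda>p. \<phi> p + \<psi> p) p = kernel_operator \<kappa> \<phi> p + kernel_operator \<kappa> \<psi> p"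
    using kernel_operator_has_sum[OF assms(1) state_norm_triangle(1)[OF assms(2,3)], of p]
    by (simp add: distrib_left has_sum_unique)
qed

lemma kernel_operator_scale:
  "kernel_operator \<kappa> (\<lambda>p. c * \<psi> p) = (\<lambda>p. c * kernel_operator \<kappa> \<psi> p)"
  unfolding kernel_operator_def by (simp add: infsum_cmult_right'[symmetric] mult_ac)

lemma kernel_operator_diff:
  assumes "orthogonal_kernel D \<kappa>" "square_summable \<phi>" "square_summable \<psi>"
  shows "kernel_operator \<kappa> (\<lambda>p. \<phi> p - \<psi> p) = (\<lambda>p. kernel_operator \<kappa> \<phi> p - kernel_operator \<kappa> \<psi> p)"
  using kernel_operator_add[OF assms(1,2) square_summable_scale[OF assms(3), of "- 1"]]
    kernel_operator_scale[of \<kappa> "- 1" \<psi>] by simp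

text \<open>Finite truncations of \<psi> keep their norm exactly, the remainder is contracted, and
  the norm of the remainder tends to 0.\<close>

lemma kernel_isometry:
  assumes \<kappa>: "orthogonal_kernel D \<kappa>" and \<psi>: "square_summable \<psi>" and supp: "\<And>p. p \<notin> D \<Longrightarrow> \<psi> p = 0"
  shows "state_norm (kernel_operator \<kappa> \<psi>) = state_norm \<psi>"
proof (rule antisym[OF kernel_contraction(2)[OF \<kappa> \<psi>]])
  let ?s = "\<lambda>Y. \<Sum>p\<in>Y. (cmod (\<psi> p))\<^sup>2" and ?F = "finite_subsets_at_top (UNIV :: (nat \<times> nat) set)"
  have lim: "(?s \<longlongrightarrow> (state_norm \<psi>)\<^sup>2) ?F"
    using square_summable_norm[OF \<psi>] unfolding has_sum_def .
  show "state_norm \<psi> \<le> state_norm (kernel_operator \<kappa> \<psi>)"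
  proof (rule tendsto_le)
    show "((\<lambda>Y. sqrt (?s Y)) \<longlongrightarrow> state_norm \<psi>) ?F"
      using tendsto_real_sqrt[OF lim] state_norm_nonneg by simp
    show "((\<lambda>Y. state_norm (kernel_operator \<kappa> \<psi>) + sqrt ((state_norm \<psi>)\<^sup>2 - ?s Y)) \<longlongrightarrow>
        state_norm (kernel_operator \<kappa> \<psi>)) ?F"
      using tendsto_add[OF tendsto_const tendsto_real_sqrt[OF tendsto_diff[OF tendsto_const lim]],
        of "state_norm (kernel_operator \<kappa> \<psi>)" "(state_norm \<psi>)\<^sup>2"] by simp
    have "sqrt (?s Y) \<le> state_norm (kernel_operator \<kappa> \<psi>) + sqrt ((state_norm \<psi>)\<^sup>2 - ?s Y)"
      if Y: "finite Y" for Y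
    proof -
      define \<phi> \<xi> where "\<phi> = (\<lambda>p. if p \<in> Y then \<psi> p else 0)" and "\<xi> = (\<lambda>p. if p \<in> Y then 0 else \<psi> p)"
      have sq: "square_summable \<phi>" "square_summable \<xi>"
        by (rule square_summable_dominated(1)[OF \<psi>], simp add: \<phi>_def \<xi>_def)+
      have "((\<lambda>p. (cmod (\<phi> p))\<^sup>2) has_sum ?s Y) UNIV"
        by (rule has_sum_finite_neutralI[OF Y]) (auto simp: \<phi>_def)
      from has_sum_add[OF square_summable_norm[OF \<psi>] has_sum_cmult_right[OF this, of "- 1"]]
      have "((\<lambda>p. (cmod (\<psi> p))\<^sup>2 + - 1 * (cmod (\<phi> p))\<^sup>2) has_sum ((state_norm \<psi>)\<^sup>2 + - 1 * ?s Y)) UNIV" .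
      moreover have "(cmod (\<psi> p))\<^sup>2 + - 1 * (cmod (\<phi> p))\<^sup>2 = (cmod (\<xi> p))\<^sup>2" for p
        by (simp add: \<phi>_def \<xi>_def)
      ultimately have "((\<lambda>p. (cmod (\<xi> p))\<^sup>2) has_sum ((state_norm \<psi>)\<^sup>2 - ?s Y)) UNIV" by simp
      from has_sum_unique[OF square_summable_norm[OF sq(2)] this]
      have \<xi>: "state_norm \<xi> = sqrt ((state_norm \<psi>)\<^sup>2 - ?s Y)"
        using state_norm_nonneg[of \<xi>] by (metis abs_of_nonneg real_sqrt_abs)
      have K\<phi>: "kernel_operator \<kappa> \<phi> p = (\<Sum>q\<in>Y \<inter> D. of_real (\<kappa> p q) * \<psi> q)" for p
      proof (rule has_sum_unique[OF kernel_operator_has_sum[OF \<kappa> sq(1)]])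
        show "((\<lambda>q. of_real (\<kappa> p q) * \<phi> q) has_sum (\<Sum>q\<in>Y \<inter> D. of_real (\<kappa> p q) * \<psi> q)) UNIV"
          by (rule has_sum_finite_neutralI[of "Y \<inter> D"]) (use Y supp in \<open>auto simp: \<phi>_def\<close>)
      qed
      have "((\<lambda>p. (cmod (kernel_operator \<kappa> \<phi> p))\<^sup>2) has_sum (\<Sum>q\<in>Y \<inter> D. (cmod (\<psi> q))\<^sup>2)) UNIV"
        unfolding K\<phi> by (rule kernel_finite_isometry[OF \<kappa>]) (use Y in auto)
      moreover have "(\<Sum>q\<in>Y \<inter> D. (cmod (\<psi> q))\<^sup>2) = ?s Y"
        using Y supp by (intro sum.mono_neutral_left) auto
      ultimately have "(state_norm (kernel_operator \<kappa> \<phi>))\<^sup>2 = ?s Y"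
        using has_sum_unique[OF square_summable_norm[OF kernel_contraction(1)[OF \<kappa> sq(1)]]] by simp
      then have "sqrt (?s Y) = state_norm (kernel_operator \<kappa> \<phi>)"
        using state_norm_nonneg by (metis abs_of_nonneg real_sqrt_abs)
      also have "kernel_operator \<kappa> \<phi> = (\<lambda>p. kernel_operator \<kappa> \<psi> p - kernel_operator \<kappa> \<xi> p)"
      proof -
        have "\<phi> = (\<lambda>p. \<psi> p - \<xi> p)" by (auto simp: \<phi>_def \<xi>_def)
        then show ?thesis using kernel_operator_diff[OF \<kappa> \<psi> sq(2)] by simp
      qed
      also have "state_norm \<dots> \<le> state_norm (kernel_operator \<kappa> \<psi>) + state_norm (kernel_operator \<kappa> \<xi>)"
        by (intro state_norm_diff kernel_contraction[OF \<kappa>] \<psi> sq)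
      also have "state_norm (kernel_operator \<kappa> \<xi>) \<le> sqrt ((state_norm \<psi>)\<^sup>2 - ?s Y)"
        using kernel_contraction(2)[OF \<kappa> sq(2)] \<xi> by simp
      finally show ?thesis by simp
    qed
    then show "\<forall>\<^sub>F Y in ?F. sqrt (?s Y) \<le> state_norm (kernel_operator \<kappa> \<psi>) + sqrt ((state_norm \<psi>)\<^sup>2 - ?s Y)"
      by (intro eventually_finite_subsets_at_top_weakI) auto
  qed simp
qed

lemma in_hilbert_space_iff:
  "\<psi> \<in> hilbert_space n W \<longleftrightarrow> square_summable \<psi> \<and> (\<forall>p. p \<notin> {..<n} \<times> W \<longrightarrow> \<psi> p = 0)"
  by (auto simp: hilbert_space_def square_summable_def)

lemma kernel_operator_closed:
  assumes "orthogonal_kernel ({..<n} \<times> W) \<kappa>" "\<psi> \<in> hilbert_space n W"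
  shows "kernel_operator \<kappa> \<psi> \<in> hilbert_space n W"
proof -
  have "kernel_operator \<kappa> \<psi> p = 0" if "p \<notin> {..<n} \<times> W" for p
  proof -
    have "\<kappa> p q = 0" for q using assms(1) that unfolding orthogonal_kernel_def by blast
    then show ?thesis by (simp add: kernel_operator_def)
  qed
  then show ?thesis using assms kernel_contraction(1) by (simp add: in_hilbert_space_iff)
qed

lemma kernel_inner_isometry:
  assumes "orthogonal_kernel ({..<n} \<times> W) \<kappa>" "\<phi> \<in> hilbert_space n W" "\<psi> \<in> hilbert_space n W"
  shows "state_inner (kernel_operator \<kappa> \<phi>) (kernel_operator \<kappa> \<psi>) = state_inner \<phi> \<psi>"
proof -
  have sq: "square_summable \<phi>" "square_summable \<psi>" using assms by (auto simp: in_hilbert_space_iff)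
  have supp: "\<phi> p = 0" "\<psi> p = 0" if "p \<notin> {..<n} \<times> W" for p
    using assms(2,3) that unfolding in_hilbert_space_iff by blast+
  note iso = kernel_isometry[OF assms(1)]
  have norms: "state_norm (kernel_operator \<kappa> \<phi>) = state_norm \<phi>"
    "state_norm (kernel_operator \<kappa> \<psi>) = state_norm \<psi>"
    "state_norm (\<lambda>p. kernel_operator \<kappa> \<phi> p + kernel_operator \<kappa> \<psi> p) = state_norm (\<lambda>p. \<phi> p + \<psi> p)"
    "state_norm (\<lambda>p. kernel_operator \<kappa> \<phi> p + \<i> * kernel_operator \<kappa> \<psi> p) = state_norm (\<lambda>p. \<phi> p + \<i> * \<psi> p)"
    using iso[OF sq(1) supp(1)] iso[OF sq(2) supp(2)]
      iso[OF state_norm_triangle(1)[OF sq]] iso[OF state_norm_triangle(1)[OF sq(1) square_summable_scale[OF sq(2), of \<i>]]]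
      kernel_operator_add[OF assms(1) sq] kernel_operator_add[OF assms(1) sq(1) square_summable_scale[OF sq(2), of \<i>]]
      kernel_operator_scale[of \<kappa> \<i> \<psi>] supp by simp_all
  show ?thesis
    using state_inner_polarization[OF sq] state_inner_polarization[OF kernel_contraction(1)[OF assms(1) sq(1)]
      kernel_contraction(1)[OF assms(1) sq(2)]] norms by (intro complex_eqI) simp_all
qed

text \<open>Coordinate q of the left side is the inner product of the images of the basis vector at
  q and of \<psi>, which the isometry reduces to \<psi> q. Applied to the transposed kernel, this
  yields surjectivity.\<close>

lemma kernel_transpose_inverse:
  assumes "orthogonal_kernel ({..<n} \<times> W) \<kappa>" "\<psi> \<in> hilbert_space n W"
  shows "kernel_operator (\<lambda>p q. \<kappa> q p) (kernel_operator \<kappa> \<psi>) = \<psi>"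
proof
  fix q
  define \<xi> where "\<xi> = kernel_operator \<kappa> \<psi>"
  show "kernel_operator (\<lambda>p q. \<kappa> q p) \<xi> q = \<psi> q"
  proof (cases "q \<in> {..<n} \<times> W")
    case True
    define \<delta> :: state where "\<delta> = (\<lambda>p. of_bool (p = q))"
    have \<delta>: "\<delta> \<in> hilbert_space n W"
    proof -
      have "((\<lambda>p. (cmod (\<delta> p))\<^sup>2) has_sum (\<Sum>p\<in>{q}. (cmod (\<delta> p))\<^sup>2)) UNIV"
        by (rule has_sum_finite_neutralI[of "{q}"]) (auto simp: \<delta>_def)
      then show ?thesis using True by (auto simp: in_hilbert_space_iff square_summable_def summable_on_def \<delta>_def)
    qed
    have K\<delta>: "kernel_operator \<kappa> \<delta> p = of_real (\<kappa> p q)" for p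
      unfolding kernel_operator_def
      by (rule infsumI, rule has_sum_finite_neutralI[of "{q}"]) (auto simp: \<delta>_def)
    have "kernel_operator (\<lambda>p q. \<kappa> q p) \<xi> q = state_inner (kernel_operator \<kappa> \<delta>) \<xi>"
      unfolding state_inner_def K\<delta> by (simp add: kernel_operator_def[of "\<lambda>p q. \<kappa> q p"])
    also have "\<dots> = state_inner \<delta> \<psi>"
      unfolding \<xi>_def by (rule kernel_inner_isometry[OF assms(1) \<delta> assms(2)])
    also have "\<dots> = \<psi> q"
      unfolding state_inner_def
      by (rule infsumI, rule has_sum_finite_neutralI[of "{q}"]) (auto simp: \<delta>_def)
    finally show ?thesis .
  next
    case False
    then show ?thesis
      using kernel_operator_closed[OF orthogonal_kernel_transpose[OF assms(1)], of \<xi>]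
        kernel_operator_closed[OF assms] assms(2) unfolding \<xi>_def in_hilbert_space_iff by metis
  qed
qed

lemma kernel_unitary:
  assumes "orthogonal_kernel ({..<n} \<times> W) \<kappa>"
  shows "unitary_operator (hilbert_space n W) (kernel_operator \<kappa>)"
  unfolding unitary_operator_def linear_operator_def
proof (intro conjI ballI allI)
  fix \<phi> \<psi> c assume \<phi>: "\<phi> \<in> hilbert_space n W" and \<psi>: "\<psi> \<in> hilbert_space n W"
  show "kernel_operator \<kappa> (\<lambda>p. \<phi> p + \<psi> p) = (\<lambda>p. kernel_operator \<kappa> \<phi> p + kernel_operator \<kappa> \<psi> p)"
    by (rule kernel_operator_add[OF assms]) (use \<phi> \<psi> in \<open>auto simp: in_hilbert_space_iff\<close>)
  show "state_inner (kernel_operator \<kappa> \<phi>) (kernel_operator \<kappa> \<psi>) = state_inner \<phi> \<psi>"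
    by (rule kernel_inner_isometry[OF assms \<phi> \<psi>])
next
  fix c \<psi> assume \<psi>: "\<psi> \<in> hilbert_space n W"
  show "kernel_operator \<kappa> \<psi> \<in> hilbert_space n W"
    by (rule kernel_operator_closed[OF assms \<psi>])
  show "kernel_operator \<kappa> (\<lambda>p. c * \<psi> p) = (\<lambda>p. c * kernel_operator \<kappa> \<psi> p)"
    by (rule kernel_operator_scale)
next
  show "kernel_operator \<kappa> ` hilbert_space n W = hilbert_space n W"
  proof (intro equalityI subsetI)
    fix \<psi> assume \<psi>: "\<psi> \<in> hilbert_space n W"
    have t: "orthogonal_kernel ({..<n} \<times> W) (\<lambda>p q. \<kappa> q p)" by (rule orthogonal_kernel_transpose[OF assms])
    from kernel_transpose_inverse[OF t \<psi>] kernel_operator_closed[OF t \<psi>]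
    show "\<psi> \<in> kernel_operator \<kappa> ` hilbert_space n W" by force
  qed (use kernel_operator_closed[OF assms] in auto)
qed

section \<open>Query programs\<close>

lemma run_Output: "run x (Output k) \<psi> = return_spmf (k, 0)"
  by (subst run.simps) simp

lemma run_Unitary: "run x (Unitary U A) \<psi> = run x A (U \<psi>)"
  by (subst run.simps) simp

lemma run_Measure: "run x (Measure P F) \<psi> =
    bind_spmf (spmf_of_pmf (embed_pmf (\<lambda>k. (state_norm (P k \<psi>))\<^sup>2)))
      (\<lambda>k. run x (F k) (normalized (P k \<psi>)))"
  by (subst run.simps) simp

lemma run_Quantum_Query:
  "run x (Quantum_Query A) \<psi> = map_spmf (map_prod id Suc) (run x A (phase_oracle x \<psi>))"
  by (subst run.simps) simp

lemma run_Classical_Query: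
  "run x (Classical_Query i F) \<psi> = map_spmf (map_prod id Suc) (run x (F (x i)) \<psi>)"
  by (subst run.simps) simp

primrec iterate_query :: "(state \<Rightarrow> state) \<Rightarrow> program \<Rightarrow> nat \<Rightarrow> program" where
  "iterate_query U A 0 = A"
| "iterate_query U A (Suc t) = Quantum_Query (Unitary U (iterate_query U A t))"

lemma valid_iterate_query:
  "unitary_operator H U \<Longrightarrow> valid_program n H A \<Longrightarrow> valid_program n H (iterate_query U A t)"
  by (induction t) (auto intro: valid_program.intros)

lemma run_iterate_query:
  "run x (iterate_query U A t) \<psi> =
    map_spmf (map_prod id ((+) t)) (run x A (((\<lambda>\<psi>. U (phase_oracle x \<psi>)) ^^ t) \<psi>))"
proof (induction t arbitrary: \<psi>)
  case 0
  show ?case by (simp add: map_spmf_idI)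
next
  case (Suc t)
  define f where "f = (\<lambda>\<psi>. U (phase_oracle x \<psi>))"
  have comp: "map_prod id Suc \<circ> map_prod id ((+) t) = map_prod (id :: nat \<Rightarrow> nat) ((+) (Suc t))" by auto
  have "run x (iterate_query U A (Suc t)) \<psi>
      = map_spmf (map_prod id Suc) (map_spmf (map_prod id ((+) t)) (run x A ((f ^^ t) (f \<psi>))))"
    by (simp only: iterate_query.simps run_Quantum_Query run_Unitary Suc f_def)
  also have "\<dots> = map_spmf (map_prod id ((+) (Suc t))) (run x A ((f ^^ t) (f \<psi>)))"
    by (simp only: spmf.map_comp comp)
  also have "(f ^^ t) (f \<psi>) = (f ^^ Suc t) \<psi>" by (simp add: funpow_swap1)
  finally show ?case unfolding f_def .
qed

text \<open>Windows may overhang the array: indices are capped at \<open>n - 1\<close>, where the bit is always 1.\<close>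

primrec bisect :: "nat \<Rightarrow> nat \<Rightarrow> nat \<Rightarrow> program" where
  "bisect n 0 = (\<lambda>lo. Output lo)"
| "bisect n (Suc k) = (\<lambda>lo. Classical_Query (min (n - 1) (lo + 2 ^ k - 1))
     (\<lambda>b. if b then bisect n k lo else bisect n k (lo + 2 ^ k)))"

lemma valid_bisect: "1 \<le> n \<Longrightarrow> valid_program n H (bisect n k lo)"
  by (induction k arbitrary: lo) (auto intro!: valid_program.intros)

lemma run_bisect:
  assumes "j < n" "lo \<le> j" "j < lo + 2 ^ k"
  shows "run (ordered_input j) (bisect n k lo) \<psi> = return_spmf (j, k)"
  using assms
proof (induction k arbitrary: lo)
  case 0
  then show ?case by (simp add: run_Output)
next
  case (Suc k)
  have "(1::nat) \<le> 2 ^ k" by simp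
  then have "ordered_input j (min (n - 1) (lo + 2 ^ k - 1)) \<longleftrightarrow> j < lo + 2 ^ k"
    using Suc.prems unfolding ordered_input_def min.bounded_iff by linarith
  then show ?case
    using Suc.IH[of lo] Suc.IH[of "lo + 2 ^ k"] Suc.prems by (simp add: run_Classical_Query)
qed

text \<open>For \<open>lo = 0\<close> the subtraction truncates and the first bit is meaningless, so it is ignored.\<close>

definition locate :: "nat \<Rightarrow> nat \<Rightarrow> nat \<Rightarrow> nat \<Rightarrow> program" where
  "locate n k K lo = Classical_Query (min (n - 1) (lo - 1)) (\<lambda>b.
     Classical_Query (min (n - 1) (lo + 2 ^ k - 1)) (\<lambda>b'.
       if (lo = 0 \<or> \<not> b) \<and> b' then bisect n k lo else bisect n K 0))"

definition locate_cost :: "nat \<Rightarrow> nat \<Rightarrow> nat \<Rightarrow> nat \<Rightarrow> nat" where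
  "locate_cost k K j lo = 2 + (if lo \<le> j \<and> j < lo + 2 ^ k then k else K)"

lemma valid_locate: "1 \<le> n \<Longrightarrow> valid_program n H (locate n k K lo)"
  unfolding locate_def by (auto intro!: valid_program.intros valid_bisect)

lemma run_locate:
  assumes "j < n" "n \<le> 2 ^ K"
  shows "run (ordered_input j) (locate n k K lo) \<psi> = return_spmf (j, locate_cost k K j lo)"
proof -
  have "(1::nat) \<le> 2 ^ k" by simp
  then have 1: "ordered_input j (min (n - 1) (lo + 2 ^ k - 1)) \<longleftrightarrow> j < lo + 2 ^ k"
    using assms unfolding ordered_input_def min.bounded_iff by linarith
  have 2: "(lo = 0 \<or> \<not> ordered_input j (min (n - 1) (lo - 1))) \<longleftrightarrow> lo \<le> j"
    using assms unfolding ordered_input_def min.bounded_iff by linarith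
  have "run (ordered_input j) (bisect n k lo) \<psi> = return_spmf (j, k)" if "lo \<le> j" "j < lo + 2 ^ k"
    by (rule run_bisect[OF assms(1) that])
  moreover have "run (ordered_input j) (bisect n K 0) \<psi> = return_spmf (j, K)"
    by (rule run_bisect) (use assms in auto)
  moreover have "run (ordered_input j) (locate n k K lo) \<psi> =
      map_spmf (map_prod id Suc) (map_spmf (map_prod id Suc)
        (run (ordered_input j) (if lo \<le> j \<and> j < lo + 2 ^ k then bisect n k lo else bisect n K 0) \<psi>))"
    unfolding locate_def run_Classical_Query 1 2 ..
  ultimately show ?thesis
    by (cases "lo \<le> j \<and> j < lo + 2 ^ k") (auto simp: locate_cost_def)
qed

section \<open>Measurement in the standard basis\<close>

text \<open>Outcomes of a measurement are natural numbers, so the basis labels are enumerated by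
  \<open>prod_decode\<close>.\<close>

definition basis_measurement :: "nat \<Rightarrow> state \<Rightarrow> state" where
  "basis_measurement m \<psi> = (\<lambda>p. if p = prod_decode m then \<psi> p else 0)"

lemma state_norm_basis_measurement: "(state_norm (basis_measurement m \<psi>))\<^sup>2 = (cmod (\<psi> (prod_decode m)))\<^sup>2"
proof -
  have "((\<lambda>p. (cmod (basis_measurement m \<psi> p))\<^sup>2) has_sum (\<Sum>p\<in>{prod_decode m}. (cmod (\<psi> p))\<^sup>2)) UNIV"
    by (rule has_sum_finite_neutralI[of "{prod_decode m}"]) (auto simp: basis_measurement_def)
  then show ?thesis by (simp add: state_norm_def infsumI)
qed

lemma square_summable_sums:
  assumes "square_summable \<psi>"
  shows "(\<lambda>m. (cmod (\<psi> (prod_decode m)))\<^sup>2) sums (state_norm \<psi>)\<^sup>2"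
  using square_summable_norm[OF assms]
    has_sum_reindex_bij_betw[OF bij_prod_decode, of "\<lambda>p. (cmod (\<psi> p))\<^sup>2"]
  by (auto dest: has_sum_imp_sums)

lemma projective_basis_measurement:
  "projective_measurement (hilbert_space n W) basis_measurement"
  unfolding projective_measurement_def
proof (intro conjI allI impI ballI)
  fix m
  have closed: "basis_measurement m \<psi> \<in> hilbert_space n W" if "\<psi> \<in> hilbert_space n W" for \<psi>
    unfolding in_hilbert_space_iff
  proof (intro conjI allI impI)
    show "square_summable (basis_measurement m \<psi>)"
      by (rule square_summable_dominated(1)[of \<psi>])
        (use that in \<open>auto simp: in_hilbert_space_iff basis_measurement_def\<close>)
    show "basis_measurement m \<psi> p = 0" if "p \<notin> {..<n} \<times> W" for p
      using \<open>\<psi> \<in> hilbert_space n W\<close> that unfolding in_hilbert_space_iff basis_measurement_def by metis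
  qed
  have inner: "state_inner (basis_measurement m \<phi>) \<psi> = state_inner \<phi> (basis_measurement m \<psi>)" for \<phi> \<psi>
    unfolding state_inner_def by (rule infsum_cong) (auto simp: basis_measurement_def)
  show "orthogonal_projection (hilbert_space n W) (basis_measurement m)"
    unfolding orthogonal_projection_def linear_operator_def
    using closed inner by (auto simp: basis_measurement_def fun_eq_iff)
next
  fix k l :: nat and \<psi> :: state assume "k \<noteq> l"
  then have "prod_decode k \<noteq> prod_decode l" by (simp add: prod_decode_eq)
  then show "basis_measurement k (basis_measurement l \<psi>) = (\<lambda>p. 0)"
    by (auto simp: basis_measurement_def fun_eq_iff)
next
  fix \<psi> assume "\<psi> \<in> hilbert_space n W"
  then have \<psi>: "square_summable \<psi>" by (simp add: in_hilbert_space_iff)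
  define rest where "rest = (\<lambda>N p. \<psi> p - (\<Sum>k<N. basis_measurement k \<psi> p))"
  have part: "(\<Sum>k<N. basis_measurement k \<psi> p) = (if prod_encode p < N then \<psi> p else 0)" for N p
  proof -
    have "(\<Sum>k<N. basis_measurement k \<psi> p) = (\<Sum>k<N. if k = prod_encode p then \<psi> p else 0)"
      by (rule sum.cong) (auto simp: basis_measurement_def)
    then show ?thesis by (simp add: sum.delta')
  qed
  have norm: "(state_norm (rest N))\<^sup>2 = (state_norm \<psi>)\<^sup>2 - (\<Sum>m<N. (cmod (\<psi> (prod_decode m)))\<^sup>2)" for N
  proof -
    have "square_summable (rest N)"
      by (rule square_summable_dominated(1)[OF \<psi>]) (simp add: rest_def part)
    from square_summable_sums[OF this]
    have "(\<lambda>m. (cmod (rest N (prod_decode m)))\<^sup>2) sums (state_norm (rest N))\<^sup>2" .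
    moreover have "(\<lambda>m. (cmod (\<psi> (prod_decode m)))\<^sup>2 - (if m < N then (cmod (\<psi> (prod_decode m)))\<^sup>2 else 0))
        sums ((state_norm \<psi>)\<^sup>2 - (\<Sum>m<N. (cmod (\<psi> (prod_decode m)))\<^sup>2))"
    proof (rule sums_diff[OF square_summable_sums[OF \<psi>]])
      show "(\<lambda>m. if m < N then (cmod (\<psi> (prod_decode m)))\<^sup>2 else 0) sums
          (\<Sum>m<N. (cmod (\<psi> (prod_decode m)))\<^sup>2)"
        using sums_If_finite_set[of "{..<N}" "\<lambda>m. (cmod (\<psi> (prod_decode m)))\<^sup>2"] by simp
    qed
    moreover have "(cmod (\<psi> (prod_decode m)))\<^sup>2 - (if m < N then (cmod (\<psi> (prod_decode m)))\<^sup>2 else 0)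
        = (cmod (rest N (prod_decode m)))\<^sup>2" for m
      by (simp add: rest_def part)
    ultimately show ?thesis using sums_unique2 by simp
  qed
  have "(\<lambda>N. (state_norm \<psi>)\<^sup>2 - (\<Sum>m<N. (cmod (\<psi> (prod_decode m)))\<^sup>2))
      \<longlonglongrightarrow> (state_norm \<psi>)\<^sup>2 - (state_norm \<psi>)\<^sup>2"
    using square_summable_sums[OF \<psi>] unfolding sums_def by (intro tendsto_intros)
  then have "(\<lambda>N. (state_norm (rest N))\<^sup>2) \<longlonglongrightarrow> 0" by (simp add: norm)
  from tendsto_real_sqrt[OF this]
  show "(\<lambda>N. state_norm (\<lambda>p. \<psi> p - (\<Sum>k<N. basis_measurement k \<psi> p))) \<longlonglongrightarrow> 0"
    by (simp add: state_norm_nonneg rest_def)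
qed

lemma kernel_phase_iterate_norm:
  assumes "orthogonal_kernel ({..<n} \<times> W) \<kappa>" "\<psi> \<in> hilbert_space n W"
  shows "((\<lambda>\<psi>. kernel_operator \<kappa> (phase_oracle x \<psi>)) ^^ t) \<psi> \<in> hilbert_space n W \<and>
    state_norm (((\<lambda>\<psi>. kernel_operator \<kappa> (phase_oracle x \<psi>)) ^^ t) \<psi>) = state_norm \<psi>"
proof (induction t)
  case (Suc t)
  let ?\<psi> = "((\<lambda>\<psi>. kernel_operator \<kappa> (phase_oracle x \<psi>)) ^^ t) \<psi>"
  have cmod: "cmod (phase_oracle x ?\<psi> p) = cmod (?\<psi> p)" for p
    by (cases p) (simp add: phase_oracle_def norm_mult norm_power)
  have "square_summable (phase_oracle x ?\<psi>)"
    by (rule square_summable_dominated(1)[of ?\<psi>]) (use Suc cmod in \<open>auto simp: in_hilbert_space_iff\<close>)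
  moreover have zero: "phase_oracle x ?\<psi> p = 0" if "p \<notin> {..<n} \<times> W" for p
  proof -
    have "?\<psi> p = 0" using Suc that unfolding in_hilbert_space_iff by blast
    then show ?thesis using cmod[of p] by simp
  qed
  ultimately have O: "phase_oracle x ?\<psi> \<in> hilbert_space n W" by (simp add: in_hilbert_space_iff)
  have "state_norm (phase_oracle x ?\<psi>) = state_norm ?\<psi>"
    by (simp add: state_norm_def cmod)
  moreover have "state_norm (kernel_operator \<kappa> (phase_oracle x ?\<psi>)) = state_norm (phase_oracle x ?\<psi>)"
    by (rule kernel_isometry[OF assms(1)]) (use O zero in \<open>auto simp: in_hilbert_space_iff\<close>)
  ultimately show ?case using kernel_operator_closed[OF assms(1) O] Suc by simp
qed (use assms in simp)

section \<open>The algorithm for an abstract kernel, and its cost\<close>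

definition search_algorithm ::
  "(nat \<times> nat \<Rightarrow> nat \<times> nat \<Rightarrow> real) \<Rightarrow> state \<Rightarrow> nat \<Rightarrow> (nat \<times> nat \<Rightarrow> nat) \<Rightarrow> nat \<Rightarrow> nat \<Rightarrow> nat \<Rightarrow> query_algorithm" where
  "search_algorithm \<kappa> \<psi> t lo n k K = \<lparr>workspace = UNIV, initial = \<psi>,
     prog = iterate_query (kernel_operator \<kappa>)
       (Measure basis_measurement (\<lambda>m. locate n k K (lo (prod_decode m)))) t\<rparr>"

text \<open>Correctness never depends on the quantum part: every measured window is verified by
  classical queries, so the state influences only the cost. The failure mass is assumed to be small
  on finite sets of labels and passes to all outcomes through partial sums. The lower bound by
  \<open>t\<close> serves the two-sided asymptotics.\<close>

lemma search_algorithm_correct: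
  fixes n k K t :: nat and \<psi> :: state and lo :: "nat \<times> nat \<Rightarrow> nat"
  assumes \<kappa>: "orthogonal_kernel ({..<n} \<times> UNIV) \<kappa>"
    and \<psi>: "\<psi> \<in> hilbert_space n UNIV" "state_norm \<psi> = 1"
    and n: "1 \<le> n" "n \<le> 2 ^ K"
  defines "A \<equiv> search_algorithm \<kappa> \<psi> t lo n k K"
    and "final \<equiv> \<lambda>j. ((\<lambda>\<psi>. kernel_operator \<kappa> (phase_oracle (ordered_input j) \<psi>)) ^^ t) \<psi>"
  shows "zero_error_ordered_search n A"
    and "\<And>j. j < n \<Longrightarrow> ennreal (real t) \<le> expected_queries (ordered_input j) A"
    and "\<And>j \<delta>. j < n \<Longrightarrow> 0 \<le> \<delta> \<Longrightarrow>
      (\<And>B. finite B \<Longrightarrow> (\<And>p. p \<in> B \<Longrightarrow> \<not> (lo p \<le> j \<and> j < lo p + 2 ^ k)) \<Longrightarrow>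
        (\<Sum>p\<in>B. (cmod (final j p))\<^sup>2) \<le> \<delta>) \<Longrightarrow>
      expected_queries (ordered_input j) A \<le> ennreal (real t + 2 + real k + real K * \<delta>)"
proof -
  define w where "w = (\<lambda>j m. (cmod (final j (prod_decode m)))\<^sup>2)"
  define M where "M = (\<lambda>j. embed_pmf (w j))"
  define cost where "cost = (\<lambda>j m. t + locate_cost k K j (lo (prod_decode m)))"
  have final: "final j \<in> hilbert_space n UNIV" "state_norm (final j) = 1" for j
    using kernel_phase_iterate_norm[OF \<kappa> \<psi>(1)] \<psi>(2) unfolding final_def by auto
  have w_sums: "w j sums 1" for j
    using square_summable_sums[of "final j"] final[of j] by (simp add: w_def in_hilbert_space_iff)
  \<comment> \<open>\<open>embed_pmf\<close> has the given weights as its mass function once their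
    total is 1; this is the preservation of the norm during the evolution.\<close>
  have w_total: "(\<integral>\<^sup>+ m. ennreal (w j m) \<partial>count_space UNIV) = 1" for j
  proof -
    have "(\<integral>\<^sup>+ m. ennreal (w j m) \<partial>count_space UNIV) = (\<Sum>m. ennreal (w j m))"
      by (rule nn_integral_count_space_nat)
    also have "\<dots> = ennreal 1"
      using w_sums[of j] by (intro suminf_ennreal_eq) (auto simp: w_def)
    finally show ?thesis by simp
  qed
  have pmf_M: "pmf (M j) m = w j m" for j m
    unfolding M_def by (rule pmf_embed_pmf) (use w_total in \<open>auto simp: w_def\<close>)
  have exec: "execute (ordered_input j) A = spmf_of_pmf (map_pmf (\<lambda>m. (j, cost j m)) (M j))"
    if j: "j < n" for j
  proof -
    have "execute (ordered_input j) A = map_spmf (map_prod id ((+) t))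
        (bind_spmf (spmf_of_pmf (M j)) (\<lambda>m. return_spmf (j, locate_cost k K j (lo (prod_decode m)))))"
      unfolding execute_def A_def search_algorithm_def M_def w_def final_def
      by (simp add: run_iterate_query run_Measure run_locate[OF j n(2)] state_norm_basis_measurement)
    also have "\<dots> = bind_spmf (spmf_of_pmf (M j)) (\<lambda>m. return_spmf (j, cost j m))"
      unfolding map_spmf_bind_spmf o_def by (simp add: cost_def)
    also have "\<dots> = map_spmf (\<lambda>m. (j, cost j m)) (spmf_of_pmf (M j))"
      by (rule map_spmf_conv_bind_spmf[symmetric])
    finally show ?thesis by simp
  qed
  have "valid_program n (hilbert_space n UNIV) (iterate_query (kernel_operator \<kappa>)
      (Measure basis_measurement (\<lambda>m. locate n k K (lo (prod_decode m)))) t)"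
    by (rule valid_iterate_query[OF kernel_unitary[OF \<kappa>]])
      (intro valid_program.intros projective_basis_measurement valid_locate n)
  then have valid: "valid_algorithm n A"
    using \<psi> by (simp add: valid_algorithm_def A_def search_algorithm_def)
  show "zero_error_ordered_search n A"
    unfolding zero_error_ordered_search_def using valid exec by auto
  have expect: "expected_queries (ordered_input j) A = (\<integral>\<^sup>+ m. ennreal (real (cost j m)) \<partial>measure_pmf (M j))"
    if "j < n" for j
    unfolding expected_queries_def exec[OF that] by (simp add: measure_spmf_spmf_of_pmf)
  show "ennreal (real t) \<le> expected_queries (ordered_input j) A" if "j < n" for j
  proof -
    have "ennreal (real t) = (\<integral>\<^sup>+ m. ennreal (real t) \<partial>measure_pmf (M j))" by simp
    also have "\<dots> \<le> (\<integral>\<^sup>+ m. ennreal (real (cost j m)) \<partial>measure_pmf (M j))"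
      by (intro nn_integral_mono ennreal_leI) (simp add: cost_def)
    finally show ?thesis by (simp add: expect[OF that])
  qed
  show "expected_queries (ordered_input j) A \<le> ennreal (real t + 2 + real k + real K * \<delta>)"
    if j: "j < n" and \<delta>: "0 \<le> \<delta>"
      and fail: "\<And>B. finite B \<Longrightarrow> (\<And>p. p \<in> B \<Longrightarrow> \<not> (lo p \<le> j \<and> j < lo p + 2 ^ k)) \<Longrightarrow>
        (\<Sum>p\<in>B. (cmod (final j p))\<^sup>2) \<le> \<delta>" for j \<delta>
  proof -
    define bad where "bad = (\<lambda>m. \<not> (lo (prod_decode m) \<le> j \<and> j < lo (prod_decode m) + 2 ^ k))"
    have partial: "(\<Sum>m<N. of_bool (bad m) * w j m) \<le> \<delta>" for N
    proof -
      have "(\<Sum>m<N. of_bool (bad m) * w j m) = (\<Sum>m\<in>{m. m < N \<and> bad m}. w j m)"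
        by (rule sum.mono_neutral_cong_right) auto
      also have "\<dots> = (\<Sum>p\<in>prod_decode ` {m. m < N \<and> bad m}. (cmod (final j p))\<^sup>2)"
        by (subst sum.reindex) (auto simp: w_def inj_prod_decode)
      also have "\<dots> \<le> \<delta>" by (rule fail) (auto simp: bad_def)
      finally show ?thesis .
    qed
    have "(\<integral>\<^sup>+ m. ennreal (of_bool (bad m)) \<partial>measure_pmf (M j)) = (\<integral>\<^sup>+ m. ennreal (of_bool (bad m) * w j m) \<partial>count_space UNIV)"
      by (simp add: nn_integral_measure_pmf pmf_M ennreal_mult'[symmetric] mult.commute w_def)
    also have "\<dots> = (\<Sum>m. ennreal (of_bool (bad m) * w j m))" by (rule nn_integral_count_space_nat)
    also have "\<dots> \<le> ennreal \<delta>"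
    proof (rule suminf_le_const)
      fix N
      have "(\<Sum>m<N. ennreal (of_bool (bad m) * w j m)) = ennreal (\<Sum>m<N. of_bool (bad m) * w j m)"
        by (rule sum_ennreal) (simp add: w_def)
      then show "(\<Sum>m<N. ennreal (of_bool (bad m) * w j m)) \<le> ennreal \<delta>"
        using partial[of N] by (simp add: ennreal_leI)
    qed (rule summableI)
    finally have bad_prob: "(\<integral>\<^sup>+ m. ennreal (of_bool (bad m)) \<partial>measure_pmf (M j)) \<le> ennreal \<delta>" .
    have "expected_queries (ordered_input j) A \<le>
        (\<integral>\<^sup>+ m. ennreal (real t + 2 + real k) + ennreal (real K) * ennreal (of_bool (bad m)) \<partial>measure_pmf (M j))"
      unfolding expect[OF j]
      by (intro nn_integral_mono)
        (auto simp: cost_def locate_cost_def bad_def ennreal_mult'[symmetric] ennreal_plus[symmetric]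
          simp del: ennreal_plus intro!: ennreal_leI)
    also have "\<dots> = ennreal (real t + 2 + real k)
        + ennreal (real K) * (\<integral>\<^sup>+ m. ennreal (of_bool (bad m)) \<partial>measure_pmf (M j))"
      by (subst nn_integral_add) (auto simp: nn_integral_cmult)
    also have "\<dots> \<le> ennreal (real t + 2 + real k) + ennreal (real K) * ennreal \<delta>"
      using bad_prob by (intro add_left_mono mult_left_mono) auto
    also have "\<dots> = ennreal (real t + 2 + real k + real K * \<delta>)"
      using \<delta> by (simp add: ennreal_mult'[symmetric] ennreal_plus[symmetric] del: ennreal_plus)
    finally show ?thesis .
  qed
qed

section \<open>The lattice inside the state space\<close>

text \<open>The lattice site \<open>a\<close> is the query label \<open>a\<close> when \<open>0 \<le> a < n - 1\<close>. All other sites use the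
  label \<open>n - 1\<close>, whose bit is 1 for every input; for \<open>a < 0\<close> the wrong sign this produces is
  compensated in the kernel below.\<close>

definition site :: "nat \<Rightarrow> int \<Rightarrow> nat \<times> nat" where
  "site n a = (if 0 \<le> a \<and> a < int n - 1 then (nat a, 0) else (n - 1, int_encode a))"

definition position :: "nat \<Rightarrow> nat \<times> nat \<Rightarrow> int" where
  "position n p = (if fst p < n - 1 then int (fst p) else int_decode (snd p))"

definition lattice_kernel :: "nat \<Rightarrow> nat \<times> nat \<Rightarrow> nat \<times> nat \<Rightarrow> real" where
  "lattice_kernel n p q =
    (if p \<in> range (site n) \<and> q \<in> range (site n)
     then hilbert_kernel (position n p - position n q) * (if position n q < 0 then - 1 else 1)
     else of_bool (p = q \<and> p \<in> {..<n} \<times> UNIV))"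

definition lift_state :: "nat \<Rightarrow> (int \<Rightarrow> real) \<Rightarrow> state" where
  "lift_state n \<phi> p = (if p \<in> range (site n) then of_real (\<phi> (position n p)) else 0)"

lemma position_site [simp]: "position n (site n a) = a"
  by (auto simp: position_def site_def)

lemma inj_site: "inj (site n)"
  by (rule inj_on_inverseI[of _ "position n"]) simp

lemma site_in_space: "1 \<le> n \<Longrightarrow> site n a \<in> {..<n} \<times> UNIV"
  by (auto simp: site_def)

lemma has_sum_site:
  assumes "((\<lambda>a. f (site n a)) has_sum s) UNIV" "\<And>p. p \<notin> range (site n) \<Longrightarrow> f p = 0"
  shows "(f has_sum s) UNIV"
proof -
  have "(f has_sum s) (range (site n))"
    using assms(1) by (subst has_sum_reindex[OF inj_site]) (simp add: o_def)
  then show ?thesis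
    by (rule has_sum_cong_neutral[THEN iffD1, rotated -1]) (use assms(2) in auto)
qed

section \<open>The query step on the lattice\<close>

lemma hilbert_kernel_rows:
  "((\<lambda>b. hilbert_kernel (a - b) * hilbert_kernel (a' - b)) has_sum of_bool (a = a')) UNIV"
proof (cases "a = a'")
  case True
  then show ?thesis using hilbert_kernel_reflect_square_has_sum[of a] by (simp add: power2_eq_square)
next
  case False
  have "bij_betw (\<lambda>b. a - b) UNIV UNIV"
    by (rule bij_betw_byWitness[where f' = "\<lambda>m. a - m"]) auto
  from has_sum_reindex_bij_betw[OF this, of "\<lambda>m. hilbert_kernel m * hilbert_kernel (m + (a' - a))"]
    hilbert_kernel_shift_orthogonal[of "a' - a"] False
  show ?thesis by simp
qed

lemma hilbert_kernel_columns:
  "((\<lambda>a. hilbert_kernel (a - b) * hilbert_kernel (a - b')) has_sum of_bool (b = b')) UNIV"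
proof -
  have bij: "bij_betw (\<lambda>a. a - b) UNIV UNIV"
    by (rule bij_betw_byWitness[where f' = "\<lambda>m. m + b"]) auto
  show ?thesis
  proof (cases "b = b'")
    case True
    with has_sum_reindex_bij_betw[OF bij, of "\<lambda>m. (hilbert_kernel m)\<^sup>2"] hilbert_kernel_square_has_sum
    show ?thesis by (simp add: power2_eq_square)
  next
    case False
    with has_sum_reindex_bij_betw[OF bij, of "\<lambda>m. hilbert_kernel m * hilbert_kernel (m + (b - b'))"]
      hilbert_kernel_shift_orthogonal[of "b - b'"]
    show ?thesis by simp
  qed
qed

text \<open>The sign attached to a column squares to 1 along the rows; between two distinct columns
  the signs only multiply a sum that is 0.\<close>

lemma orthogonal_lattice_kernel:
  assumes n: "1 \<le> n"
  shows "orthogonal_kernel ({..<n} \<times> UNIV) (lattice_kernel n)"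
  unfolding orthogonal_kernel_def
proof (intro conjI allI impI ballI)
  fix p q assume "lattice_kernel n p q \<noteq> 0"
  then show "p \<in> {..<n} \<times> UNIV" "q \<in> {..<n} \<times> UNIV"
    using site_in_space[OF n] by (auto simp: lattice_kernel_def split: if_splits)
next
  fix p p' assume D: "p \<in> {..<n} \<times> (UNIV :: nat set)" "p' \<in> {..<n} \<times> (UNIV :: nat set)"
  let ?s = "\<lambda>b::int. if b < 0 then - 1 else (1 :: real)"
  have s2: "?s b * ?s b = 1" for b by simp
  show "((\<lambda>q. lattice_kernel n p q * lattice_kernel n p' q) has_sum of_bool (p = p')) UNIV"
  proof (cases "p \<in> range (site n) \<and> p' \<in> range (site n)")
    case True
    then obtain a a' where a: "p = site n a" "p' = site n a'" by blast
    have "((\<lambda>b. hilbert_kernel (a - b) * hilbert_kernel (a' - b)) has_sum of_bool (p = p')) UNIV"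
      using hilbert_kernel_rows[of a a'] inj_site[of n] by (simp add: a inj_eq)
    moreover have "lattice_kernel n p (site n b) * lattice_kernel n p' (site n b)
        = hilbert_kernel (a - b) * hilbert_kernel (a' - b)" for b
    proof -
      have "lattice_kernel n p (site n b) * lattice_kernel n p' (site n b)
          = hilbert_kernel (a - b) * hilbert_kernel (a' - b) * (?s b * ?s b)"
        by (simp add: lattice_kernel_def a)
      then show ?thesis by (simp only: s2 mult_1_right)
    qed
    ultimately have "((\<lambda>b. lattice_kernel n p (site n b) * lattice_kernel n p' (site n b))
        has_sum of_bool (p = p')) UNIV" by (simp only:)
    then show ?thesis
    proof (rule has_sum_site)
      fix q assume "q \<notin> range (site n)"
      moreover from this have "p \<noteq> q" using True by auto
      ultimately show "lattice_kernel n p q * lattice_kernel n p' q = 0" by (simp add: lattice_kernel_def)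
    qed
  next
    case False
    \<comment> \<open>A row outside the lattice is a unit vector, so the product of two rows has at
      most one candidate for a nonzero term: \<open>p\<close> itself, or \<open>p'\<close> if only
      \<open>p'\<close> is outside.\<close>
    then show ?thesis
      using D by (intro has_sum_finite_neutralI[of "if p \<in> range (site n) then {p'} else {p}"])
        (auto simp: lattice_kernel_def)
  qed
next
  fix q q' assume D: "q \<in> {..<n} \<times> (UNIV :: nat set)" "q' \<in> {..<n} \<times> (UNIV :: nat set)"
  let ?s = "\<lambda>b::int. if b < 0 then - 1 else (1 :: real)"
  have s2: "?s b * ?s b = 1" for b by simp
  show "((\<lambda>p. lattice_kernel n p q * lattice_kernel n p q') has_sum of_bool (q = q')) UNIV"
  proof (cases "q \<in> range (site n) \<and> q' \<in> range (site n)")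
    case True
    then obtain b b' where b: "q = site n b" "q' = site n b'" by blast
    have "((\<lambda>a. ?s b * ?s b' * (hilbert_kernel (a - b) * hilbert_kernel (a - b'))) has_sum
        ?s b * ?s b' * of_bool (b = b')) UNIV"
      by (intro has_sum_cmult_right hilbert_kernel_columns)
    moreover have "?s b * ?s b' * of_bool (b = b') = (of_bool (q = q') :: real)"
      using inj_site[of n] by (auto simp: b inj_eq)
    moreover have "lattice_kernel n (site n a) q * lattice_kernel n (site n a) q'
        = ?s b * ?s b' * (hilbert_kernel (a - b) * hilbert_kernel (a - b'))" for a
      by (simp add: lattice_kernel_def b)
    ultimately show ?thesis by (intro has_sum_site) (auto simp: lattice_kernel_def b)
  next
    case False
    then show ?thesis
      using D by (intro has_sum_finite_neutralI[of "if q \<in> range (site n) then {q'} else {q}"])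
        (auto simp: lattice_kernel_def)
  qed
qed

text \<open>The oracle phase at site b is - 1 for b < 0 and for b \<ge> j, and the sign in the
  kernel flips it for b < 0. The product is + 1 for b < j and - 1 for b \<ge> j on all of the
  integers, which is minus the sign function seen from the answer; hence the minus in front of the
  sum.\<close>

lemma kernel_lift_state:
  assumes n: "1 \<le> n" and j: "j < n"
    and summ: "\<And>a. (\<lambda>b. hilbert_kernel (a - b) * ((if b < int j then - 1 else 1) * \<phi> b)) summable_on UNIV"
  shows "kernel_operator (lattice_kernel n) (phase_oracle (ordered_input j) (lift_state n \<phi>))
    = lift_state n (\<lambda>a. - (\<Sum>\<^sub>\<infinity>b. hilbert_kernel (a - b) * ((if b < int j then - 1 else 1) * \<phi> b)))"
proof
  fix p
  let ?o = "phase_oracle (ordered_input j) (lift_state n \<phi>)"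
  have zero: "?o q = 0" if "q \<notin> range (site n)" for q
    using that by (cases q) (simp add: phase_oracle_def lift_state_def)
  show "kernel_operator (lattice_kernel n) ?o p =
    lift_state n (\<lambda>a. - (\<Sum>\<^sub>\<infinity>b. hilbert_kernel (a - b) * ((if b < int j then - 1 else 1) * \<phi> b))) p"
  proof (cases "p \<in> range (site n)")
    case True
    then obtain a where a: "p = site n a" by blast
    have summand: "of_real (lattice_kernel n p (site n b)) * ?o (site n b)
        = complex_of_real (- (hilbert_kernel (a - b) * ((if b < int j then - 1 else 1) * \<phi> b)))" for b
    proof -
      have "?o (site n b) = (- 1) ^ of_bool (ordered_input j (fst (site n b))) * complex_of_real (\<phi> b)"
      proof -
        have "phase_oracle x \<psi> q = (- 1) ^ of_bool (x (fst q)) * \<psi> q" for x \<psi> q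
          by (cases q) (simp add: phase_oracle_def)
        then show ?thesis by (simp add: lift_state_def)
      qed
      moreover have "ordered_input j (fst (site n b)) \<longleftrightarrow> b < 0 \<or> int j \<le> b"
        using j by (auto simp: ordered_input_def site_def)
      ultimately show ?thesis by (auto simp: lattice_kernel_def a)
    qed
    have "((\<lambda>b. complex_of_real (- (hilbert_kernel (a - b) * ((if b < int j then - 1 else 1) * \<phi> b))))
        has_sum of_real (- (\<Sum>\<^sub>\<infinity>b. hilbert_kernel (a - b) * ((if b < int j then - 1 else 1) * \<phi> b)))) UNIV"
      by (intro has_sum_of_real has_sum_uminusI has_sum_infsum summ)
    then have "((\<lambda>q. of_real (lattice_kernel n p q) * ?o q)
        has_sum of_real (- (\<Sum>\<^sub>\<infinity>b. hilbert_kernel (a - b) * ((if b < int j then - 1 else 1) * \<phi> b)))) UNIV"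
    proof (intro has_sum_site[of _ n])
      fix q assume "q \<notin> range (site n)"
      then have "?o q = 0" by (rule zero)
      then show "of_real (lattice_kernel n p q) * ?o q = 0" by (simp only: mult_zero_right)
    qed (simp only: summand)
    then show ?thesis
      unfolding kernel_operator_def by (simp add: infsumI lift_state_def a)
  next
    case False
    then have "of_real (lattice_kernel n p q) * ?o q = 0" for q
      using zero[of q] by (cases "q \<in> range (site n)") (auto simp: lattice_kernel_def)
    then have "kernel_operator (lattice_kernel n) ?o p = 0"
      unfolding kernel_operator_def by (simp only: infsum_0_simp)
    then show ?thesis using False by (simp add: lift_state_def)
  qed
qed

lemma lift_state_bound:
  assumes "\<And>A. finite A \<Longrightarrow> (\<Sum>a\<in>A. (\<phi> a)\<^sup>2) \<le> B\<^sup>2" "0 \<le> B"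
  shows "square_summable (lift_state n \<phi>)" and "state_norm (lift_state n \<phi>) \<le> B"
proof -
  have "(\<Sum>p\<in>P. (cmod (lift_state n \<phi> p))\<^sup>2) \<le> B\<^sup>2" if P: "finite P" for P
  proof -
    have "(\<Sum>p\<in>P. (cmod (lift_state n \<phi> p))\<^sup>2) = (\<Sum>p\<in>P \<inter> range (site n). (\<phi> (position n p))\<^sup>2)"
      using P by (intro sum.mono_neutral_cong_right) (auto simp: lift_state_def)
    also have "\<dots> = (\<Sum>a\<in>position n ` (P \<inter> range (site n)). (\<phi> a)\<^sup>2)"
    proof -
      have "inj_on (position n) (P \<inter> range (site n))" by (rule inj_on_inverseI[of _ "site n"]) auto
      then show ?thesis by (simp add: sum.reindex)
    qed
    also have "\<dots> \<le> B\<^sup>2" using P by (intro assms) auto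
    finally show ?thesis .
  qed
  from square_summableI_finite[of "lift_state n \<phi>", OF this assms(2)]
  show "square_summable (lift_state n \<phi>)" and "state_norm (lift_state n \<phi>) \<le> B" by auto
qed

lemma lift_state_norm:
  assumes "((\<lambda>a. (\<phi> a)\<^sup>2) has_sum s) UNIV"
  shows "(state_norm (lift_state n \<phi>))\<^sup>2 = s"
proof -
  have "((\<lambda>p. (cmod (lift_state n \<phi> p))\<^sup>2) has_sum s) UNIV"
    by (rule has_sum_site[of _ n]) (use assms in \<open>auto simp: lift_state_def\<close>)
  then have "state_norm (lift_state n \<phi>) = sqrt s" by (simp add: state_norm_def infsumI)
  moreover have "0 \<le> s" by (rule has_sum_nonneg[OF assms]) simp
  ultimately show ?thesis by simp
qed

lemma lift_state_diff: "lift_state n \<phi> p - lift_state n \<psi> p = lift_state n (\<lambda>a. \<phi> a - \<psi> a) p"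
  by (simp add: lift_state_def)

lemma phase_oracle_norm:
  assumes "square_summable \<psi>"
  shows "square_summable (phase_oracle x \<psi>)" and "state_norm (phase_oracle x \<psi>) = state_norm \<psi>"
proof -
  have "cmod (phase_oracle x \<psi> p) = cmod (\<psi> p)" for p
    by (cases p) (simp add: phase_oracle_def norm_mult norm_power)
  then show "square_summable (phase_oracle x \<psi>)" and "state_norm (phase_oracle x \<psi>) = state_norm \<psi>"
    using assms by (simp_all add: state_norm_def square_summable_def)
qed

lemma phase_oracle_diff:
  "phase_oracle x (\<lambda>p. \<phi> p - \<psi> p) = (\<lambda>p. phase_oracle x \<phi> p - phase_oracle x \<psi> p)"
  by (auto simp: phase_oracle_def fun_eq_iff right_diff_distrib)

lemma phase_oracle_scale: "phase_oracle x (\<lambda>p. c * \<psi> p) = (\<lambda>p. c * phase_oracle x \<psi> p)"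
  by (auto simp: phase_oracle_def fun_eq_iff)

section \<open>Packets as states and their evolution\<close>

text \<open>The parameter \<open>j\<close> is the site of the answer. The algorithm prepares the
  state with \<open>j\<close> = 0; states with the true \<open>j\<close> occur only in the
  analysis.\<close>

definition packet_state :: "nat \<Rightarrow> nat \<Rightarrow> real \<Rightarrow> real \<Rightarrow> state" where
  "packet_state n j \<sigma> c = lift_state n (\<lambda>a. packet \<sigma> c (of_int (a - int j) + 1 / 2))"

lemma sum_translate_int: "(\<Sum>a\<in>A. f (a - d)) = (\<Sum>a\<in>(\<lambda>a. a - d) ` A. f a)" for d :: int
  by (subst sum.reindex) (auto simp: inj_on_def)

lemma square_summable_packet_state:
  assumes "0 < \<sigma>" "\<sigma> \<le> 1 / 2"
  shows "square_summable (packet_state n j \<sigma> c)"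
  unfolding packet_state_def
proof (rule lift_state_bound(1))
  fix A :: "int set" assume A: "finite A"
  have "(\<Sum>a\<in>A. (packet \<sigma> c (of_int (a - int j) + 1 / 2))\<^sup>2) \<le> 8 / \<sigma>"
    unfolding sum_translate_int[of "\<lambda>a. (packet \<sigma> c (of_int a + 1 / 2))\<^sup>2"]
    by (rule packet_int_sum_le[OF assms]) (use A in simp)
  then show "(\<Sum>a\<in>A. (packet \<sigma> c (of_int (a - int j) + 1 / 2))\<^sup>2) \<le> (sqrt (8 / \<sigma>))\<^sup>2"
    using assms by simp
qed (use assms in simp)

lemma state_norm_packet_state:
  assumes "0 < \<sigma>" "\<sigma> \<le> 1 / 2" "0 \<le> c"
  shows "2 / \<sigma> \<le> (state_norm (packet_state n 0 \<sigma> c))\<^sup>2"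
proof -
  let ?f = "\<lambda>a::int. (packet \<sigma> c (of_int a + 1 / 2))\<^sup>2"
  have "(?f has_sum infsum ?f UNIV) UNIV"
    using packet_int_square_has_sum[OF assms(1,2), of c] by (auto simp: infsumI)
  from lift_state_norm[of "\<lambda>a. packet \<sigma> c (of_int a + 1 / 2)", OF this, of n]
    packet_int_square_sum_ge[OF assms]
  show ?thesis by (simp add: packet_state_def)
qed

lemma packet_state_translate:
  assumes "0 < \<sigma>" "\<sigma> \<le> 1 / 2" "j < n"
  shows "square_summable (\<lambda>p. packet_state n 0 \<sigma> c p - packet_state n j \<sigma> c p)"
    and "state_norm (\<lambda>p. packet_state n 0 \<sigma> c p - packet_state n j \<sigma> c p)
      \<le> sqrt (64 / \<sigma> * exp (2 * \<sigma> * (ln (3 * real n) - c)))"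
proof -
  let ?d = "\<lambda>a. packet \<sigma> c (of_int (a - int 0) + 1 / 2) - packet \<sigma> c (of_int (a - int j) + 1 / 2)"
  have "(\<Sum>a\<in>A. (?d a)\<^sup>2) \<le> (sqrt (64 / \<sigma> * exp (2 * \<sigma> * (ln (3 * real n) - c))))\<^sup>2" if "finite A" for A
    using packet_translate[OF assms that, of c] assms by (simp add: power2_commute)
  from lift_state_bound[of ?d, OF this, of n] assms
  show "square_summable (\<lambda>p. packet_state n 0 \<sigma> c p - packet_state n j \<sigma> c p)"
    and "state_norm (\<lambda>p. packet_state n 0 \<sigma> c p - packet_state n j \<sigma> c p)
      \<le> sqrt (64 / \<sigma> * exp (2 * \<sigma> * (ln (3 * real n) - c)))"
    unfolding packet_state_def lift_state_diff by simp_all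
qed

definition search_step :: "nat \<Rightarrow> nat \<Rightarrow> state \<Rightarrow> state" where
  "search_step n j \<psi> = kernel_operator (lattice_kernel n) (phase_oracle (ordered_input j) \<psi>)"

text \<open>The constants are uniform in n, j, \<sigma> and c, so they are fixed before the
  parameters are chosen as functions of n. The packet is not normalized here.\<close>

definition step_bounds :: "real \<Rightarrow> real \<Rightarrow> bool" where
  "step_bounds C Z \<longleftrightarrow> 0 < C \<and> 0 \<le> Z \<and> (\<forall>\<sigma> c n j. 0 < \<sigma> \<longrightarrow> \<sigma> \<le> 1 / 16 \<longrightarrow> j < n \<longrightarrow>
     state_norm (\<lambda>p. search_step n j (packet_state n j \<sigma> c) p - packet_state n j \<sigma> (c - pi) p)
       \<le> C * sqrt (16 * \<sigma> ^ 3 + Z * exp (- 2 * \<sigma> * c)))"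

text \<open>The kernel is translation invariant and the sign function moves with the answer, so
  subtracting j from all sites reduces the pointwise estimate to an answer at the origin; squares
  are then summed.\<close>

lemma step_bounds_exist: "\<exists>C Z. step_bounds C Z"
proof -
  obtain C where C: "0 < C"
    "\<And>\<sigma> c a. 0 < \<sigma> \<Longrightarrow> \<sigma> \<le> 1 / 16 \<Longrightarrow>
      \<bar>- (\<Sum>\<^sub>\<infinity>b. hilbert_kernel (a - b) * ((if b < 0 then - 1 else 1) * packet \<sigma> c (of_int b + 1 / 2)))
        - packet \<sigma> (c - pi) (of_int a + 1 / 2)\<bar>
      \<le> C * (\<sigma>\<^sup>2 + \<bar>of_int a + 1 / 2\<bar> powr (- 1 / 4)) * packet \<sigma> c (of_int a + 1 / 2)"
    using packet_step by blast
  obtain Z where Z: "0 \<le> Z"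
    "\<And>\<sigma> c A. 0 < \<sigma> \<Longrightarrow> \<sigma> \<le> 1 / 16 \<Longrightarrow> finite A \<Longrightarrow>
      (\<Sum>a\<in>A. ((\<sigma>\<^sup>2 + \<bar>of_int a + 1 / 2\<bar> powr (- 1 / 4)) * packet \<sigma> c (of_int a + 1 / 2))\<^sup>2)
        \<le> 16 * \<sigma> ^ 3 + Z * exp (- 2 * \<sigma> * c)"
    using packet_weighted_sum by blast
  have "state_norm (\<lambda>p. search_step n j (packet_state n j \<sigma> c) p - packet_state n j \<sigma> (c - pi) p)
       \<le> C * sqrt (16 * \<sigma> ^ 3 + Z * exp (- 2 * \<sigma> * c))"
    if \<sigma>: "0 < \<sigma>" "\<sigma> \<le> 1 / 16" and j: "j < n" for \<sigma> c n j
  proof -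
    define t where "t = (\<lambda>a b. hilbert_kernel (a - b) * ((if b < 0 then - 1 else 1) * packet \<sigma> c (of_int b + 1 / 2)))"
    define e where "e = (\<lambda>a. - infsum (t a) UNIV - packet \<sigma> (c - pi) (of_int a + 1 / 2))"
    have bij: "bij_betw (\<lambda>b. b - int j) UNIV UNIV"
      by (rule bij_betw_byWitness[where f' = "\<lambda>m. m + int j"]) auto
    have t_summ: "t a summable_on UNIV" for a
      unfolding t_def by (rule packet_hilbert_pairs(1)) (use \<sigma> in auto)
    have shift: "hilbert_kernel (a - b) * ((if b < int j then - 1 else 1) * packet \<sigma> c (of_int (b - int j) + 1 / 2))
        = t (a - int j) (b - int j)" for a b
      by (simp add: t_def)
    have "(\<lambda>b. t (a - int j) (b - int j)) summable_on UNIV" for a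
      using t_summ summable_on_reindex_bij_betw[OF bij, of "t (a - int j)"] by simp
    then have "search_step n j (packet_state n j \<sigma> c)
        = lift_state n (\<lambda>a. - (\<Sum>\<^sub>\<infinity>b. t (a - int j) (b - int j)))"
      unfolding search_step_def packet_state_def
      using kernel_lift_state[of n j "\<lambda>a. packet \<sigma> c (of_int (a - int j) + 1 / 2)", unfolded shift] j by simp
    also have "(\<lambda>a. - (\<Sum>\<^sub>\<infinity>b. t (a - int j) (b - int j))) = (\<lambda>a. - infsum (t (a - int j)) UNIV)"
      by (simp only: infsum_reindex_bij_betw[OF bij])
    finally have eq: "(\<lambda>p. search_step n j (packet_state n j \<sigma> c) p - packet_state n j \<sigma> (c - pi) p)
        = lift_state n (\<lambda>a. e (a - int j))"
      by (auto simp: packet_state_def lift_state_diff e_def fun_eq_iff)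
    show ?thesis
      unfolding eq
    proof (rule lift_state_bound(2))
      fix A :: "int set" assume A: "finite A"
      let ?w = "\<lambda>a::int. (\<sigma>\<^sup>2 + \<bar>of_int a + 1 / 2\<bar> powr (- 1 / 4)) * packet \<sigma> c (of_int a + 1 / 2)"
      have e_le: "(e a)\<^sup>2 \<le> C\<^sup>2 * (?w a)\<^sup>2" for a
      proof -
        have "\<bar>e a\<bar> \<le> C * ?w a"
          using C(2)[OF \<sigma>, of a c] unfolding e_def t_def by (simp only: mult.assoc)
        then have "\<bar>e a\<bar>\<^sup>2 \<le> (C * ?w a)\<^sup>2" by (intro power_mono) auto
        then show ?thesis by (simp only: power2_abs power_mult_distrib[of C "?w a"])
      qed
      have "(\<Sum>a\<in>A. (e (a - int j))\<^sup>2) = (\<Sum>a\<in>(\<lambda>a. a - int j) ` A. (e a)\<^sup>2)"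
        by (rule sum_translate_int)
      also have "\<dots> \<le> (\<Sum>a\<in>(\<lambda>a. a - int j) ` A. C\<^sup>2 * (?w a)\<^sup>2)" by (intro sum_mono e_le)
      also have "\<dots> = C\<^sup>2 * (\<Sum>a\<in>(\<lambda>a. a - int j) ` A. (?w a)\<^sup>2)" by (rule sum_distrib_left[symmetric])
      also have "\<dots> \<le> C\<^sup>2 * (16 * \<sigma> ^ 3 + Z * exp (- 2 * \<sigma> * c))"
        using A by (intro mult_left_mono Z(2) \<sigma>) auto
      also have "\<dots> = (C * sqrt (16 * \<sigma> ^ 3 + Z * exp (- 2 * \<sigma> * c)))\<^sup>2"
        using \<sigma> Z(1) by (simp add: power_mult_distrib)
      finally show "(\<Sum>a\<in>A. (e (a - int j))\<^sup>2) \<le> (C * sqrt (16 * \<sigma> ^ 3 + Z * exp (- 2 * \<sigma> * c)))\<^sup>2" .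
    qed (use C(1) \<sigma> Z(1) in simp)
  qed
  then show ?thesis unfolding step_bounds_def using C(1) Z(1) by blast
qed

lemma square_summable_search_step:
  assumes "1 \<le> n" "square_summable \<psi>"
  shows "square_summable (search_step n j \<psi>)" and "state_norm (search_step n j \<psi>) \<le> state_norm \<psi>"
  using kernel_contraction[OF orthogonal_lattice_kernel[OF assms(1)] phase_oracle_norm(1)[OF assms(2)]]
    phase_oracle_norm(2)[OF assms(2)] by (simp_all add: search_step_def)

lemma search_step_diff:
  assumes "1 \<le> n" "square_summable \<phi>" "square_summable \<psi>"
  shows "search_step n j (\<lambda>p. \<phi> p - \<psi> p) = (\<lambda>p. search_step n j \<phi> p - search_step n j \<psi> p)"
  unfolding search_step_def phase_oracle_diff
  by (rule kernel_operator_diff[OF orthogonal_lattice_kernel[OF assms(1)]])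
    (use assms phase_oracle_norm in auto)

lemma search_step_scale: "search_step n j (\<lambda>p. c * \<psi> p) = (\<lambda>p. c * search_step n j \<psi> p)"
  unfolding search_step_def phase_oracle_scale kernel_operator_scale ..

text \<open>A step is linear and does not increase norms, so errors only add up: \<open>D\<close>
  from centering the initial packet at the answer, and \<open>G\<close> from each step. The squared
  normalizing factor, at most \<sigma> / 2, turns the 16 \<sigma>^3 of one step into 8 \<sigma>^4.
  The initial center pi T + b is the one that ends at b after T shifts by pi.\<close>

lemma search_state_close:
  fixes n j T :: nat and \<sigma> b C Z :: real
  assumes CZ: "step_bounds C Z" and \<sigma>: "0 < \<sigma>" "\<sigma> \<le> 1 / 16" and j: "j < n"
    and b: "0 \<le> b" and T: "ln (3 * real n) \<le> pi * real T"
  defines "c \<equiv> pi * real T + b"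
  defines "r \<equiv> complex_of_real (1 / state_norm (packet_state n 0 \<sigma> c))"
  shows "square_summable ((search_step n j ^^ T) (\<lambda>p. r * packet_state n 0 \<sigma> c p))"
    and "(state_norm (\<lambda>p. (search_step n j ^^ T) (\<lambda>p. r * packet_state n 0 \<sigma> c p) p
      - r * packet_state n j \<sigma> b p))\<^sup>2
    \<le> 64 * exp (- 2 * \<sigma> * b) + 2 * (real T)\<^sup>2 * C\<^sup>2 * (8 * \<sigma> ^ 4 + Z * exp (- 2 * \<sigma> * b))"
    and "(cmod r)\<^sup>2 \<le> \<sigma> / 2"
    and "state_norm (\<lambda>p. r * packet_state n 0 \<sigma> c p) = 1"
proof -
  define N where "N = state_norm (packet_state n 0 \<sigma> c)"
  have \<sigma>': "\<sigma> \<le> 1 / 2" using \<sigma> by simp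
  have n: "1 \<le> n" using j by simp
  have C: "0 < C" "0 \<le> Z" using CZ by (auto simp: step_bounds_def)
  have c0: "0 \<le> c" using b by (simp add: c_def)
  have N2: "2 / \<sigma> \<le> N\<^sup>2" unfolding N_def by (rule state_norm_packet_state[OF \<sigma>(1) \<sigma>' c0])
  have "0 < 2 / \<sigma>" using \<sigma> by simp
  then have "N \<noteq> 0" using N2 by auto
  then have N: "0 < N" using state_norm_nonneg[of "packet_state n 0 \<sigma> c"] by (simp add: N_def)
  have r: "r = of_real (1 / N)" "cmod r = 1 / N" using N by (auto simp: r_def N_def norm_divide)
  have r2: "(1 / N)\<^sup>2 \<le> \<sigma> / 2"
  proof -
    have "1 / N\<^sup>2 \<le> 1 / (2 / \<sigma>)" using N2 \<sigma> N by (intro divide_left_mono) auto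
    then show ?thesis by (simp add: power_divide)
  qed
  then show "(cmod r)\<^sup>2 \<le> \<sigma> / 2" by (simp only: r(2))
  show "state_norm (\<lambda>p. r * packet_state n 0 \<sigma> c p) = 1"
    unfolding state_norm_scale r(2) using N by (simp add: N_def)
  define \<psi> where "\<psi> = (\<lambda>s. (search_step n j ^^ s) (\<lambda>p. r * packet_state n 0 \<sigma> c p))"
  define \<Phi> where "\<Phi> = (\<lambda>s p. r * packet_state n j \<sigma> (c - pi * real s) p)"
  define D G where "D = sqrt (32 * exp (- 2 * \<sigma> * b))"
    and "G = C * sqrt (8 * \<sigma> ^ 4 + Z * exp (- 2 * \<sigma> * b))"
  have \<Phi>_sq: "square_summable (\<Phi> s)" for s
    unfolding \<Phi>_def by (rule square_summable_scale[OF square_summable_packet_state[OF \<sigma>(1) \<sigma>']])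
  have \<psi>_sq: "square_summable (\<psi> s)" for s
  proof (induction s)
    case 0
    show ?case unfolding \<psi>_def
      using square_summable_scale[OF square_summable_packet_state[OF \<sigma>(1) \<sigma>']] by simp
  next
    case (Suc s)
    then show ?case using square_summable_search_step(1)[OF n, of "\<psi> s"] by (simp add: \<psi>_def)
  qed
  then show "square_summable ((search_step n j ^^ T) (\<lambda>p. r * packet_state n 0 \<sigma> c p))"
    by (simp add: \<psi>_def)
  have close: "state_norm (\<lambda>p. \<psi> s p - \<Phi> s p) \<le> D + real s * G" if "s \<le> T" for s
    using that
  proof (induction s)
    case 0
    have "state_norm (\<lambda>p. \<psi> 0 p - \<Phi> 0 p)
        = state_norm (\<lambda>p. r * (packet_state n 0 \<sigma> c p - packet_state n j \<sigma> c p))"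
      by (simp add: \<psi>_def \<Phi>_def right_diff_distrib)
    also have "\<dots> \<le> 1 / N * sqrt (64 / \<sigma> * exp (2 * \<sigma> * (ln (3 * real n) - c)))"
      unfolding state_norm_scale r(2) using packet_state_translate(2)[OF \<sigma>(1) \<sigma>' j] N
      by (intro mult_left_mono) auto
    also have "\<dots> = sqrt ((1 / N)\<^sup>2 * (64 / \<sigma> * exp (2 * \<sigma> * (ln (3 * real n) - c))))"
      using N by (simp add: real_sqrt_mult real_sqrt_divide)
    also have "\<dots> \<le> D"
      unfolding D_def
    proof (rule real_sqrt_le_mono)
      have "ln (3 * real n) - c \<le> - b" using T by (simp add: c_def)
      then have "2 * \<sigma> * (ln (3 * real n) - c) \<le> 2 * \<sigma> * (- b)" using \<sigma> by (intro mult_left_mono) auto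
      then have "exp (2 * \<sigma> * (ln (3 * real n) - c)) \<le> exp (- 2 * \<sigma> * b)" by simp
      then have "(1 / N)\<^sup>2 * (64 / \<sigma> * exp (2 * \<sigma> * (ln (3 * real n) - c)))
          \<le> \<sigma> / 2 * (64 / \<sigma> * exp (- 2 * \<sigma> * b))"
        using r2 \<sigma> by (intro mult_mono) auto
      then show "(1 / N)\<^sup>2 * (64 / \<sigma> * exp (2 * \<sigma> * (ln (3 * real n) - c))) \<le> 32 * exp (- 2 * \<sigma> * b)"
        using \<sigma> by simp
    qed
    finally show ?case by simp
  next
    case (Suc s)
    let ?c = "c - pi * real s"
    \<comment> \<open>Every center met on the way is at least b, so the lattice-scale error exp (- 2
      \<sigma> b) serves for all steps.\<close>
    have cb: "b \<le> ?c"
    proof -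
      have "pi * real s \<le> pi * real T" using Suc.prems by (intro mult_left_mono) auto
      then show ?thesis by (simp add: c_def)
    qed
    have diff_sq: "square_summable (\<lambda>p. \<psi> s p - \<Phi> s p)" by (rule state_norm_diff(1)[OF \<psi>_sq \<Phi>_sq])
    have next_c: "c - pi * real (Suc s) = ?c - pi" by (simp add: algebra_simps)
    have eq: "(\<lambda>p. \<psi> (Suc s) p - \<Phi> (Suc s) p) = (\<lambda>p. search_step n j (\<lambda>p. \<psi> s p - \<Phi> s p) p
        + r * (search_step n j (packet_state n j \<sigma> ?c) p - packet_state n j \<sigma> (?c - pi) p))"
    proof
      fix p
      have "\<psi> (Suc s) = search_step n j (\<psi> s)" by (simp add: \<psi>_def)
      moreover have "search_step n j (\<lambda>p. \<psi> s p - \<Phi> s p) = (\<lambda>p. search_step n j (\<psi> s) p - search_step n j (\<Phi> s) p)"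
        by (rule search_step_diff[OF n \<psi>_sq \<Phi>_sq])
      moreover have "search_step n j (\<Phi> s) = (\<lambda>p. r * search_step n j (packet_state n j \<sigma> ?c) p)"
        unfolding \<Phi>_def by (rule search_step_scale)
      moreover have "\<Phi> (Suc s) p = r * packet_state n j \<sigma> (?c - pi) p" unfolding \<Phi>_def next_c ..
      ultimately show "\<psi> (Suc s) p - \<Phi> (Suc s) p = search_step n j (\<lambda>p. \<psi> s p - \<Phi> s p) p
          + r * (search_step n j (packet_state n j \<sigma> ?c) p - packet_state n j \<sigma> (?c - pi) p)"
        by (simp add: right_diff_distrib)
    qed
    have err_sq: "square_summable (\<lambda>p. search_step n j (packet_state n j \<sigma> ?c) p - packet_state n j \<sigma> (?c - pi) p)"
      by (intro state_norm_diff(1) square_summable_search_step(1)[OF n] square_summable_packet_state[OF \<sigma>(1) \<sigma>'])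
    have "state_norm (\<lambda>p. \<psi> (Suc s) p - \<Phi> (Suc s) p)
        \<le> state_norm (search_step n j (\<lambda>p. \<psi> s p - \<Phi> s p))
          + state_norm (\<lambda>p. r * (search_step n j (packet_state n j \<sigma> ?c) p - packet_state n j \<sigma> (?c - pi) p))"
      unfolding eq
      by (intro state_norm_triangle(2) square_summable_search_step(1)[OF n diff_sq] square_summable_scale err_sq)
    also have "state_norm (search_step n j (\<lambda>p. \<psi> s p - \<Phi> s p)) \<le> D + real s * G"
      using square_summable_search_step(2)[OF n diff_sq, of j] Suc by simp
    also have "state_norm (\<lambda>p. r * (search_step n j (packet_state n j \<sigma> ?c) p - packet_state n j \<sigma> (?c - pi) p))
        \<le> 1 / N * (C * sqrt (16 * \<sigma> ^ 3 + Z * exp (- 2 * \<sigma> * ?c)))"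
      unfolding state_norm_scale r(2)
      using CZ \<sigma> j N unfolding step_bounds_def by (intro mult_left_mono) auto
    also have "\<dots> \<le> G"
    proof -
      have "exp (- 2 * \<sigma> * ?c) \<le> exp (- 2 * \<sigma> * b)" using cb \<sigma> by simp
      then have le: "Z * exp (- 2 * \<sigma> * ?c) \<le> Z * exp (- 2 * \<sigma> * b)" by (rule mult_left_mono[OF _ C(2)])
      have Ze: "0 \<le> Z * exp (- 2 * \<sigma> * ?c)" "0 \<le> Z * exp (- 2 * \<sigma> * b)" using C by auto
      have "(1 / N)\<^sup>2 * (16 * \<sigma> ^ 3 + Z * exp (- 2 * \<sigma> * ?c))
          \<le> \<sigma> / 2 * (16 * \<sigma> ^ 3 + Z * exp (- 2 * \<sigma> * b))"
        by (rule mult_mono[OF r2 add_left_mono[OF le]]) (use \<sigma> C(2) in auto)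
      also have "\<dots> = 8 * \<sigma> ^ 4 + \<sigma> / 2 * (Z * exp (- 2 * \<sigma> * b))"
        by (simp add: algebra_simps eval_nat_numeral)
      also have "\<sigma> / 2 * (Z * exp (- 2 * \<sigma> * b)) \<le> 1 * (Z * exp (- 2 * \<sigma> * b))"
        using \<sigma> Ze by (intro mult_right_mono) auto
      finally have s1: "sqrt ((1 / N)\<^sup>2 * (16 * \<sigma> ^ 3 + Z * exp (- 2 * \<sigma> * ?c)))
          \<le> sqrt (8 * \<sigma> ^ 4 + Z * exp (- 2 * \<sigma> * b))" by simp
      have s2: "sqrt ((1 / N)\<^sup>2 * (16 * \<sigma> ^ 3 + Z * exp (- 2 * \<sigma> * ?c)))
          = 1 / N * sqrt (16 * \<sigma> ^ 3 + Z * exp (- 2 * \<sigma> * ?c))"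
        using N by (simp add: real_sqrt_mult real_sqrt_divide)
      have "C * (1 / N * sqrt (16 * \<sigma> ^ 3 + Z * exp (- 2 * \<sigma> * ?c))) \<le> G"
        unfolding G_def by (rule mult_left_mono[OF s1[unfolded s2] less_imp_le[OF C(1)]])
      then show ?thesis by (simp add: mult.left_commute)
    qed
    finally show ?case by (simp add: algebra_simps)
  qed
  have G0: "0 \<le> G" "0 \<le> D" using C \<sigma> by (auto simp: G_def D_def)
  have "(state_norm (\<lambda>p. \<psi> T p - \<Phi> T p))\<^sup>2 \<le> (D + real T * G)\<^sup>2"
    using close[of T] by (intro power_mono state_norm_nonneg) auto
  also have "\<dots> \<le> 2 * D\<^sup>2 + 2 * (real T * G)\<^sup>2"
    using zero_le_power2[of "D - real T * G"] by (simp add: power2_eq_square algebra_simps)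
  also have "\<dots> = 64 * exp (- 2 * \<sigma> * b) + 2 * (real T)\<^sup>2 * C\<^sup>2 * (8 * \<sigma> ^ 4 + Z * exp (- 2 * \<sigma> * b))"
    using C \<sigma> by (simp add: D_def G_def power_mult_distrib)
  finally show "(state_norm (\<lambda>p. (search_step n j ^^ T) (\<lambda>p. r * packet_state n 0 \<sigma> c p) p
      - r * packet_state n j \<sigma> b p))\<^sup>2
    \<le> 64 * exp (- 2 * \<sigma> * b) + 2 * (real T)\<^sup>2 * C\<^sup>2 * (8 * \<sigma> ^ 4 + Z * exp (- 2 * \<sigma> * b))"
    by (simp add: \<psi>_def \<Phi>_def c_def)
qed

text \<open>The window of width \<open>2 ^ (\<kappa> + 2)\<close> contains the answer unless the measured site is further
  than \<open>2 ^ (\<kappa> + 1)\<close> from it.\<close>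

definition window_start :: "nat \<Rightarrow> nat \<Rightarrow> nat \<times> nat \<Rightarrow> nat" where
  "window_start n \<kappa> p = nat (position n p - (2 ^ (\<kappa> + 1) - 1))"

text \<open>The condition on \<kappa> makes 2^\<kappa> at least exp (2 b), the square of the packet
  scale exp b. The tail of the ideal packet beyond the window is then of the same order exp (- 2
  \<sigma> b) as the other errors.\<close>

lemma search_state_tail:
  fixes n j T \<kappa> :: nat and \<sigma> b C Z :: real
  assumes CZ: "step_bounds C Z" and \<sigma>: "0 < \<sigma>" "\<sigma> \<le> 1 / 16" and j: "j < n"
    and b: "0 \<le> b" and T: "ln (3 * real n) \<le> pi * real T" and \<kappa>: "2 * b \<le> real \<kappa> * ln 2"
    and B: "finite B" "\<And>p. p \<in> B \<Longrightarrow> \<not> (window_start n \<kappa> p \<le> j \<and> j < window_start n \<kappa> p + 2 ^ (\<kappa> + 2))"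
  defines "c \<equiv> pi * real T + b"
  defines "r \<equiv> complex_of_real (1 / state_norm (packet_state n 0 \<sigma> c))"
  shows "(\<Sum>p\<in>B. (cmod ((search_step n j ^^ T) (\<lambda>p. r * packet_state n 0 \<sigma> c p) p))\<^sup>2)
    \<le> 132 * exp (- 2 * \<sigma> * b) + 4 * (real T)\<^sup>2 * C\<^sup>2 * (8 * \<sigma> ^ 4 + Z * exp (- 2 * \<sigma> * b))"
proof -
  define \<psi> where "\<psi> = (search_step n j ^^ T) (\<lambda>p. r * packet_state n 0 \<sigma> c p)"
  define \<Phi> where "\<Phi> = (\<lambda>p. r * packet_state n j \<sigma> b p)"
  note close = search_state_close[OF CZ \<sigma> j b T, folded c_def, folded r_def, folded \<psi>_def]
  have close2: "(state_norm (\<lambda>p. \<psi> p - \<Phi> p))\<^sup>2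
      \<le> 64 * exp (- 2 * \<sigma> * b) + 2 * (real T)\<^sup>2 * C\<^sup>2 * (8 * \<sigma> ^ 4 + Z * exp (- 2 * \<sigma> * b))"
    using close(2) by (simp only: \<Phi>_def)
  have \<sigma>': "\<sigma> \<le> 1 / 2" using \<sigma> by simp
  have "square_summable \<Phi>"
    unfolding \<Phi>_def by (rule square_summable_scale[OF square_summable_packet_state[OF \<sigma>(1) \<sigma>']])
  then have diff_sq: "square_summable (\<lambda>p. \<psi> p - \<Phi> p)"
    using state_norm_diff(1)[OF close(1)] by simp
  define K where "K = 2 ^ (\<kappa> + 1) - (1::nat)"
  have K: "real K = 2 ^ (\<kappa> + 1) - 1" by (simp add: K_def of_nat_diff)
  have Kint: "int K = 2 ^ (\<kappa> + 1) - 1" by (simp add: K_def of_nat_diff)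
  \<comment> \<open>Before truncation at 0 the window is a - K, ..., a + K + 1, of width 2 K + 2; it
    is symmetric for the distance a - j + 1/2. Truncation only shifts it upwards, and j \<ge> 0
    stays inside.\<close>
  have far: "real K + 1 / 2 < \<bar>of_int (a - int j) + 1 / 2\<bar>" if "site n a \<in> B" for a
  proof (rule ccontr)
    assume "\<not> ?thesis"
    then have "of_int (a - int j) \<le> real K" "- (real K + 1) \<le> of_int (a - int j)" by (auto simp: abs_le_iff not_less)
    then have "real_of_int (a - int j) \<le> real_of_int (int K)" "real_of_int (- (int K + 1)) \<le> real_of_int (a - int j)"
      by simp_all
    then have a: "a - int j \<le> int K" "- (int K + 1) \<le> a - int j" by (simp_all only: of_int_le_iff)
    have "(2::int) ^ (\<kappa> + 2) = 2 * int K + 2" using Kint by simp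
    then have w: "int (window_start n \<kappa> (site n a) + 2 ^ (\<kappa> + 2)) = int (nat (a - int K)) + 2 * int K + 2"
      by (simp add: window_start_def Kint)
    have ws: "window_start n \<kappa> (site n a) = nat (a - int K)"
      unfolding window_start_def Kint by simp
    have "window_start n \<kappa> (site n a) \<le> j"
      unfolding ws using a by (simp add: nat_le_iff)
    moreover have "int j < int (window_start n \<kappa> (site n a) + 2 ^ (\<kappa> + 2))"
      unfolding w using a by linarith
    then have "j < window_start n \<kappa> (site n a) + 2 ^ (\<kappa> + 2)" by (simp only: of_nat_less_iff)
    ultimately show False using B(2)[OF that] by blast
  qed
  have \<Phi>_tail: "(\<Sum>p\<in>B. (cmod (\<Phi> p))\<^sup>2) \<le> 2 * exp (- 2 * \<sigma> * b)"
  proof -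
    define A where "A = (\<lambda>p. position n p - int j) ` (B \<inter> range (site n))"
    have "(\<Sum>p\<in>B. (cmod (packet_state n j \<sigma> b p))\<^sup>2)
        = (\<Sum>p\<in>B \<inter> range (site n). (packet \<sigma> b (of_int (position n p - int j) + 1 / 2))\<^sup>2)"
      using B(1) by (intro sum.mono_neutral_cong_right) (auto simp: packet_state_def lift_state_def simp flip: of_int_diff)
    also have "\<dots> = (\<Sum>a\<in>A. (packet \<sigma> b (of_int a + 1 / 2))\<^sup>2)"
    proof -
      have "inj_on (\<lambda>p. position n p - int j) (B \<inter> range (site n))"
        by (rule inj_on_inverseI[of _ "\<lambda>a. site n (a + int j)"]) auto
      then show ?thesis by (simp add: A_def sum.reindex)
    qed
    also have "\<dots> \<le> 4 / \<sigma> * exp (2 * \<sigma> * (b - ln (real K + 1 / 2)))"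
      by (rule packet_tail[OF \<sigma>(1) \<sigma>']) (use B(1) far in \<open>auto simp: A_def\<close>)
    also have "\<dots> \<le> 4 / \<sigma> * exp (- 2 * \<sigma> * b)"
    proof -
      have "(2::real) ^ \<kappa> \<le> real K + 1 / 2"
      proof -
        have "(1::real) \<le> 2 ^ \<kappa>" "(2::real) ^ (\<kappa> + 1) = 2 * 2 ^ \<kappa>" by simp_all
        then show ?thesis unfolding K by linarith
      qed
      then have "ln (2 ^ \<kappa>) \<le> ln (real K + 1 / 2)" by (subst ln_le_cancel_iff) auto
      then have "2 * b \<le> ln (real K + 1 / 2)" using \<kappa> by (simp add: ln_realpow)
      then have "2 * \<sigma> * (b - ln (real K + 1 / 2)) \<le> 2 * \<sigma> * (- b)" using \<sigma> by (intro mult_left_mono) auto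
      then show ?thesis using \<sigma> by (intro mult_left_mono) auto
    qed
    finally have "(cmod r)\<^sup>2 * (\<Sum>p\<in>B. (cmod (packet_state n j \<sigma> b p))\<^sup>2) \<le> \<sigma> / 2 * (4 / \<sigma> * exp (- 2 * \<sigma> * b))"
      using close(3) \<sigma> by (intro mult_mono sum_nonneg) auto
    then show ?thesis using \<sigma> by (simp add: \<Phi>_def norm_mult power_mult_distrib sum_distrib_left)
  qed
  have "(cmod (\<psi> p))\<^sup>2 \<le> 2 * (cmod (\<Phi> p))\<^sup>2 + 2 * (cmod (\<psi> p - \<Phi> p))\<^sup>2" for p
  proof -
    have "cmod (\<psi> p) \<le> cmod (\<Phi> p) + cmod (\<psi> p - \<Phi> p)"
      using norm_triangle_ineq[of "\<Phi> p" "\<psi> p - \<Phi> p"] by simp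
    then have "(cmod (\<psi> p))\<^sup>2 \<le> (cmod (\<Phi> p) + cmod (\<psi> p - \<Phi> p))\<^sup>2" by (intro power_mono) auto
    also have "\<dots> \<le> 2 * (cmod (\<Phi> p))\<^sup>2 + 2 * (cmod (\<psi> p - \<Phi> p))\<^sup>2"
      using zero_le_power2[of "cmod (\<Phi> p) - cmod (\<psi> p - \<Phi> p)"] by (simp add: power2_eq_square algebra_simps)
    finally show ?thesis .
  qed
  then have "(\<Sum>p\<in>B. (cmod (\<psi> p))\<^sup>2) \<le> (\<Sum>p\<in>B. 2 * (cmod (\<Phi> p))\<^sup>2 + 2 * (cmod (\<psi> p - \<Phi> p))\<^sup>2)"
    by (rule sum_mono)
  also have "\<dots> = 2 * (\<Sum>p\<in>B. (cmod (\<Phi> p))\<^sup>2) + 2 * (\<Sum>p\<in>B. (cmod (\<psi> p - \<Phi> p))\<^sup>2)"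
    by (simp add: sum.distrib sum_distrib_left)
  also have "\<dots> \<le> 2 * (2 * exp (- 2 * \<sigma> * b)) + 2 * (64 * exp (- 2 * \<sigma> * b)
      + 2 * (real T)\<^sup>2 * C\<^sup>2 * (8 * \<sigma> ^ 4 + Z * exp (- 2 * \<sigma> * b)))"
    using \<Phi>_tail order_trans[OF square_summable_finite_le[OF diff_sq B(1)] close2]
    by (intro add_mono mult_left_mono) auto
  also have "\<dots> = 132 * exp (- 2 * \<sigma> * b) + 4 * (real T)\<^sup>2 * C\<^sup>2 * (8 * \<sigma> ^ 4 + Z * exp (- 2 * \<sigma> * b))"
    by (simp add: algebra_simps)
  finally show ?thesis unfolding \<psi>_def .
qed

section \<open>The search algorithm\<close>

lemma packet_state_in_space:
  assumes "1 \<le> n" "0 < \<sigma>" "\<sigma> \<le> 1 / 2"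
  shows "(\<lambda>p. r * packet_state n j \<sigma> c p) \<in> hilbert_space n UNIV"
proof -
  have "packet_state n j \<sigma> c p = 0" if "p \<notin> {..<n} \<times> UNIV" for p
    using site_in_space[OF assms(1)] that unfolding packet_state_def lift_state_def by (metis imageE)
  then show ?thesis
    using square_summable_scale[OF square_summable_packet_state[OF assms(2,3)]]
    by (simp add: in_hilbert_space_iff)
qed

theorem corollary3p5:
  "\<exists>A :: nat \<Rightarrow> query_algorithm.
     (\<forall>n\<ge>1. zero_error_ordered_search n (A n) \<and> expected_query_complexity n (A n) < \<infinity>) \<and>
     (\<lambda>n. enn2real (expected_query_complexity n (A n)) - ln (real n) / pi)
       \<in> o[at_top](\<lambda>n. ln (real n))"
proof -
  obtain C Z where CZ: "step_bounds C Z" using step_bounds_exist by blast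
  then have C: "0 < C" "0 \<le> Z" by (auto simp: step_bounds_def)
  \<comment> \<open>The summand 3 exceeds ln 3, so the T shifts cover the scale 3n of the
    translation estimate; it also keeps L \<ge> 3 for n = 1.\<close>
  define L where "L = (\<lambda>n::nat. ln (real n) + 3)"
  \<comment> \<open>A failure costs about L further queries, so L (L \<sigma>^2)^2 has to be o(L):
    \<sigma> must decay faster than L^(-1/2). On the other hand \<sigma> b must outgrow ln L while b
    = o(L), so the decay must be slower than 1 / L. The exponent 3/4 lies midway, and 7/8 is midway
    between 3/4 and 1. The divisor 16 ensures \<sigma> \<le> 1/16.\<close>
  define \<sigma> where "\<sigma> = (\<lambda>n. L n powr (- 3 / 4) / 16)"
  define b where "b = (\<lambda>n. L n powr (7 / 8))"
  define T where "T = (\<lambda>n. nat \<lceil>L n / pi\<rceil>)"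
  define \<kappa> where "\<kappa> = (\<lambda>n. nat \<lceil>2 * b n / ln 2\<rceil>)"
  \<comment> \<open>The factor 2 gives n \<le> 2^K because ln 2 \<ge> 1/2.\<close>
  define K where "K = (\<lambda>n. nat \<lceil>2 * L n\<rceil>)"
  define c where "c = (\<lambda>n. pi * real (T n) + b n)"
  define r where "r = (\<lambda>n. complex_of_real (1 / state_norm (packet_state n 0 (\<sigma> n) (c n))))"
  define A where "A = (\<lambda>n. search_algorithm (lattice_kernel n) (\<lambda>p. r n * packet_state n 0 (\<sigma> n) (c n) p)
    (T n) (window_start n (\<kappa> n)) n (\<kappa> n + 2) (K n))"
  define \<epsilon> where "\<epsilon> = (\<lambda>n. exp (- 2 * \<sigma> n * b n))"
  define \<delta> where "\<delta> = (\<lambda>n. 132 * \<epsilon> n + 4 * (L n)\<^sup>2 * C\<^sup>2 * (8 * \<sigma> n ^ 4 + Z * \<epsilon> n))"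
  \<comment> \<open>The constant absorbs roundings and the verification queries, 4 b the window
    search; the last summand is the cost of a full binary search weighted with its
    probability.\<close>
  define err where "err = (\<lambda>n. 10 + 4 * b n + (2 * L n + 1) * \<delta> n)"
  \<comment> \<open>The deviation is nonnegative because at least T \<ge> ln n / pi queries are
    always made. A one-sided upper bound therefore controls its absolute value, as the Landau symbol
    requires.\<close>
  have bounds: "zero_error_ordered_search n (A n) \<and> expected_query_complexity n (A n) < \<infinity> \<and>
      0 \<le> enn2real (expected_query_complexity n (A n)) - ln (real n) / pi \<and>
      enn2real (expected_query_complexity n (A n)) - ln (real n) / pi \<le> err n" if n: "1 \<le> n" for n
  proof -
    have ln2: "1 / 2 \<le> ln (2::real)" "0 < ln (2::real)" using ln2_ge_two_thirds by simp_all
    have L: "3 \<le> L n" using n by (simp add: L_def)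
    have \<sigma>: "0 < \<sigma> n" "\<sigma> n \<le> 1 / 16"
    proof -
      have "L n powr (- 3 / 4) \<le> 1 powr (- 3 / 4)" using L by (intro powr_mono2') auto
      then show "\<sigma> n \<le> 1 / 16" by (simp add: \<sigma>_def)
    qed (use L in \<open>simp add: \<sigma>_def\<close>)
    have \<sigma>': "\<sigma> n \<le> 1 / 2" using \<sigma> by simp
    have b: "0 \<le> b n" by (simp add: b_def)
    have T: "L n / pi \<le> real (T n)" "real (T n) \<le> L n / pi + 1"
    proof -
      have "0 \<le> L n / pi" using L by simp
      then show "L n / pi \<le> real (T n)" "real (T n) \<le> L n / pi + 1" unfolding T_def by linarith+
    qed
    have T_ge: "ln (3 * real n) \<le> pi * real (T n)"
    proof -
      have "ln (3 :: real) \<le> 3" using ln_le_minus_one[of "3::real"] by simp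
      then have "ln (3 * real n) \<le> L n" using n by (simp add: L_def ln_mult)
      also have "L n = pi * (L n / pi)" by simp
      also have "\<dots> \<le> pi * real (T n)" using T by (intro mult_left_mono) auto
      finally show ?thesis .
    qed
    have T_le: "real (T n) \<le> L n"
    proof -
      have "L n / pi \<le> L n / 3" using L pi_gt3 by (intro divide_left_mono) auto
      then show ?thesis using T L by linarith
    qed
    have \<kappa>: "2 * b n \<le> real (\<kappa> n) * ln 2" "real (\<kappa> n) \<le> 4 * b n + 1"
    proof -
      have x: "0 \<le> 2 * b n / ln 2" using b ln2 by simp
      then have "2 * b n / ln 2 \<le> real (\<kappa> n)" unfolding \<kappa>_def by linarith
      then show "2 * b n \<le> real (\<kappa> n) * ln 2" using ln2 by (simp add: pos_divide_le_eq)
      have "real (\<kappa> n) \<le> 2 * b n / ln 2 + 1" using x unfolding \<kappa>_def by linarith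
      also have "2 * b n / ln 2 \<le> 2 * b n / (1 / 2)" using b ln2 by (intro divide_left_mono) auto
      finally show "real (\<kappa> n) \<le> 4 * b n + 1" by simp
    qed
    have K: "n \<le> 2 ^ K n" "real (K n) \<le> 2 * L n + 1"
    proof -
      have "0 \<le> 2 * L n" using L by simp
      then have K2: "2 * L n \<le> real (K n)" "real (K n) \<le> 2 * L n + 1" unfolding K_def by linarith+
      then show "real (K n) \<le> 2 * L n + 1" by simp
      have "ln (real n) \<le> 2 * L n * (1 / 2)" by (simp add: L_def)
      also have "\<dots> \<le> real (K n) * ln 2" using K2 ln2 L by (intro mult_mono) auto
      also have "\<dots> = ln (2 ^ K n)" by (simp add: ln_realpow)
      finally have "real n \<le> 2 ^ K n" using n by (subst (asm) ln_le_cancel_iff) auto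
      then have "real n \<le> real (2 ^ K n)" by simp
      then show "n \<le> 2 ^ K n" by (simp only: of_nat_le_iff)
    qed
    have step: "search_step n j = (\<lambda>\<psi>. kernel_operator (lattice_kernel n) (phase_oracle (ordered_input j) \<psi>))" for j
      by (simp add: search_step_def fun_eq_iff)
    have \<epsilon>0: "0 \<le> \<epsilon> n" by (simp add: \<epsilon>_def)
    have \<delta>0: "0 \<le> \<delta> n" using \<epsilon>0 C \<sigma> by (simp add: \<delta>_def)
    have norm: "state_norm (\<lambda>p. r n * packet_state n 0 (\<sigma> n) (c n) p) = 1"
      using search_state_close(4)[OF CZ \<sigma>, of 0 n "b n" "T n"] n b T_ge by (simp add: r_def c_def)
    have fail: "(\<Sum>p\<in>B. (cmod ((search_step n j ^^ T n) (\<lambda>p. r n * packet_state n 0 (\<sigma> n) (c n) p) p))\<^sup>2) \<le> \<delta> n"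
      if j: "j < n" and B: "finite B"
        "\<And>p. p \<in> B \<Longrightarrow> \<not> (window_start n (\<kappa> n) p \<le> j \<and> j < window_start n (\<kappa> n) p + 2 ^ (\<kappa> n + 2))" for j B
    proof -
      have "(\<Sum>p\<in>B. (cmod ((search_step n j ^^ T n) (\<lambda>p. r n * packet_state n 0 (\<sigma> n) (c n) p) p))\<^sup>2)
          \<le> 132 * \<epsilon> n + 4 * (real (T n))\<^sup>2 * C\<^sup>2 * (8 * \<sigma> n ^ 4 + Z * \<epsilon> n)"
        unfolding r_def c_def \<epsilon>_def by (rule search_state_tail[OF CZ \<sigma> j b T_ge \<kappa>(1) B])
      also have "\<dots> \<le> \<delta> n"
        unfolding \<delta>_def using T_le C \<sigma> \<epsilon>0
        by (intro add_left_mono mult_right_mono mult_left_mono power_mono) auto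
      finally show ?thesis .
    qed
    note correct = search_algorithm_correct[OF orthogonal_lattice_kernel[OF n]
      packet_state_in_space[OF n \<sigma>(1) \<sigma>'] norm n K(1),
      where t = "T n" and lo = "window_start n (\<kappa> n)" and k = "\<kappa> n + 2", folded step]
    define U where "U = real (T n) + 2 + real (\<kappa> n + 2) + real (K n) * \<delta> n"
    have A_unfold: "search_algorithm (lattice_kernel n) (\<lambda>p. r n * packet_state n 0 (\<sigma> n) (c n) p)
        (T n) (window_start n (\<kappa> n)) n (\<kappa> n + 2) (K n) = A n" by (simp add: A_def)
    have lower: "ennreal (real (T n)) \<le> expected_query_complexity n (A n)"
    proof -
      have "ennreal (real (T n)) \<le> expected_queries (ordered_input 0) (A n)"
        using correct(2)[of 0] n unfolding A_unfold by simp
      also have "\<dots> \<le> expected_query_complexity n (A n)"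
        unfolding expected_query_complexity_def using n by (intro SUP_upper) auto
      finally show ?thesis .
    qed
    have upper: "expected_query_complexity n (A n) \<le> ennreal U"
      unfolding expected_query_complexity_def
    proof (rule SUP_least)
      fix j assume "j \<in> {..<n}"
      then have j: "j < n" by simp
      show "expected_queries (ordered_input j) (A n) \<le> ennreal U"
        using correct(3)[OF j \<delta>0 fail[OF j]] unfolding A_unfold U_def .
    qed
    have U0: "0 \<le> U" using \<delta>0 by (simp add: U_def)
    have fin: "expected_query_complexity n (A n) < \<infinity>"
      using le_less_trans[OF upper] by (simp add: ennreal_less_top)
    have "real (T n) \<le> enn2real (expected_query_complexity n (A n))"
      using enn2real_mono[OF lower] fin by simp
    moreover have "ln (real n) / pi \<le> L n / pi" by (intro divide_right_mono) (auto simp: L_def)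
    ultimately have ge: "0 \<le> enn2real (expected_query_complexity n (A n)) - ln (real n) / pi"
      using T by linarith
    have "enn2real (expected_query_complexity n (A n)) \<le> U"
      using enn2real_mono[OF upper] U0 by simp
    moreover have "real (K n) * \<delta> n \<le> (2 * L n + 1) * \<delta> n" using K \<delta>0 by (intro mult_right_mono)
    moreover have "L n / pi = ln (real n) / pi + 3 / pi" by (simp add: L_def add_divide_distrib)
    moreover have "3 / pi \<le> 1" using pi_gt3 by simp
    ultimately have "enn2real (expected_query_complexity n (A n)) - ln (real n) / pi \<le> err n"
      using T \<kappa> unfolding err_def U_def of_nat_add of_nat_numeral by linarith
    then show ?thesis using correct(1) fin ge unfolding A_unfold by blast
  qed
  have err_small: "err \<in> o[at_top](\<lambda>n. ln (real n))"
  proof -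
    have 1: "(\<lambda>n. 10 + 4 * b n) \<in> o[at_top](\<lambda>n. ln (real n))"
      unfolding b_def L_def by real_asymp
    have 2: "(\<lambda>n. (2 * L n + 1) * \<epsilon> n) \<in> o[at_top](\<lambda>n. ln (real n))"
      unfolding \<epsilon>_def \<sigma>_def b_def L_def by real_asymp
    have 3: "(\<lambda>n. (2 * L n + 1) * (L n)\<^sup>2 * \<epsilon> n) \<in> o[at_top](\<lambda>n. ln (real n))"
      unfolding \<epsilon>_def \<sigma>_def b_def L_def by real_asymp
    \<comment> \<open>Here L^3 \<sigma>^4 is constant, so failures caused by the Taylor errors cost
      only a bounded number of queries on average.\<close>
    have 4: "(\<lambda>n. (2 * L n + 1) * (L n)\<^sup>2 * \<sigma> n ^ 4) \<in> o[at_top](\<lambda>n. ln (real n))"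
      unfolding \<sigma>_def L_def by real_asymp
    have scale: "(\<lambda>n. d * f n) \<in> o[at_top](\<lambda>n. ln (real n))"
      if "f \<in> o[at_top](\<lambda>n. ln (real n))" for d :: real and f
      using that by (cases "d = 0") auto
    have "(\<lambda>n. (10 + 4 * b n) + 132 * ((2 * L n + 1) * \<epsilon> n)
        + ((32 * C\<^sup>2) * ((2 * L n + 1) * (L n)\<^sup>2 * \<sigma> n ^ 4)
          + (4 * C\<^sup>2 * Z) * ((2 * L n + 1) * (L n)\<^sup>2 * \<epsilon> n))) \<in> o[at_top](\<lambda>n. ln (real n))"
      by (rule sum_in_smallo(1)[OF sum_in_smallo(1)[OF 1 scale[OF 2]]
        sum_in_smallo(1)[OF scale[OF 4] scale[OF 3]]])
    moreover have "(10 + 4 * b n) + 132 * ((2 * L n + 1) * \<epsilon> n)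
        + ((32 * C\<^sup>2) * ((2 * L n + 1) * (L n)\<^sup>2 * \<sigma> n ^ 4)
          + (4 * C\<^sup>2 * Z) * ((2 * L n + 1) * (L n)\<^sup>2 * \<epsilon> n)) = err n" for n
      by (simp add: err_def \<delta>_def algebra_simps)
    ultimately show ?thesis by simp
  qed
  have "(\<lambda>n. enn2real (expected_query_complexity n (A n)) - ln (real n) / pi) \<in> O[at_top](err)"
  proof (rule bigoI[where c = 1])
    show "\<forall>\<^sub>F n in at_top. norm (enn2real (expected_query_complexity n (A n)) - ln (real n) / pi) \<le> 1 * norm (err n)"
      using eventually_ge_at_top[of 1]
    proof eventually_elim
      case (elim n)
      then show ?case using bounds[of n] by (simp add: abs_of_nonneg)
    qed
  qed
  from landau_o.big_small_trans[OF this err_small]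
  have "(\<lambda>n. enn2real (expected_query_complexity n (A n)) - ln (real n) / pi) \<in> o[at_top](\<lambda>n. ln (real n))" .
  then show ?thesis using bounds by blast
qed

end
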